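(* Let $p$ be an odd prime, let $k\ge 1$ be an integer, and let $H=\mathfrak S_{p^{k-1}}\wr\mathfrak S_p\le\mathfrak S_{p^k}$. If $\chi\in\mathrm{Irr}_{p'}(\mathfrak S_{p^k})$, then $\chi\downarrow_H=\chi^*+\Delta$, where $\chi^*\in\mathrm{Irr}_{p'}(H)$ and $\Delta$ is a (possibly empty) sum of irreducible characters of $H$ of degree divisible by $p$. Moreover, the map $\chi\mapsto\chi^*$ is a bijection between $\mathrm{Irr}_{p'}(\mathfrak S_{p^k})$ and $\mathrm{Irr}_{p'}(\mathfrak S_{p^{k-1}}\wr\mathfrak S_p)$.
   Context: $\mathrm{Irr}_{p'}(G)$ denotes the set of complex irreducible characters of the finite group $G$ of degree coprime to $p$. $H=\mathfrak S_{p^{k-1}}\wr\mathfrak S_p$ is embedded in $\mathfrak S_{p^k}$ as the stabilizer of a set partition of $\{1,\dots,p^k\}$ into $p$ sets of size $p^{k-1}$. $\chi\downarrow_H$ is restriction. *)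

theory Defs
  imports
    "Jordan_Normal_Form.VS_Connect"
    "HOL-Algebra.Sym_Groups"
    "HOL-Algebra.Group_Action"
    "HOL-Library.Disjoint_Sets"
    "HOL-Library.Multiset"
begin

definition GL :: "nat \<Rightarrow> complex mat monoid" where
  "GL n = units_of (ring_mat TYPE(complex) n ())"

definition representation :: "('g, 'b) monoid_scheme \<Rightarrow> nat \<Rightarrow> ('g \<Rightarrow> complex mat) \<Rightarrow> bool" where
  "representation G n \<rho> \<longleftrightarrow> \<rho> \<in> hom G (GL n)"

definition invariant_subspace ::
  "('g, 'b) monoid_scheme \<Rightarrow> nat \<Rightarrow> ('g \<Rightarrow> complex mat) \<Rightarrow> complex vec set \<Rightarrow> bool" where
  "invariant_subspace G n \<rho> W \<longleftrightarrow>
     VectorSpace.subspace class_ring W (module_vec TYPE(complex) n) \<and>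
     (\<forall>g\<in>carrier G. \<forall>w\<in>W. \<rho> g *\<^sub>v w \<in> W)"

definition irreducible_representation ::
  "('g, 'b) monoid_scheme \<Rightarrow> nat \<Rightarrow> ('g \<Rightarrow> complex mat) \<Rightarrow> bool" where
  "irreducible_representation G n \<rho> \<longleftrightarrow>
     representation G n \<rho> \<and> n > 0 \<and>
     (\<forall>W. invariant_subspace G n \<rho> W \<longrightarrow> W = {0\<^sub>v n} \<or> W = carrier_vec n)"

definition mat_trace :: "complex mat \<Rightarrow> complex" where
  "mat_trace A = (\<Sum>i<dim_row A. A $$ (i, i))"

text \<open>Class functions on \<open>G\<close> are extensional functions on the carrier, so that two of them are
  equal in HOL exactly when they agree on \<open>G\<close>; in particular \<open>restrict \<chi> (carrier H)\<close> is the
  restriction of a character of \<open>G\<close> to a subgroup \<open>H\<close>.\<close>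

definition character_of :: "('g, 'b) monoid_scheme \<Rightarrow> ('g \<Rightarrow> complex mat) \<Rightarrow> 'g \<Rightarrow> complex" where
  "character_of G \<rho> = (\<lambda>g\<in>carrier G. mat_trace (\<rho> g))"

definition Irr :: "('g, 'b) monoid_scheme \<Rightarrow> ('g \<Rightarrow> complex) set" where
  "Irr G = {character_of G \<rho> | n \<rho>. irreducible_representation G n \<rho>}"

definition char_degree :: "('g, 'b) monoid_scheme \<Rightarrow> ('g \<Rightarrow> complex) \<Rightarrow> nat" where
  "char_degree G \<chi> = (THE d. \<chi> \<one>\<^bsub>G\<^esub> = of_nat d)"

definition Irr_p' :: "nat \<Rightarrow> ('g, 'b) monoid_scheme \<Rightarrow> ('g \<Rightarrow> complex) set" where
  "Irr_p' p G = {\<chi> \<in> Irr G. coprime (char_degree G \<chi>) p}"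

text \<open>The sum is taken over a multiset, so constituents may be repeated and the sum may be
  empty.\<close>

definition sum_of_irr_div :: "nat \<Rightarrow> ('g, 'b) monoid_scheme \<Rightarrow> ('g \<Rightarrow> complex) \<Rightarrow> bool" where
  "sum_of_irr_div p G \<Delta> \<longleftrightarrow>
     (\<exists>M. (\<forall>\<psi>\<in>#M. \<psi> \<in> Irr G \<and> p dvd char_degree G \<psi>) \<and>
          \<Delta> = (\<lambda>g\<in>carrier G. \<Sum>\<psi>\<in>#M. \<psi> g))"

text \<open>\<open>\<psi>\<close> plays the role of \<open>\<chi>\<^sup>*\<close> in \<open>\<chi>\<down>\<^sub>H = \<chi>\<^sup>* + \<Delta>\<close>.\<close>

definition is_star :: "nat \<Rightarrow> ('g, 'b) monoid_scheme \<Rightarrow> ('g \<Rightarrow> complex) \<Rightarrow> ('g \<Rightarrow> complex) \<Rightarrow> bool" where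
  "is_star p H \<chi> \<psi> \<longleftrightarrow>
     \<psi> \<in> Irr_p' p H \<and>
     (\<exists>\<Delta>. sum_of_irr_div p H \<Delta> \<and>
          restrict \<chi> (carrier H) = (\<lambda>h\<in>carrier H. \<psi> h + \<Delta> h))"

text \<open>For a partition \<open>P\<close> of \<open>{1..n}\<close> into \<open>b\<close> sets of size \<open>a\<close> this is the wreath product
  of the symmetric group of degree \<open>a\<close> by the symmetric group of degree \<open>b\<close>, the blocks
  being permuted among themselves.\<close>

definition partition_stabilizer :: "nat \<Rightarrow> nat set set \<Rightarrow> (nat \<Rightarrow> nat) monoid" where
  "partition_stabilizer n P =
     (sym_group n)\<lparr>carrier := stabilizer (sym_group n) (\<lambda>\<sigma> Q. (`) \<sigma> ` Q) P\<rparr>"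

lemma char_degree_character_of:
  assumes "group G" "representation G n \<rho>"
  shows "char_degree G (character_of G \<rho>) = n"
proof -
  interpret R: ring "ring_mat TYPE(complex) n ()" by (rule ring_mat)
  have "group (GL n)" unfolding GL_def by (rule R.units_group)
  then have "\<rho> \<one>\<^bsub>G\<^esub> = \<one>\<^bsub>GL n\<^esub>"
    using assms hom_one unfolding representation_def by blast
  then have "\<rho> \<one>\<^bsub>G\<^esub> = 1\<^sub>m n" by (simp add: GL_def units_of_def ring_mat_simps)
  then have "character_of G \<rho> \<one>\<^bsub>G\<^esub> = of_nat n"
    using assms(1) by (simp add: character_of_def mat_trace_def group.is_monoid)
  then show ?thesis unfolding char_degree_def by simp
qed

lemma carrier_partition_stabilizer:
  "carrier (partition_stabilizer n P) = {\<sigma>. \<sigma> permutes {1..n} \<and> (`) \<sigma> ` P = P}"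
  by (auto simp: partition_stabilizer_def stabilizer_def sym_group_def)

lemma group_partition_stabilizer: "group (partition_stabilizer n P)"
proof -
  interpret S: group "sym_group n" by (rule sym_group_is_group)
  have "subgroup (carrier (partition_stabilizer n P)) (sym_group n)"
  proof (rule S.subgroupI)
    show "carrier (partition_stabilizer n P) \<subseteq> carrier (sym_group n)"
      by (auto simp: carrier_partition_stabilizer sym_group_carrier)
    have "id \<in> carrier (partition_stabilizer n P)"
      by (simp add: carrier_partition_stabilizer permutes_id)
    then show "carrier (partition_stabilizer n P) \<noteq> {}" by blast
  next
    fix \<sigma> assume s: "\<sigma> \<in> carrier (partition_stabilizer n P)"
    then have p: "\<sigma> permutes {1..n}" and P: "(`) \<sigma> ` P = P"
      by (auto simp: carrier_partition_stabilizer)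
    have i: "inv\<^bsub>sym_group n\<^esub> \<sigma> = inv' \<sigma>"
      using p by (simp add: sym_group_inv_equality sym_group_carrier)
    have "(`) (inv' \<sigma>) ` P = (`) (inv' \<sigma>) ` ((`) \<sigma> ` P)" using P by simp
    also have "\<dots> = P"
      using permutes_inj[OF p] by (simp add: image_image inv_f_f)
    finally show "inv\<^bsub>sym_group n\<^esub> \<sigma> \<in> carrier (partition_stabilizer n P)"
      using p by (simp add: i carrier_partition_stabilizer permutes_inv)
  next
    fix \<sigma> \<tau>
    assume s: "\<sigma> \<in> carrier (partition_stabilizer n P)"
      and t: "\<tau> \<in> carrier (partition_stabilizer n P)"
    have "(`) (\<sigma> \<circ> \<tau>) ` P = (`) \<sigma> ` ((`) \<tau> ` P)" by (simp add: image_image image_comp)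
    then have "(`) (\<sigma> \<circ> \<tau>) ` P = P" using s t by (simp add: carrier_partition_stabilizer)
    then show "\<sigma> \<otimes>\<^bsub>sym_group n\<^esub> \<tau> \<in> carrier (partition_stabilizer n P)"
      using s t
      by (simp add: sym_group_mult carrier_partition_stabilizer permutes_compose)
  qed
  then have "group (sym_group n\<lparr>carrier := carrier (partition_stabilizer n P)\<rparr>)"
    by (rule S.subgroup_imp_group)
  then show ?thesis by (simp add: partition_stabilizer_def)
qed

end

theory Submission
  imports Defs "Jordan_Normal_Form.Spectral_Radius" "HOL-Algebra.Multiplicative_Group" "HOL-Number_Theory.Cong"
begin

text \<open>
  Write \<open>n = p ^ k\<close> and \<open>a = p ^ (k - 1)\<close>. The \<open>n\<close> hook characters \<open>\<chi>\<^sub>i\<close> of the symmetric group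
  satisfy \<open>\<chi>\<^sub>i + \<chi>\<^sub>i\<^sub>-\<^sub>1 = \<lambda>\<^sub>i\<close>, the character of the \<open>i\<close>-th exterior power of the permutation
  module. Restricting an exterior power to \<open>H\<close> distributes the factors of a wedge product over the
  blocks; pairing the result with the character \<open>\<psi>\<^sub>t\<^sub>,\<^sub>s\<close> obtained from the outer tensor power of the
  hook character \<open>\<chi>\<^sub>t\<close> of \<open>a\<close> letters and the hook character \<open>\<chi>\<^sub>s\<close> of \<open>p\<close> letters shows that
  \<open>\<psi>\<^sub>t\<^sub>,\<^sub>s\<close> occurs in exactly one \<open>\<chi>\<^sub>i\<close>, namely for \<open>i = p t + s\<close>, and there with multiplicity one.

  The hooks are exactly the characters of degree prime to \<open>p\<close>: their alternating sum vanishes off the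
  full cycles and is \<open>n\<close> on them. Hence an irreducible character vanishes on an \<open>n\<close>-cycle unless it
  is a hook, in which case its value is \<open>1\<close> or \<open>-1\<close>; and its value on an element of \<open>p\<close>-power order,
  if constant on the generators of the group spanned by that element, is congruent to its degree
  modulo \<open>p\<close>. The same argument works for \<open>H\<close>, since full cycles of \<open>H\<close> are conjugate
  in \<open>H\<close> and the alternating sum of the \<open>\<psi>\<^sub>t\<^sub>,\<^sub>s\<close> equals that of the restricted hooks.
\<close>

text \<open>The obstacle is to know all of \<open>Irr_p'\<close> on both sides without classifying
  the irreducible characters of either group. One count settles both. The centralizer of a full
  cycle is the group it generates, of order n, so the full cycles are the fraction 1/n of the group.
  A class function of squared norm n with value n on them has no norm left elsewhere, and the
  alternating sum of n orthonormal characters with values 1 and -1 there is such a function. If the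
  full cycle lies in H, so does its centralizer, and the same fraction occurs in H. Irreducibility
  is read off from inner products alone: norm 1, or norm 2 with one constituent known. Inner
  products of exterior powers count orbits on pairs of subsets, and only pairs survive in which each
  set has at most one point outside the other. The index p t + s comes from such a count: t factors
  of a wedge product in every block, plus one more factor in each of s or s + 1 blocks; two
  consecutive exterior powers are hit, and the alternating subtraction that defines the hooks leaves
  one.\<close>

lemma sum_mult_delta:
  fixes f :: "'i \<Rightarrow> complex"
  assumes "finite A"
  shows "(\<Sum>u\<in>A. f u * (if u = v then 1 else 0)) = (if v \<in> A then f v else 0)"
    and "(\<Sum>u\<in>A. f u * (if v = u then 1 else 0)) = (if v \<in> A then f v else 0)"
    and "(\<Sum>u\<in>A. (if u = v then 1 else 0) * f u) = (if v \<in> A then f v else 0)"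
    and "(\<Sum>u\<in>A. (if v = u then 1 else 0) * f u) = (if v \<in> A then f v else 0)"
proof -
  show "(\<Sum>u\<in>A. f u * (if u = v then 1 else 0)) = (if v \<in> A then f v else 0)"
    and "(\<Sum>u\<in>A. f u * (if v = u then 1 else 0)) = (if v \<in> A then f v else 0)"
    using assms by (simp_all add: if_distrib[of "\<lambda>x. _ * x"] cong: if_cong)
  then show "(\<Sum>u\<in>A. (if u = v then 1 else 0) * f u) = (if v \<in> A then f v else 0)"
    and "(\<Sum>u\<in>A. (if v = u then 1 else 0) * f u) = (if v \<in> A then f v else 0)"
    by (simp_all only: mult.commute[of _ "f _"])
qed

section \<open>Dual bases and idempotent matrices over finite index sets\<close>

lemma subspace_add_sum:
  fixes W :: "('i \<Rightarrow> complex) set" and c :: "nat \<Rightarrow> 'i \<Rightarrow> complex"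
  assumes cl: "\<And>f g a. f \<in> W \<Longrightarrow> g \<in> W \<Longrightarrow> (\<lambda>i. f i + a * g i) \<in> W"
    and "f \<in> W" "\<And>u. u < r \<Longrightarrow> c u \<in> W"
  shows "(\<lambda>i. f i + (\<Sum>u<r. a u * c u i)) \<in> W"
  using assms(3)
proof (induction r)
  case 0
  then show ?case using assms(2) by simp
next
  case (Suc r)
  have "(\<lambda>i. (f i + (\<Sum>u<r. a u * c u i)) + a r * c r i) \<in> W"
    by (rule cl) (use Suc in auto)
  then show ?case by (simp add: add.assoc)
qed

text \<open>Gaussian elimination, one coordinate at a time: split off the elements that vanish at
  \<open>x\<close>, and add one basis vector if some element does not. Only values on
  \<open>I\<close> matter, so the \<open>c u\<close> are honest elements of \<open>W\<close> while
  the expansion is asked on \<open>I\<close> alone.\<close>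

lemma biorthogonal_system:
  fixes W :: "('i \<Rightarrow> complex) set"
  assumes "finite I" "\<And>f g a. f \<in> W \<Longrightarrow> g \<in> W \<Longrightarrow> (\<lambda>i. f i + a * g i) \<in> W"
  shows "\<exists>r (c :: nat \<Rightarrow> 'i \<Rightarrow> complex) q. (\<forall>u<r. c u \<in> W) \<and>
    (\<forall>u<r. \<forall>v<r. (\<Sum>i\<in>I. q u i * c v i) = (if u = v then 1 else 0)) \<and>
    (\<forall>w\<in>W. \<forall>i\<in>I. w i = (\<Sum>u<r. (\<Sum>j\<in>I. q u j * w j) * c u i))"
  using assms
proof (induction I arbitrary: W rule: finite_induct)
  case empty
  show ?case by (rule exI[of _ 0]) auto
next
  case (insert x I)
  define W0 where "W0 = {w \<in> W. w x = 0}"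
  have "\<And>f g a. f \<in> W0 \<Longrightarrow> g \<in> W0 \<Longrightarrow> (\<lambda>i. f i + a * g i) \<in> W0"
    using insert.prems by (auto simp: W0_def)
  from insert.IH[OF this] obtain r and c :: "nat \<Rightarrow> 'i \<Rightarrow> complex" and q where
    c: "\<And>u. u < r \<Longrightarrow> c u \<in> W0" and
    bi: "\<And>u v. u < r \<Longrightarrow> v < r \<Longrightarrow> (\<Sum>i\<in>I. q u i * c v i) = (if u = v then 1 else 0)" and
    sp: "\<And>w i. w \<in> W0 \<Longrightarrow> i \<in> I \<Longrightarrow> w i = (\<Sum>u<r. (\<Sum>j\<in>I. q u j * w j) * c u i)"
    by blast
  define q' where "q' u = (q u)(x := 0)" for u
  have q': "(\<Sum>j\<in>insert x I. q' u j * f j) = (\<Sum>j\<in>I. q u j * f j)" for u f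
    using insert.hyps by (auto simp: q'_def intro!: sum.cong)
  have cx: "c u x = 0" if "u < r" for u using c[OF that] by (simp add: W0_def)
  show ?case
  proof (cases "\<exists>w\<in>W. w x \<noteq> 0")
    case False
    then have "W = W0" by (auto simp: W0_def)
    have "w i = (\<Sum>u<r. (\<Sum>j\<in>insert x I. q' u j * w j) * c u i)"
      if "w \<in> W" "i \<in> insert x I" for w i
    proof (cases "i = x")
      case True
      then show ?thesis using that False by (simp add: cx)
    next
      case F: False
      then show ?thesis using sp[of w i] that \<open>W = W0\<close> by (simp add: q')
    qed
    moreover have "(\<Sum>i\<in>insert x I. q' u i * c v i) = (if u = v then 1 else 0)"
      if "u < r" "v < r" for u v using bi that by (simp add: q')
    moreover have "\<forall>u<r. c u \<in> W" using c \<open>W = W0\<close> by simp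
    ultimately show ?thesis
      by (intro exI[of _ r] exI[of _ c] exI[of _ q'] conjI allI impI ballI) simp_all
  next
    case True
    then obtain w1 where w1: "w1 \<in> W" "w1 x \<noteq> 0" by blast
    \<comment> \<open>This is \<open>w1\<close> divided by \<open>w1 x\<close>, written in the form
      f + a * g that the closure hypothesis provides.\<close>
    define w2 where "w2 = (\<lambda>i. w1 i + (1 / w1 x - 1) * w1 i)"
    have w2: "w2 \<in> W" unfolding w2_def using w1(1) w1(1) by (rule insert.prems)
    have w2x: "w2 x = 1" using w1(2) by (simp add: w2_def field_simps)
    \<comment> \<open>Subtracting the components along the old basis makes all old functionals
      vanish on \<open>w3\<close>. The value 1 at \<open>x\<close> is kept, because the old basis
      vectors are 0 there.\<close>
    define w3 where "w3 = (\<lambda>i. w2 i + (\<Sum>u<r. (- (\<Sum>j\<in>I. q u j * w2 j)) * c u i))"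
    have "w3 \<in> W" unfolding w3_def
      by (rule subspace_add_sum[OF insert.prems w2]) (use c in \<open>auto simp: W0_def\<close>)
    have w3x: "w3 x = 1" by (simp add: w3_def w2x cx)
    have qw3: "(\<Sum>j\<in>I. q v j * w3 j) = 0" if "v < r" for v
    proof -
      have "(\<Sum>j\<in>I. q v j * w3 j) = (\<Sum>j\<in>I. q v j * w2 j) -
          (\<Sum>j\<in>I. \<Sum>u<r. q v j * ((\<Sum>j\<in>I. q u j * w2 j) * c u j))"
        by (simp add: w3_def algebra_simps sum.distrib sum_negf sum_subtractf sum_distrib_left)
      also have "(\<Sum>j\<in>I. \<Sum>u<r. q v j * ((\<Sum>j\<in>I. q u j * w2 j) * c u j)) =
          (\<Sum>u<r. (\<Sum>j\<in>I. q u j * w2 j) * (\<Sum>j\<in>I. q v j * c u j))"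
        by (subst sum.swap) (simp add: sum_distrib_left mult_ac)
      also have "\<dots> = (\<Sum>u<r. (\<Sum>j\<in>I. q u j * w2 j) * (if v = u then 1 else 0))"
        using bi that by (intro sum.cong) auto
      also have "\<dots> = (\<Sum>j\<in>I. q v j * w2 j)" using that by (simp add: sum_mult_delta)
      finally show ?thesis by simp
    qed
    define c' where "c' = c(r := w3)"
    \<comment> \<open>The new functional is evaluation at \<open>x\<close>; the old ones are
      extended by 0 at \<open>x\<close> and so ignore this coordinate.\<close>
    define q'' where "q'' = q'(r := (\<lambda>j. if j = x then 1 else 0))"
    have q''r: "(\<Sum>j\<in>insert x I. q'' r j * f j) = f x" for f :: "'i \<Rightarrow> complex"
    proof -
      have "(\<Sum>j\<in>insert x I. q'' r j * f j) = (\<Sum>j\<in>insert x I. if j = x then f j else 0)"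
        by (intro sum.cong) (auto simp: q''_def)
      then show ?thesis using insert.hyps by (subst (asm) sum.delta) auto
    qed
    have q''u: "(\<Sum>j\<in>insert x I. q'' u j * f j) = (\<Sum>j\<in>I. q u j * f j)" if "u < r" for u f
      using that by (simp add: q''_def q')
    have "\<forall>u<Suc r. c' u \<in> W" using c \<open>w3 \<in> W\<close> by (auto simp: c'_def W0_def less_Suc_eq)
    moreover have "(\<Sum>i\<in>insert x I. q'' u i * c' v i) = (if u = v then 1 else 0)"
      if "u < Suc r" "v < Suc r" for u v
    proof (cases "u = r")
      case True
      then show ?thesis using that by (simp only: q''r) (auto simp: c'_def w3x cx)
    next
      case False
      then have "u < r" using that by simp
      then show ?thesis using that bi[of u v] qw3[of u] by (simp only: q''u) (auto simp: c'_def)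
    qed
    moreover have "w i = (\<Sum>u<Suc r. (\<Sum>j\<in>insert x I. q'' u j * w j) * c' u i)"
      if "w \<in> W" "i \<in> insert x I" for w i
    proof -
      define w' where "w' = (\<lambda>i. w i + (- w x) * w3 i)"
      have "w' \<in> W" unfolding w'_def using that(1) \<open>w3 \<in> W\<close> by (rule insert.prems)
      then have w': "w' \<in> W0" by (simp add: W0_def) (simp add: w'_def w3x)
      have "w' i = (\<Sum>u<r. (\<Sum>j\<in>I. q u j * w j) * c u i)"
      proof (cases "i = x")
        case True
        then show ?thesis using w' by (simp add: W0_def cx)
      next
        case False
        have "w' i = (\<Sum>u<r. (\<Sum>j\<in>I. q u j * w' j) * c u i)" using sp w' that False by blast
        moreover have "(\<Sum>j\<in>I. q u j * w' j) = (\<Sum>j\<in>I. q u j * w j)" if "u < r" for u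
        proof -
          have "(\<Sum>j\<in>I. q u j * w' j) = (\<Sum>j\<in>I. q u j * w j) - w x * (\<Sum>j\<in>I. q u j * w3 j)"
            by (simp add: w'_def algebra_simps sum.distrib sum_subtractf sum_distrib_left)
          then show ?thesis using qw3[OF that] by simp
        qed
        ultimately show ?thesis by simp
      qed
      then have "w i = (\<Sum>u<r. (\<Sum>j\<in>I. q u j * w j) * c u i) + w x * w3 i"
        by (simp add: w'_def algebra_simps)
      moreover have "(\<Sum>u<r. (\<Sum>j\<in>insert x I. q'' u j * w j) * c' u i) =
          (\<Sum>u<r. (\<Sum>j\<in>I. q u j * w j) * c u i)"
        by (intro sum.cong) (simp_all add: q''u c'_def del: sum.insert)
      ultimately show ?thesis by (simp only: sum.lessThan_Suc q''r) (simp add: c'_def)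
    qed
    ultimately show ?thesis
      by (intro exI[of _ "Suc r"] exI[of _ c'] exI[of _ q''] conjI allI impI ballI) (simp_all only:)
  qed
qed

text \<open>An idempotent is the identity on its image. A basis of the image (the columns of
  \<open>P\<close>) and the coordinates of the columns of \<open>E\<close> (the matrix
  \<open>Q\<close>) therefore satisfy E = P Q and Q P = 1, and comparing traces identifies the trace
  of \<open>E\<close> with the rank.\<close>

lemma idempotent_factorization:
  fixes E :: "'i \<Rightarrow> 'i \<Rightarrow> complex"
  assumes fin: "finite I"
    and idem: "\<And>i j. i \<in> I \<Longrightarrow> j \<in> I \<Longrightarrow> (\<Sum>k\<in>I. E i k * E k j) = E i j"
  shows "\<exists>r (P :: 'i \<Rightarrow> nat \<Rightarrow> complex) Q. (\<forall>i\<in>I. \<forall>j\<in>I. E i j = (\<Sum>u<r. P i u * Q u j)) \<and>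
    (\<forall>u<r. \<forall>v<r. (\<Sum>i\<in>I. Q u i * P i v) = (if u = v then 1 else 0)) \<and>
    of_nat r = (\<Sum>i\<in>I. E i i)"
proof -
  define W where "W = {(\<lambda>i. \<Sum>k\<in>I. E i k * f k) | f. True}"
  have "\<exists>r (c :: nat \<Rightarrow> 'i \<Rightarrow> complex) q. (\<forall>u<r. c u \<in> W) \<and>
    (\<forall>u<r. \<forall>v<r. (\<Sum>i\<in>I. q u i * c v i) = (if u = v then 1 else 0)) \<and>
    (\<forall>w\<in>W. \<forall>i\<in>I. w i = (\<Sum>u<r. (\<Sum>j\<in>I. q u j * w j) * c u i))"
  proof (rule biorthogonal_system[OF fin])
    fix f g a assume "f \<in> W" "g \<in> W"
    then obtain f' g' where "f = (\<lambda>i. \<Sum>k\<in>I. E i k * f' k)" "g = (\<lambda>i. \<Sum>k\<in>I. E i k * g' k)"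
      by (auto simp: W_def)
    then have "(\<lambda>i. f i + a * g i) = (\<lambda>i. \<Sum>k\<in>I. E i k * (f' k + a * g' k))"
      by (simp add: fun_eq_iff algebra_simps sum.distrib sum_distrib_left)
    then show "(\<lambda>i. f i + a * g i) \<in> W"
      unfolding W_def mem_Collect_eq by (intro exI[of _ "\<lambda>k. f' k + a * g' k"] conjI TrueI)
  qed
  then obtain r and c :: "nat \<Rightarrow> 'i \<Rightarrow> complex" and q where
    c: "\<And>u. u < r \<Longrightarrow> c u \<in> W" and
    bi: "\<And>u v. u < r \<Longrightarrow> v < r \<Longrightarrow> (\<Sum>i\<in>I. q u i * c v i) = (if u = v then 1 else 0)" and
    sp: "\<And>w i. w \<in> W \<Longrightarrow> i \<in> I \<Longrightarrow> w i = (\<Sum>u<r. (\<Sum>j\<in>I. q u j * w j) * c u i)"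
    by blast
  have Ew: "(\<Sum>k\<in>I. E i k * w k) = w i" if "w \<in> W" "i \<in> I" for w i
  proof -
    obtain f where f: "w = (\<lambda>i. \<Sum>k\<in>I. E i k * f k)" using \<open>w \<in> W\<close> by (auto simp: W_def)
    have "(\<Sum>k\<in>I. E i k * w k) = (\<Sum>l\<in>I. (\<Sum>k\<in>I. E i k * E k l) * f l)"
      unfolding f sum_distrib_left sum_distrib_right by (subst sum.swap) (simp add: mult_ac)
    also have "\<dots> = w i" using idem that(2) by (simp add: f)
    finally show ?thesis .
  qed
  define P where "P i u = c u i" for i u
  define Q where "Q u j = (\<Sum>k\<in>I. q u k * E k j)" for u j
  have 1: "E i j = (\<Sum>u<r. P i u * Q u j)" if "i \<in> I" "j \<in> I" for i j
  proof -
    have "(\<lambda>i. \<Sum>k\<in>I. E i k * (if k = j then 1 else 0)) \<in> W" unfolding W_def mem_Collect_eq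
      by (intro exI[of _ "\<lambda>k. if k = j then 1 else 0"] conjI TrueI refl)
    moreover have "(\<Sum>k\<in>I. E i k * (if k = j then 1 else 0)) = E i j" for i
      using that fin by (simp add: sum_mult_delta)
    ultimately have "(\<lambda>i. E i j) \<in> W" by simp
    from sp[OF this that(1)] show ?thesis by (simp add: P_def Q_def mult.commute)
  qed
  have 2: "(\<Sum>i\<in>I. Q u i * P i v) = (if u = v then 1 else 0)" if "u < r" "v < r" for u v
  proof -
    have "(\<Sum>i\<in>I. Q u i * P i v) = (\<Sum>k\<in>I. q u k * (\<Sum>i\<in>I. E k i * c v i))"
      unfolding P_def Q_def sum_distrib_left sum_distrib_right
      by (subst sum.swap) (simp add: mult_ac)
    also have "\<dots> = (\<Sum>k\<in>I. q u k * c v k)" using Ew c that by (intro sum.cong) auto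
    finally show ?thesis using bi that by simp
  qed
  have "(\<Sum>i\<in>I. E i i) = (\<Sum>i\<in>I. \<Sum>u<r. P i u * Q u i)" using 1 by simp
  also have "\<dots> = (\<Sum>u<r. \<Sum>i\<in>I. Q u i * P i u)" by (subst sum.swap) (simp add: mult_ac)
  also have "\<dots> = of_nat r" using 2 by simp
  finally have 3: "of_nat r = (\<Sum>i\<in>I. E i i)" by simp
  show ?thesis
    by (intro exI[of _ r] exI[of _ P] exI[of _ Q] conjI allI impI ballI) (simp_all add: 1 2 3)
qed

text \<open>The source of integrality for eigenvalue multiplicities, which appear as traces of
  averaging idempotents.\<close>

lemma trace_idempotent_Nats:
  fixes E :: "'i \<Rightarrow> 'i \<Rightarrow> complex"
  assumes "finite I" "\<And>i j. i \<in> I \<Longrightarrow> j \<in> I \<Longrightarrow> (\<Sum>k\<in>I. E i k * E k j) = E i j"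
  shows "(\<Sum>i\<in>I. E i i) \<in> \<nat>"
  using idempotent_factorization[OF assms] by (metis of_nat_in_Nats)

section \<open>Matrix representations with arbitrary finite index sets\<close>

text \<open>With arbitrary finite index sets, tensor powers can be indexed by families, exterior
  powers by subsets and products by pairs. Entries outside \<open>I\<close> are left
  arbitrary.\<close>

definition fun_rep :: "('g, 'b) monoid_scheme \<Rightarrow> 'i set \<Rightarrow> ('g \<Rightarrow> 'i \<Rightarrow> 'i \<Rightarrow> complex) \<Rightarrow> bool" where
  "fun_rep G I \<rho> \<longleftrightarrow> finite I \<and>
    (\<forall>g\<in>carrier G. \<forall>h\<in>carrier G. \<forall>i\<in>I. \<forall>j\<in>I.
      \<rho> (g \<otimes>\<^bsub>G\<^esub> h) i j = (\<Sum>k\<in>I. \<rho> g i k * \<rho> h k j)) \<and>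
    (\<forall>i\<in>I. \<forall>j\<in>I. \<rho> \<one>\<^bsub>G\<^esub> i j = (if i = j then 1 else 0))"

definition fun_char :: "('g, 'b) monoid_scheme \<Rightarrow> 'i set \<Rightarrow> ('g \<Rightarrow> 'i \<Rightarrow> 'i \<Rightarrow> complex) \<Rightarrow> 'g \<Rightarrow> complex" where
  "fun_char G I \<rho> = (\<lambda>g\<in>carrier G. \<Sum>i\<in>I. \<rho> g i i)"

definition genuine_char :: "('g, 'b) monoid_scheme \<Rightarrow> ('g \<Rightarrow> complex) \<Rightarrow> bool" where
  "genuine_char G f \<longleftrightarrow> (\<exists>n \<rho>. representation G n \<rho> \<and> f = character_of G \<rho>)"

lemma fun_rep_finite: "fun_rep G I \<rho> \<Longrightarrow> finite I"
  and fun_rep_mult: "fun_rep G I \<rho> \<Longrightarrow> g \<in> carrier G \<Longrightarrow> h \<in> carrier G \<Longrightarrow> i \<in> I \<Longrightarrow> j \<in> I \<Longrightarrow>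
      \<rho> (g \<otimes>\<^bsub>G\<^esub> h) i j = (\<Sum>k\<in>I. \<rho> g i k * \<rho> h k j)"
  and fun_rep_one: "fun_rep G I \<rho> \<Longrightarrow> i \<in> I \<Longrightarrow> j \<in> I \<Longrightarrow>
      \<rho> \<one>\<^bsub>G\<^esub> i j = (if i = j then 1 else 0)"
  unfolding fun_rep_def by auto

lemma GL_simps: "Group.monoid.mult (GL n) = (*)" "one (GL n) = 1\<^sub>m n"
  "carrier (GL n) = {A \<in> carrier_mat n n. \<exists>B\<in>carrier_mat n n. B * A = 1\<^sub>m n \<and> A * B = 1\<^sub>m n}"
  by (auto simp: GL_def units_of_def ring_mat_simps Units_def)

lemma group_GL: "group (GL n)"
proof -
  interpret R: ring "ring_mat TYPE(complex) n ()" by (rule ring_mat)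
  show ?thesis unfolding GL_def by (rule R.units_group)
qed

lemma representation_carrier: "representation G n \<rho> \<Longrightarrow> g \<in> carrier G \<Longrightarrow> \<rho> g \<in> carrier_mat n n"
  unfolding representation_def by (auto simp: GL_simps dest!: hom_in_carrier)

lemma representation_mult:
  "representation G n \<rho> \<Longrightarrow> g \<in> carrier G \<Longrightarrow> h \<in> carrier G \<Longrightarrow> \<rho> (g \<otimes>\<^bsub>G\<^esub> h) = \<rho> g * \<rho> h"
  unfolding representation_def by (auto simp: hom_def GL_simps)

lemma representation_one:
  assumes "group G" "representation G n \<rho>"
  shows "\<rho> \<one>\<^bsub>G\<^esub> = 1\<^sub>m n"
  using assms group_GL hom_one unfolding representation_def by (metis GL_simps(2))

lemma index_mult_mat_sum:
  "A \<in> carrier_mat n m \<Longrightarrow> B \<in> carrier_mat m l \<Longrightarrow> i < n \<Longrightarrow> j < l \<Longrightarrow>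
    (A * B) $$ (i, j) = (\<Sum>k<m. A $$ (i, k) * B $$ (k, j))"
  by (auto simp: scalar_prod_def lessThan_atLeast0 intro!: sum.cong)

lemma representation_imp_fun_rep:
  assumes "group G" "representation G n \<rho>"
  shows "fun_rep G {..<n} (\<lambda>g i j. \<rho> g $$ (i, j))"
  unfolding fun_rep_def
  using representation_carrier[OF assms(2)] representation_mult[OF assms(2)]
    representation_one[OF assms]
  by (auto simp: index_mult_mat_sum[of _ n n _ n])

lemma character_of_eq_fun_char:
  assumes "representation G n \<rho>"
  shows "character_of G \<rho> = fun_char G {..<n} (\<lambda>g i j. \<rho> g $$ (i, j))"
proof -
  have "dim_row (\<rho> g) = n" if "g \<in> carrier G" for g
    using representation_carrier[OF assms that] by auto
  then show ?thesis by (auto simp: character_of_def fun_char_def mat_trace_def fun_eq_iff)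
qed

lemma fun_rep_imp_representation:
  assumes G: "group G" and \<rho>: "fun_rep G {..<n} \<rho>"
  shows "representation G n (\<lambda>g. mat n n (\<lambda>(i, j). \<rho> g i j))"
    and "character_of G (\<lambda>g. mat n n (\<lambda>(i, j). \<rho> g i j)) = fun_char G {..<n} \<rho>"
proof -
  interpret group G by fact
  define M where "M g = mat n n (\<lambda>(i, j). \<rho> g i j)" for g
  have M: "M g \<in> carrier_mat n n" for g by (simp add: M_def)
  have dim: "dim_row (M g) = n" "dim_col (M g) = n" for g by (simp_all add: M_def)
  have mult: "M (g \<otimes>\<^bsub>G\<^esub> h) = M g * M h" if "g \<in> carrier G" "h \<in> carrier G" for g h
  proof (rule eq_matI)
    fix i j assume "i < dim_row (M g * M h)" "j < dim_col (M g * M h)"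
    then have "i < n" "j < n" by (auto simp: dim)
    then show "M (g \<otimes>\<^bsub>G\<^esub> h) $$ (i, j) = (M g * M h) $$ (i, j)"
      using fun_rep_mult[OF \<rho> that, of i j] by (simp add: index_mult_mat_sum[OF M M]) (simp add: M_def)
  qed (auto simp: dim)
  have one: "M \<one>\<^bsub>G\<^esub> = 1\<^sub>m n"
    using fun_rep_one[OF \<rho>] by (auto simp: M_def)
  have "M g \<in> carrier (GL n)" if "g \<in> carrier G" for g
    using mult[OF that inv_closed[OF that]] mult[OF inv_closed[OF that] that] that M one
    by (auto simp: GL_simps intro!: bexI[of _ "M (inv\<^bsub>G\<^esub> g)"])
  then have rep: "representation G n M"
    unfolding representation_def hom_def using mult by (auto simp: GL_simps(1))
  show "representation G n (\<lambda>g. mat n n (\<lambda>(i, j). \<rho> g i j))"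
    using rep by (simp add: M_def[abs_def])
  show "character_of G (\<lambda>g. mat n n (\<lambda>(i, j). \<rho> g i j)) = fun_char G {..<n} \<rho>"
    by (auto simp: character_of_def mat_trace_def fun_char_def fun_eq_iff)
qed

text \<open>An enumeration of \<open>I\<close> renames the indices to an initial segment of the
  naturals, the form that \<open>representation\<close> asks for.\<close>

lemma genuine_charI:
  assumes G: "group G" and \<rho>: "fun_rep G I \<rho>"
  shows "genuine_char G (fun_char G I \<rho>)"
proof -
  have fin: "finite I" using \<rho> by (rule fun_rep_finite)
  then obtain e where e: "bij_betw e {..<card I} I"
    using ex_bij_betw_nat_finite[OF fin] by (auto simp: lessThan_atLeast0)
  have e_in: "e i \<in> I" if "i < card I" for i using e that by (auto simp: bij_betw_def)
  have e_eq: "e i = e j \<longleftrightarrow> i = j" if "i < card I" "j < card I" for i j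
    using e that by (auto simp: bij_betw_def inj_on_def)
  define \<rho>' where "\<rho>' g i j = \<rho> g (e i) (e j)" for g i j
  have "fun_rep G {..<card I} \<rho>'"
    unfolding fun_rep_def
  proof (intro conjI ballI)
    fix g h i j assume a: "g \<in> carrier G" "h \<in> carrier G" "i \<in> {..<card I}" "j \<in> {..<card I}"
    have "\<rho>' (g \<otimes>\<^bsub>G\<^esub> h) i j = (\<Sum>k\<in>I. \<rho> g (e i) k * \<rho> h k (e j))"
      using a e_in by (simp add: \<rho>'_def fun_rep_mult[OF \<rho>])
    also have "\<dots> = (\<Sum>k<card I. \<rho>' g i k * \<rho>' h k j)"
      by (subst sum.reindex_bij_betw[OF e, symmetric]) (simp add: \<rho>'_def)
    finally show "\<rho>' (g \<otimes>\<^bsub>G\<^esub> h) i j = (\<Sum>k<card I. \<rho>' g i k * \<rho>' h k j)" .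
  qed (auto simp: \<rho>'_def fun_rep_one[OF \<rho>] e_in e_eq)
  moreover have "fun_char G I \<rho> = fun_char G {..<card I} \<rho>'"
    unfolding fun_char_def \<rho>'_def by (subst sum.reindex_bij_betw[OF e]) simp
  ultimately show ?thesis
    unfolding genuine_char_def using fun_rep_imp_representation[OF G] by metis
qed

lemma genuine_charE:
  assumes "group G" "genuine_char G f"
  obtains n \<rho> where "fun_rep G {..<n::nat} \<rho>" "f = fun_char G {..<n} \<rho>"
  using assms unfolding genuine_char_def
  by (metis character_of_eq_fun_char representation_imp_fun_rep)

lemma Irr_imp_genuine_char: "f \<in> Irr G \<Longrightarrow> genuine_char G f"
  unfolding Irr_def genuine_char_def irreducible_representation_def by blast

lemma char_degree_genuine:
  assumes "group G" "genuine_char G f"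
  shows "f \<one>\<^bsub>G\<^esub> = of_nat (char_degree G f)"
proof -
  interpret group G by fact
  obtain n \<rho> where \<rho>: "representation G n \<rho>" "f = character_of G \<rho>"
    using assms(2) by (auto simp: genuine_char_def)
  then have "f \<one>\<^bsub>G\<^esub> = of_nat n"
    using representation_one[OF assms(1) \<rho>(1)] by (simp add: character_of_def mat_trace_def)
  then show ?thesis using char_degree_character_of[OF assms(1) \<rho>(1)] \<rho>(2) by simp
qed

lemma fun_rep_prod:
  assumes "fun_rep G I \<rho>" "fun_rep G J \<sigma>"
  shows "fun_rep G (I \<times> J) (\<lambda>g (i, i') (j, j'). \<rho> g i j * \<sigma> g i' j')"
    and "fun_char G (I \<times> J) (\<lambda>g (i, i') (j, j'). \<rho> g i j * \<sigma> g i' j') =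
      (\<lambda>g\<in>carrier G. fun_char G I \<rho> g * fun_char G J \<sigma> g)"
proof -
  show "fun_rep G (I \<times> J) (\<lambda>g (i, i') (j, j'). \<rho> g i j * \<sigma> g i' j')"
    using assms unfolding fun_rep_def
    by (auto simp: sum.cartesian_product' sum_product mult_ac)
  show "fun_char G (I \<times> J) (\<lambda>g (i, i') (j, j'). \<rho> g i j * \<sigma> g i' j') =
      (\<lambda>g\<in>carrier G. fun_char G I \<rho> g * fun_char G J \<sigma> g)"
    unfolding fun_char_def
    by (auto simp: fun_eq_iff sum.cartesian_product' sum_product)
qed

text \<open>Entries are total functions, so associativity is an equation of functions and can be
  used for rewriting; identities that hold only inside the index sets enter through
  \<open>mat_prod_cong\<close>.\<close>

definition mat_prod :: "'k set \<Rightarrow> ('i \<Rightarrow> 'k \<Rightarrow> complex) \<Rightarrow> ('k \<Rightarrow> 'j \<Rightarrow> complex) \<Rightarrow> 'i \<Rightarrow> 'j \<Rightarrow> complex" where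
  "mat_prod K A B = (\<lambda>i j. \<Sum>k\<in>K. A i k * B k j)"

lemma mat_prod_assoc: "mat_prod L (mat_prod K A B) C = mat_prod K A (mat_prod L B C)"
  unfolding mat_prod_def sum_distrib_left sum_distrib_right fun_eq_iff
  by (subst sum.swap) (simp add: mult_ac)

lemma mat_prod_cong:
  "(\<And>k. k \<in> K \<Longrightarrow> A i k = A' i k) \<Longrightarrow> (\<And>k. k \<in> K \<Longrightarrow> B k j = B' k j) \<Longrightarrow> mat_prod K A B i j = mat_prod K A' B' i j"
  unfolding mat_prod_def by (auto intro!: sum.cong)

lemma mat_prod_one:
  assumes "finite K" "i \<in> K"
  shows "mat_prod K (\<lambda>i j. if i = j then 1 else 0) B i j = B i j"
    and "mat_prod K A (\<lambda>i j. if i = j then 1 else 0) j i = A j i"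
  using assms by (simp_all add: mat_prod_def sum_mult_delta)

lemma trace_mm: "(\<Sum>i\<in>I. mat_prod J A B i i) = (\<Sum>j\<in>J. mat_prod I B A j j)"
  unfolding mat_prod_def by (subst sum.swap) (simp add: mult.commute)

lemma mat_prod_add_left: "mat_prod K (\<lambda>i j. A i j + B i j) C = (\<lambda>i j. mat_prod K A C i j + mat_prod K B C i j)"
  by (simp add: mat_prod_def fun_eq_iff sum.distrib algebra_simps)

lemma mat_prod_add_right: "mat_prod K A (\<lambda>i j. B i j + C i j) = (\<lambda>i j. mat_prod K A B i j + mat_prod K A C i j)"
  by (simp add: mat_prod_def fun_eq_iff sum.distrib algebra_simps)

lemma fun_rep_mm: "fun_rep G I \<rho> \<Longrightarrow> g \<in> carrier G \<Longrightarrow> h \<in> carrier G \<Longrightarrow> i \<in> I \<Longrightarrow> j \<in> I \<Longrightarrow>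
    \<rho> (g \<otimes>\<^bsub>G\<^esub> h) i j = mat_prod I (\<rho> g) (\<rho> h) i j"
  by (simp add: mat_prod_def fun_rep_mult)

text \<open>In a basis adapted to \<open>W\<close> all matrices are block triangular, with the
  actions on \<open>W\<close> and on the quotient as diagonal blocks, and the trace sees only these
  blocks. The last two conclusions say that a block of size 0 occurs only for trivial
  \<open>W\<close>, which makes an induction on the degree possible.\<close>

lemma fun_rep_split:
  fixes \<rho> :: "'g \<Rightarrow> 'i \<Rightarrow> 'i \<Rightarrow> complex"
  assumes G: "group G" and rep: "fun_rep G I \<rho>"
    and zero: "(\<lambda>i. 0) \<in> W"
    and cl: "\<And>f g a. f \<in> W \<Longrightarrow> g \<in> W \<Longrightarrow> (\<lambda>i. f i + a * g i) \<in> W"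
    and inv: "\<And>g f. g \<in> carrier G \<Longrightarrow> f \<in> W \<Longrightarrow> \<exists>f'\<in>W. \<forall>i\<in>I. f' i = (\<Sum>k\<in>I. \<rho> g i k * f k)"
  obtains r s \<rho>1 \<rho>2 where "r + s = card I" "fun_rep G {..<r::nat} \<rho>1" "fun_rep G {..<s::nat} \<rho>2"
    "\<And>g. g \<in> carrier G \<Longrightarrow> fun_char G I \<rho> g = fun_char G {..<r} \<rho>1 g + fun_char G {..<s} \<rho>2 g"
    "\<And>f i. r = 0 \<Longrightarrow> f \<in> W \<Longrightarrow> i \<in> I \<Longrightarrow> f i = 0"
    "\<And>h. s = 0 \<Longrightarrow> \<exists>f\<in>W. \<forall>i\<in>I. f i = h i"
proof -
  interpret group G by fact
  have fin: "finite I" using rep by (rule fun_rep_finite)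
  obtain r and c :: "nat \<Rightarrow> 'i \<Rightarrow> complex" and q where
    c: "\<And>u. u < r \<Longrightarrow> c u \<in> W" and
    bi0: "\<And>u v. u < r \<Longrightarrow> v < r \<Longrightarrow> (\<Sum>i\<in>I. q u i * c v i) = (if u = v then 1 else 0)" and
    sp0: "\<And>w i. w \<in> W \<Longrightarrow> i \<in> I \<Longrightarrow> w i = (\<Sum>u<r. (\<Sum>j\<in>I. q u j * w j) * c u i)"
    using biorthogonal_system[OF fin cl] by blast
  define C where "C i u = c u i" for i u
  have bi: "mat_prod I q C u v = (if u = v then 1 else 0)" if "u < r" "v < r" for u v
    using bi0 that by (simp add: mat_prod_def C_def)
  have sp: "(\<Sum>u<r. C i u * (\<Sum>j\<in>I. q u j * w j)) = w i" if "w \<in> W" "i \<in> I" for w i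
    using sp0[OF that] by (simp add: C_def mult.commute)
  define \<rho>1 where "\<rho>1 g = mat_prod I q (mat_prod I (\<rho> g) C)" for g
  have K: "mat_prod I (\<rho> g) C i v = mat_prod {..<r} C (\<rho>1 g) i v" if a: "g \<in> carrier G" "v < r" "i \<in> I" for g v i
  proof -
    obtain f' where f': "f' \<in> W" "\<And>i. i \<in> I \<Longrightarrow> f' i = (\<Sum>k\<in>I. \<rho> g i k * c v k)"
      using inv[OF a(1) c[OF a(2)]] by blast
    have "mat_prod I (\<rho> g) C i v = f' i" using f' that by (simp add: mat_prod_def C_def)
    also have "\<dots> = (\<Sum>u<r. C i u * (\<Sum>j\<in>I. q u j * f' j))" using sp[OF f'(1) a(3)] by simp
    also have "\<dots> = mat_prod {..<r} C (\<rho>1 g) i v"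
      unfolding \<rho>1_def by (simp add: mat_prod_def f' C_def)
    finally show ?thesis .
  qed
  have rep1: "fun_rep G {..<r} \<rho>1"
    unfolding fun_rep_def
  proof (intro conjI ballI)
    fix g h u v assume a: "g \<in> carrier G" "h \<in> carrier G" "u \<in> {..<r}" "v \<in> {..<r}"
    have "\<rho>1 (g \<otimes>\<^bsub>G\<^esub> h) u v = mat_prod I q (mat_prod I (mat_prod I (\<rho> g) (\<rho> h)) C) u v"
      unfolding \<rho>1_def by (intro mat_prod_cong refl) (use a fun_rep_mm[OF rep] in auto)
    also have "\<dots> = mat_prod I q (mat_prod I (\<rho> g) (mat_prod I (\<rho> h) C)) u v" by (simp add: mat_prod_assoc)
    also have "\<dots> = mat_prod I q (mat_prod I (\<rho> g) (mat_prod {..<r} C (\<rho>1 h))) u v"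
      by (intro mat_prod_cong refl) (use a K in auto)
    also have "\<dots> = mat_prod {..<r} (\<rho>1 g) (\<rho>1 h) u v" unfolding \<rho>1_def[of g] by (simp only: mat_prod_assoc)
    finally show "\<rho>1 (g \<otimes>\<^bsub>G\<^esub> h) u v = (\<Sum>k<r. \<rho>1 g u k * \<rho>1 h k v)" by (simp add: mat_prod_def)
  next
    fix u v assume a: "u \<in> {..<r}" "v \<in> {..<r}"
    have "\<rho>1 \<one>\<^bsub>G\<^esub> u v = mat_prod I q C u v"
      unfolding \<rho>1_def
    proof (rule mat_prod_cong)
      fix k assume "k \<in> I"
      then have "mat_prod I (\<rho> \<one>\<^bsub>G\<^esub>) C k v = mat_prod I (\<lambda>i j. if i = j then 1 else 0) C k v"
        by (intro mat_prod_cong) (auto simp: fun_rep_one[OF rep])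
      then show "mat_prod I (\<rho> \<one>\<^bsub>G\<^esub>) C k v = C k v" using \<open>k \<in> I\<close> fin by (simp add: mat_prod_one)
    qed simp
    then show "\<rho>1 \<one>\<^bsub>G\<^esub> u v = (if u = v then 1 else 0)" using bi a by simp
  qed simp
  \<comment> \<open>C q is a projection onto \<open>W\<close>, so \<open>F\<close> is the
    complementary projection with kernel \<open>W\<close>. Factoring it as P Q gives coordinates
    \<open>Q\<close> on the quotient.\<close>
  define F where "F i j = (if i = j then 1 else 0) + (- mat_prod {..<r} C q i j)" for i j
  have CqC: "mat_prod I (mat_prod {..<r} C q) (mat_prod {..<r} C q) i j = mat_prod {..<r} C q i j" for i j
  proof -
    have "mat_prod I (mat_prod {..<r} C q) (mat_prod {..<r} C q) i j = mat_prod {..<r} C (mat_prod {..<r} (mat_prod I q C) q) i j"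
      by (simp only: mat_prod_assoc)
    also have "\<dots> = mat_prod {..<r} C (mat_prod {..<r} (\<lambda>i j. if i = j then 1 else 0) q) i j"
      by (intro mat_prod_cong refl) (simp add: bi)
    also have "\<dots> = mat_prod {..<r} C q i j" by (intro mat_prod_cong refl) (simp add: mat_prod_one)
    finally show ?thesis .
  qed
  have idem: "(\<Sum>k\<in>I. F i k * F k j) = F i j" if "i \<in> I" "j \<in> I" for i j
  proof -
    have "(\<Sum>k\<in>I. F i k * F k j) = (\<Sum>k\<in>I. (if i = k then 1 else 0) * F k j) -
       (\<Sum>k\<in>I. mat_prod {..<r} C q i k * (if k = j then 1 else 0)) +
       mat_prod I (mat_prod {..<r} C q) (mat_prod {..<r} C q) i j"
      unfolding mat_prod_def[of I] F_def
      by (simp add: algebra_simps sum.distrib sum_subtractf sum_negf)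
    also have "\<dots> = F i j" using that fin by (simp add: sum_mult_delta CqC)
    finally show ?thesis .
  qed
  obtain s and P :: "'i \<Rightarrow> nat \<Rightarrow> complex" and Q where
    PQ: "\<And>i j. i \<in> I \<Longrightarrow> j \<in> I \<Longrightarrow> F i j = (\<Sum>u<s. P i u * Q u j)" and
    QP0: "\<And>u v. u < s \<Longrightarrow> v < s \<Longrightarrow> (\<Sum>i\<in>I. Q u i * P i v) = (if u = v then 1 else 0)" and
    s: "of_nat s = (\<Sum>i\<in>I. F i i)"
    using idempotent_factorization[OF fin idem] by blast
  have dec: "mat_prod {..<s} P Q i j + mat_prod {..<r} C q i j = (if i = j then 1 else 0)" if "i \<in> I" "j \<in> I" for i j
    using PQ[OF that] by (simp add: mat_prod_def F_def algebra_simps)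
  have QP: "mat_prod I Q P u v = (if u = v then 1 else 0)" if "u < s" "v < s" for u v
    using QP0 that by (simp add: mat_prod_def)
  \<comment> \<open>The quotient coordinates annihilate \<open>W\<close>: multiply P Q C = C - C q C
    = 0 by \<open>Q\<close> from the left.\<close>
  have QC: "mat_prod I Q C u v = 0" if "u < s" "v < r" for u v
  proof -
    have FC: "mat_prod I (mat_prod {..<s} P Q) C i v = 0" if "i \<in> I" for i
    proof -
      have "mat_prod I (\<lambda>i j. mat_prod {..<s} P Q i j + mat_prod {..<r} C q i j) C i v = mat_prod I (\<lambda>i j. if i = j then 1 else 0) C i v"
        using that by (intro mat_prod_cong refl) (rule dec)
      then have "mat_prod I (mat_prod {..<s} P Q) C i v + mat_prod {..<r} C (mat_prod I q C) i v = C i v"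
        using fin that by (simp add: mat_prod_one mat_prod_add_left) (simp only: mat_prod_assoc)
      moreover have "mat_prod {..<r} C (mat_prod I q C) i v = mat_prod {..<r} C (\<lambda>i j. if i = j then 1 else 0) i v"
        using \<open>v < r\<close> by (intro mat_prod_cong refl) (simp add: bi)
      ultimately show ?thesis using \<open>v < r\<close> by (simp add: mat_prod_one)
    qed
    have "mat_prod I Q (mat_prod I (mat_prod {..<s} P Q) C) u v = mat_prod I Q (\<lambda>_ _. 0) u v"
      by (intro mat_prod_cong refl) (simp add: FC)
    also have "\<dots> = 0" by (simp add: mat_prod_def)
    also have "mat_prod I Q (mat_prod I (mat_prod {..<s} P Q) C) u v = mat_prod {..<s} (mat_prod I Q P) (mat_prod I Q C) u v"
      by (simp only: mat_prod_assoc)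
    also have "\<dots> = mat_prod {..<s} (\<lambda>i j. if i = j then 1 else 0) (mat_prod I Q C) u v"
      using \<open>u < s\<close> by (intro mat_prod_cong refl) (simp add: QP)
    also have "\<dots> = mat_prod I Q C u v" using \<open>u < s\<close> by (simp add: mat_prod_one)
    finally show ?thesis by simp
  qed
  define \<rho>2 where "\<rho>2 g = mat_prod I Q (mat_prod I (\<rho> g) P)" for g
  have QrC: "mat_prod I Q (mat_prod I (\<rho> g) C) u v = 0" if "u < s" "v < r" "g \<in> carrier G" for u v g
  proof -
    have "mat_prod I Q (mat_prod I (\<rho> g) C) u v = mat_prod I Q (mat_prod {..<r} C (\<rho>1 g)) u v"
      using that K by (intro mat_prod_cong refl) auto
    also have "\<dots> = mat_prod {..<r} (mat_prod I Q C) (\<rho>1 g) u v" by (simp only: mat_prod_assoc)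
    also have "\<dots> = mat_prod {..<r} (\<lambda>_ _. 0) (\<rho>1 g) u v" using that QC by (intro mat_prod_cong refl) auto
    finally show ?thesis by (simp add: mat_prod_def)
  qed
  have rep2: "fun_rep G {..<s} \<rho>2"
    unfolding fun_rep_def
  proof (intro conjI ballI)
    fix g h u v assume a: "g \<in> carrier G" "h \<in> carrier G" "u \<in> {..<s}" "v \<in> {..<s}"
    have "\<rho>2 (g \<otimes>\<^bsub>G\<^esub> h) u v = mat_prod I Q (mat_prod I (mat_prod I (\<rho> g) (\<rho> h)) P) u v"
      unfolding \<rho>2_def by (intro mat_prod_cong refl) (use a fun_rep_mm[OF rep] in auto)
    also have "\<dots> = mat_prod I Q (mat_prod I (\<rho> g) (mat_prod I (\<rho> h) P)) u v" by (simp add: mat_prod_assoc)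
    \<comment> \<open>Insert the identity as P Q + C q between the two group elements. The summand
      with C q contains Q \<rho>(g) C, which is 0 because \<open>W\<close> is invariant.\<close>
    also have "\<dots> = mat_prod I Q (mat_prod I (\<rho> g)
        (mat_prod I (\<lambda>i j. mat_prod {..<s} P Q i j + mat_prod {..<r} C q i j) (mat_prod I (\<rho> h) P))) u v"
    proof (rule mat_prod_cong, rule refl, rule mat_prod_cong, rule refl)
      fix l assume "l \<in> I"
      have "mat_prod I (\<lambda>i j. mat_prod {..<s} P Q i j + mat_prod {..<r} C q i j) (mat_prod I (\<rho> h) P) l v =
        mat_prod I (\<lambda>i j. if i = j then 1 else 0) (mat_prod I (\<rho> h) P) l v"
        using \<open>l \<in> I\<close> by (intro mat_prod_cong refl) (rule dec)
      then show "mat_prod I (\<rho> h) P l v =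
        mat_prod I (\<lambda>i j. mat_prod {..<s} P Q i j + mat_prod {..<r} C q i j) (mat_prod I (\<rho> h) P) l v"
        using \<open>l \<in> I\<close> fin by (simp add: mat_prod_one)
    qed
    also have "\<dots> = mat_prod {..<s} (\<rho>2 g) (\<rho>2 h) u v +
       mat_prod {..<r} (mat_prod I Q (mat_prod I (\<rho> g) C)) (mat_prod I q (mat_prod I (\<rho> h) P)) u v"
      unfolding \<rho>2_def by (simp only: mat_prod_add_left mat_prod_add_right mat_prod_assoc)
    also have "mat_prod {..<r} (mat_prod I Q (mat_prod I (\<rho> g) C)) (mat_prod I q (mat_prod I (\<rho> h) P)) u v =
        mat_prod {..<r} (\<lambda>_ _. 0) (mat_prod I q (mat_prod I (\<rho> h) P)) u v"
      using a QrC by (intro mat_prod_cong refl) auto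
    finally show "\<rho>2 (g \<otimes>\<^bsub>G\<^esub> h) u v = (\<Sum>k<s. \<rho>2 g u k * \<rho>2 h k v)" by (simp add: mat_prod_def)
  next
    fix u v assume a: "u \<in> {..<s}" "v \<in> {..<s}"
    have "\<rho>2 \<one>\<^bsub>G\<^esub> u v = mat_prod I Q P u v"
      unfolding \<rho>2_def
    proof (rule mat_prod_cong)
      fix k assume "k \<in> I"
      then have "mat_prod I (\<rho> \<one>\<^bsub>G\<^esub>) P k v = mat_prod I (\<lambda>i j. if i = j then 1 else 0) P k v"
        by (intro mat_prod_cong) (auto simp: fun_rep_one[OF rep])
      then show "mat_prod I (\<rho> \<one>\<^bsub>G\<^esub>) P k v = P k v" using \<open>k \<in> I\<close> fin by (simp add: mat_prod_one)
    qed simp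
    then show "\<rho>2 \<one>\<^bsub>G\<^esub> u v = (if u = v then 1 else 0)" using QP a by simp
  qed simp
  have "of_nat (r + s) = (of_nat (card I) :: complex)"
  proof -
    have "of_nat s = (\<Sum>i\<in>I. 1 - mat_prod {..<r} C q i i)" unfolding s F_def by simp
    also have "\<dots> = of_nat (card I) - (\<Sum>i\<in>I. mat_prod {..<r} C q i i)" by (simp add: sum_subtractf)
    also have "(\<Sum>i\<in>I. mat_prod {..<r} C q i i) = (\<Sum>u<r. mat_prod I q C u u)" by (rule trace_mm)
    also have "\<dots> = of_nat r" by (simp add: bi)
    finally show ?thesis by simp
  qed
  then have rs: "r + s = card I" by (simp only: of_nat_eq_iff)
  have char: "fun_char G I \<rho> g = fun_char G {..<r} \<rho>1 g + fun_char G {..<s} \<rho>2 g" if g: "g \<in> carrier G" for g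
  proof -
    have "(\<Sum>i\<in>I. \<rho> g i i) = (\<Sum>i\<in>I. mat_prod I (\<rho> g) (\<lambda>i j. mat_prod {..<s} P Q i j + mat_prod {..<r} C q i j) i i)"
    proof (rule sum.cong)
      fix i assume i: "i \<in> I"
      have "mat_prod I (\<rho> g) (\<lambda>i j. mat_prod {..<s} P Q i j + mat_prod {..<r} C q i j) i i =
         mat_prod I (\<rho> g) (\<lambda>i j. if i = j then 1 else 0) i i"
        using i by (intro mat_prod_cong refl) (rule dec)
      then show "\<rho> g i i = mat_prod I (\<rho> g) (\<lambda>i j. mat_prod {..<s} P Q i j + mat_prod {..<r} C q i j) i i"
        using i fin by (simp add: mat_prod_one)
    qed simp
    also have "\<dots> = (\<Sum>i\<in>I. mat_prod I (\<rho> g) (mat_prod {..<s} P Q) i i) + (\<Sum>i\<in>I. mat_prod I (\<rho> g) (mat_prod {..<r} C q) i i)"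
      by (simp add: mat_prod_add_right sum.distrib)
    also have "(\<Sum>i\<in>I. mat_prod I (\<rho> g) (mat_prod {..<s} P Q) i i) = (\<Sum>u<s. \<rho>2 g u u)"
      unfolding mat_prod_assoc[symmetric] \<rho>2_def by (subst trace_mm) (simp only: mat_prod_assoc)
    also have "(\<Sum>i\<in>I. mat_prod I (\<rho> g) (mat_prod {..<r} C q) i i) = (\<Sum>u<r. \<rho>1 g u u)"
      unfolding mat_prod_assoc[symmetric] \<rho>1_def by (subst trace_mm) (simp only: mat_prod_assoc)
    finally show ?thesis using g by (simp add: fun_char_def)
  qed
  have z1: "f i = 0" if "r = 0" "f \<in> W" "i \<in> I" for f i
    using sp[OF that(2,3)] that(1) by simp
  have z2: "\<exists>f\<in>W. \<forall>i\<in>I. f i = h i" if "s = 0" for h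
  proof
    let ?f = "\<lambda>i. 0 + (\<Sum>u<r. (\<Sum>j\<in>I. q u j * h j) * c u i)"
    show "?f \<in> W" by (rule subspace_add_sum[OF cl zero c])
    show "\<forall>i\<in>I. ?f i = h i"
    proof
      fix i assume i: "i \<in> I"
      have "?f i = mat_prod {..<r} C (mat_prod I q (\<lambda>j _. h j)) i ()" by (simp add: mat_prod_def C_def mult.commute)
      also have "\<dots> = mat_prod I (mat_prod {..<r} C q) (\<lambda>j _. h j) i ()" by (simp only: mat_prod_assoc)
      also have "\<dots> = mat_prod I (\<lambda>i j. if i = j then 1 else 0) (\<lambda>j _. h j) i ()"
        using dec i that by (intro mat_prod_cong refl) (simp add: mat_prod_def)
      also have "\<dots> = h i" using i fin by (simp add: mat_prod_one)
      finally show "?f i = h i" .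
    qed
  qed
  show thesis
    by (rule that[OF rs rep1 rep2]) (fact char z1 z2)+
qed

section \<open>Schur's lemma and orthogonality relations\<close>

lemma subspace_vec_iff:
  "VectorSpace.subspace class_ring W (module_vec TYPE(complex) n) \<longleftrightarrow>
    W \<subseteq> carrier_vec n \<and> 0\<^sub>v n \<in> W \<and> (\<forall>v\<in>W. \<forall>w\<in>W. v + w \<in> W) \<and> (\<forall>c. \<forall>v\<in>W. c \<cdot>\<^sub>v v \<in> W)"
proof -
  interpret vec_space "TYPE(complex)" n .
  have "vectorspace class_ring (module_vec TYPE(complex) n)" "Module.module class_ring (module_vec TYPE(complex) n)"
    by unfold_locales
  then show ?thesis
    unfolding VectorSpace.subspace_def submodule_def by (auto simp: class_ring_simps module_vec_simps)
qed

lemma irreducible_subspaceD: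
  assumes "irreducible_representation G n \<rho>" "W \<subseteq> carrier_vec n" "0\<^sub>v n \<in> W"
    "\<And>v w. v \<in> W \<Longrightarrow> w \<in> W \<Longrightarrow> v + w \<in> W" "\<And>c v. v \<in> W \<Longrightarrow> c \<cdot>\<^sub>v v \<in> W"
    "\<And>g v. g \<in> carrier G \<Longrightarrow> v \<in> W \<Longrightarrow> \<rho> g *\<^sub>v v \<in> W"
  shows "W = {0\<^sub>v n} \<or> W = carrier_vec n"
proof -
  have "invariant_subspace G n \<rho> W"
    unfolding invariant_subspace_def subspace_vec_iff by (intro conjI ballI allI assms)
  then show ?thesis using assms(1) unfolding irreducible_representation_def by simp
qed

lemma irreducible_imp_representation: "irreducible_representation G n \<rho> \<Longrightarrow> representation G n \<rho>"
  by (simp add: irreducible_representation_def)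

lemmas irreducible_carrier = representation_carrier[OF irreducible_imp_representation]

lemma mult_mat_vec_unit:
  fixes T :: "complex mat"
  assumes "T \<in> carrier_mat n m" "i < n" "j < m"
  shows "(T *\<^sub>v unit_vec m j) $ i = T $$ (i, j)"
  using assms by (auto simp: scalar_prod_def unit_vec_def if_distrib cong: if_cong)

lemma mat_eq_zeroI:
  fixes T :: "complex mat"
  assumes T: "T \<in> carrier_mat n m" and "\<And>v. v \<in> carrier_vec m \<Longrightarrow> T *\<^sub>v v = 0\<^sub>v n"
  shows "T = 0\<^sub>m n m"
proof (rule eq_matI)
  fix i j assume "i < dim_row (0\<^sub>m n m)" "j < dim_col (0\<^sub>m n m)"
  then have "i < n" "j < m" by auto
  then show "T $$ (i, j) = 0\<^sub>m n m $$ (i, j)"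
    using mult_mat_vec_unit[OF T, of i j] assms(2)[of "unit_vec m j"] by simp
qed (use T in auto)

lemma mat_minus_eq_zeroD:
  fixes A :: "complex mat"
  assumes "A \<in> carrier_mat n m" "B \<in> carrier_mat n m" "A - B = 0\<^sub>m n m"
  shows "A = B"
proof (rule eq_matI)
  fix i j assume "i < dim_row B" "j < dim_col B"
  then have ij: "i < n" "j < m" using assms(2) by auto
  then have "(A - B) $$ (i, j) = 0" using assms(3) by simp
  then show "A $$ (i, j) = B $$ (i, j)" using assms(1,2) ij by simp
qed (use assms in auto)

text \<open>Kernel and image of an intertwiner are invariant subspaces; irreducibility leaves only
  the extreme cases, and T \<noteq> 0 selects injective and surjective.\<close>

lemma schur_invertible:
  fixes T :: "complex mat"
  assumes \<rho>: "irreducible_representation G n \<rho>" and \<sigma>: "irreducible_representation G m \<sigma>"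
    and T: "T \<in> carrier_mat n m" and tw: "\<And>g. g \<in> carrier G \<Longrightarrow> \<rho> g * T = T * \<sigma> g"
    and nz: "T \<noteq> 0\<^sub>m n m"
  obtains S where "S \<in> carrier_mat m n" "T * S = 1\<^sub>m n" "S * T = 1\<^sub>m m"
proof -
  have \<rho>c: "\<rho> g \<in> carrier_mat n n" and \<sigma>c: "\<sigma> g \<in> carrier_mat m m" if "g \<in> carrier G" for g
    using that by (simp_all add: irreducible_carrier[OF \<rho>] irreducible_carrier[OF \<sigma>])
  define W1 where "W1 = {v \<in> carrier_vec m. T *\<^sub>v v = 0\<^sub>v n}"
  have "W1 = {0\<^sub>v m} \<or> W1 = carrier_vec m"
  proof (rule irreducible_subspaceD[OF \<sigma>])
    fix g v assume g: "g \<in> carrier G" and v: "v \<in> W1"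
    then have vc: "v \<in> carrier_vec m" and v0: "T *\<^sub>v v = 0\<^sub>v n" by (auto simp: W1_def)
    have "T *\<^sub>v (\<sigma> g *\<^sub>v v) = (T * \<sigma> g) *\<^sub>v v"
      using assoc_mult_mat_vec[OF T \<sigma>c[OF g] vc] by simp
    also have "\<dots> = \<rho> g *\<^sub>v (T *\<^sub>v v)"
      using assoc_mult_mat_vec[OF \<rho>c[OF g] T vc] tw[OF g] by simp
    also have "\<dots> = 0\<^sub>v n" using \<rho>c[OF g] by (auto simp: v0)
    finally show "\<sigma> g *\<^sub>v v \<in> W1" using \<sigma>c[OF g] vc by (auto simp: W1_def)
  qed (use T in \<open>auto simp: W1_def mult_add_distrib_mat_vec[OF T] mult_mat_vec[OF T]\<close>)
  moreover have "W1 \<noteq> carrier_vec m"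
    using mat_eq_zeroI[OF T] nz by (auto simp: W1_def)
  ultimately have ker: "v = 0\<^sub>v m" if "v \<in> carrier_vec m" "T *\<^sub>v v = 0\<^sub>v n" for v
    using that by (auto simp: W1_def)
  define W2 where "W2 = (\<lambda>v. T *\<^sub>v v) ` carrier_vec m"
  have "W2 = {0\<^sub>v n} \<or> W2 = carrier_vec n"
  proof (rule irreducible_subspaceD[OF \<rho>])
    show "W2 \<subseteq> carrier_vec n" using T by (auto simp: W2_def)
    show "0\<^sub>v n \<in> W2" using T by (auto simp: W2_def intro!: image_eqI[of _ _ "0\<^sub>v m"])
  next
    fix v w assume "v \<in> W2" "w \<in> W2"
    then obtain v' w' where "v' \<in> carrier_vec m" "w' \<in> carrier_vec m" "v = T *\<^sub>v v'" "w = T *\<^sub>v w'"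
      by (auto simp: W2_def)
    then show "v + w \<in> W2" unfolding W2_def
      by (intro image_eqI[of _ _ "v' + w'"]) (auto simp: mult_add_distrib_mat_vec[OF T])
  next
    fix c v assume "v \<in> W2"
    then obtain v' where "v' \<in> carrier_vec m" "v = T *\<^sub>v v'" by (auto simp: W2_def)
    then show "c \<cdot>\<^sub>v v \<in> W2" unfolding W2_def
      by (intro image_eqI[of _ _ "c \<cdot>\<^sub>v v'"]) (auto simp: mult_mat_vec[OF T])
  next
    fix g v assume g: "g \<in> carrier G" and "v \<in> W2"
    then obtain v' where v': "v' \<in> carrier_vec m" "v = T *\<^sub>v v'" by (auto simp: W2_def)
    have "\<rho> g *\<^sub>v v = (\<rho> g * T) *\<^sub>v v'"
      using assoc_mult_mat_vec[OF \<rho>c[OF g] T v'(1)] v'(2) by simp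
    also have "\<dots> = T *\<^sub>v (\<sigma> g *\<^sub>v v')"
      using assoc_mult_mat_vec[OF T \<sigma>c[OF g] v'(1)] tw[OF g] by simp
    finally show "\<rho> g *\<^sub>v v \<in> W2" unfolding W2_def
      using \<sigma>c[OF g] v' by (intro image_eqI[of _ _ "\<sigma> g *\<^sub>v v'"]) auto
  qed
  moreover have "W2 \<noteq> {0\<^sub>v n}" using mat_eq_zeroI[OF T] nz by (auto simp: W2_def)
  ultimately have im: "W2 = carrier_vec n" by simp
  have "\<exists>v. v \<in> carrier_vec m \<and> T *\<^sub>v v = unit_vec n j" if "j < n" for j
  proof -
    have "unit_vec n j \<in> W2" using im by simp
    then show ?thesis by (auto simp: W2_def)
  qed
  then obtain s where s: "\<And>j. j < n \<Longrightarrow> s j \<in> carrier_vec m" "\<And>j. j < n \<Longrightarrow> T *\<^sub>v s j = unit_vec n j"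
    by metis
  define S where "S = mat m n (\<lambda>(i, j). s j $ i)"
  have S: "S \<in> carrier_mat m n" by (simp add: S_def)
  have colS: "col S j = s j" if "j < n" for j
    using s(1)[OF that] that by (auto simp: S_def intro!: eq_vecI)
  have TS: "T * S = 1\<^sub>m n"
  proof (rule eq_matI)
    fix i j assume ij: "i < dim_row (1\<^sub>m n)" "j < dim_col (1\<^sub>m n)"
    then have "(T * S) $$ (i, j) = (T *\<^sub>v s j) $ i" using T S colS[of j] by simp
    then show "(T * S) $$ (i, j) = 1\<^sub>m n $$ (i, j)" using s(2)[of j] ij by simp
  qed (use T S in auto)
  \<comment> \<open>S T v - v lies in the kernel of \<open>T\<close>, since T S = 1, and the kernel
    is trivial.\<close>
  have "S * T - 1\<^sub>m m = 0\<^sub>m m m"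
  proof (rule mat_eq_zeroI)
    show "S * T - 1\<^sub>m m \<in> carrier_mat m m" using S T by auto
    fix v :: "complex vec" assume v: "v \<in> carrier_vec m"
    have "(S * T - 1\<^sub>m m) *\<^sub>v v = (S * T) *\<^sub>v v - v"
      using S T v by (subst minus_mult_distrib_mat_vec[of _ m m]) auto
    also have "\<dots> = 0\<^sub>v m"
    proof (rule ker)
      show "(S * T) *\<^sub>v v - v \<in> carrier_vec m" using S T v by auto
      have "T *\<^sub>v ((S * T) *\<^sub>v v - v) = T *\<^sub>v ((S * T) *\<^sub>v v) - T *\<^sub>v v"
        using S T v by (subst mult_minus_distrib_mat_vec[of _ n m]) auto
      also have "T *\<^sub>v ((S * T) *\<^sub>v v) = (T * S) *\<^sub>v (T *\<^sub>v v)"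
        using S T v by (simp add: assoc_mult_mat_vec[of _ m n _ m] assoc_mult_mat_vec[of _ n m _ n])
      finally show "T *\<^sub>v ((S * T) *\<^sub>v v - v) = 0\<^sub>v n" using TS T v by simp
    qed
    finally show "(S * T - 1\<^sub>m m) *\<^sub>v v = 0\<^sub>v m" .
  qed
  then have "S * T = 1\<^sub>m m" by (rule mat_minus_eq_zeroD[rotated 2]) (use S T in auto)
  then show thesis using that S TS by blast
qed

lemma mat_trace_mult_comm:
  assumes "A \<in> carrier_mat n m" "B \<in> carrier_mat m n"
  shows "mat_trace (A * B) = mat_trace (B * A)"
proof -
  have "mat_trace (A * B) = (\<Sum>i<n. \<Sum>k<m. A $$ (i, k) * B $$ (k, i))"
    using assms by (simp add: mat_trace_def index_mult_mat_sum[OF assms] del: index_mult_mat(1))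
  also have "\<dots> = (\<Sum>k<m. \<Sum>i<n. B $$ (k, i) * A $$ (i, k))" by (subst sum.swap) (simp add: mult.commute)
  also have "\<dots> = mat_trace (B * A)"
    using assms by (simp add: mat_trace_def index_mult_mat_sum[OF assms(2,1)] del: index_mult_mat(1))
  finally show ?thesis .
qed

lemma schur_same_character:
  fixes T :: "complex mat"
  assumes \<rho>: "irreducible_representation G n \<rho>" and \<sigma>: "irreducible_representation G m \<sigma>"
    and T: "T \<in> carrier_mat n m" and tw: "\<And>g. g \<in> carrier G \<Longrightarrow> \<rho> g * T = T * \<sigma> g"
    and nz: "T \<noteq> 0\<^sub>m n m"
  shows "character_of G \<rho> = character_of G \<sigma>"
proof -
  obtain S where S: "S \<in> carrier_mat m n" "T * S = 1\<^sub>m n" "S * T = 1\<^sub>m m"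
    using schur_invertible[OF assms] by metis
  have "mat_trace (\<rho> g) = mat_trace (\<sigma> g)" if g: "g \<in> carrier G" for g
  proof -
    have \<rho>c: "\<rho> g \<in> carrier_mat n n" and \<sigma>c: "\<sigma> g \<in> carrier_mat m m"
      using g by (simp_all add: irreducible_carrier[OF \<rho>] irreducible_carrier[OF \<sigma>])
    have "\<rho> g = (\<rho> g * T) * S" using assoc_mult_mat[OF \<rho>c T S(1)] S(2) \<rho>c by simp
    also have "\<dots> = T * (\<sigma> g * S)" using assoc_mult_mat[OF T \<sigma>c S(1)] tw[OF g] by simp
    finally have "mat_trace (\<rho> g) = mat_trace ((\<sigma> g * S) * T)"
      using mat_trace_mult_comm[OF T, of "\<sigma> g * S"] \<sigma>c S(1) by simp
    also have "(\<sigma> g * S) * T = \<sigma> g" using assoc_mult_mat[OF \<sigma>c S(1) T] S(3) \<sigma>c by simp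
    finally show ?thesis .
  qed
  then show ?thesis by (auto simp: character_of_def fun_eq_iff)
qed

text \<open>A complex matrix of positive size has an eigenvalue c. Then T - c 1 is again an
  intertwiner and kills a nonzero vector, so it cannot be invertible and must be 0.\<close>

lemma schur_scalar:
  fixes T :: "complex mat"
  assumes \<rho>: "irreducible_representation G n \<rho>"
    and T: "T \<in> carrier_mat n n" and tw: "\<And>g. g \<in> carrier G \<Longrightarrow> \<rho> g * T = T * \<rho> g"
  obtains c where "T = c \<cdot>\<^sub>m 1\<^sub>m n"
proof -
  have "n > 0" using \<rho> by (simp add: irreducible_representation_def)
  then obtain c where "eigenvalue T c"
    using spectrum_non_empty[OF T] by (auto simp: spectrum_def)
  then obtain v where v: "v \<in> carrier_vec n" "v \<noteq> 0\<^sub>v n" "T *\<^sub>v v = c \<cdot>\<^sub>v v"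
    using T by (auto simp: eigenvalue_def eigenvector_def)
  define X where "X = T - c \<cdot>\<^sub>m 1\<^sub>m n"
  have X: "X \<in> carrier_mat n n" by (simp add: X_def minus_carrier_mat)
  have "(c \<cdot>\<^sub>m 1\<^sub>m n) *\<^sub>v v = c \<cdot>\<^sub>v v"
  proof (rule eq_vecI)
    fix i assume "i < dim_vec (c \<cdot>\<^sub>v v)"
    then have i: "i < n" using v by simp
    then have "((c \<cdot>\<^sub>m 1\<^sub>m n) *\<^sub>v v) $ i = (\<Sum>k<n. (if i = k then 1 else 0) * (c * v $ k))"
      using v by (auto simp: scalar_prod_def lessThan_atLeast0 intro!: sum.cong)
    then show "((c \<cdot>\<^sub>m 1\<^sub>m n) *\<^sub>v v) $ i = (c \<cdot>\<^sub>v v) $ i" using i v by (simp add: sum_mult_delta)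
  qed (use v in auto)
  then have Xv: "X *\<^sub>v v = 0\<^sub>v n"
    using T v by (simp add: X_def minus_mult_distrib_mat_vec[of _ n n])
  have "X = 0\<^sub>m n n"
  proof (rule ccontr)
    assume nz: "X \<noteq> 0\<^sub>m n n"
    have "\<rho> g * X = X * \<rho> g" if g: "g \<in> carrier G" for g
    proof -
      have \<rho>c: "\<rho> g \<in> carrier_mat n n"
        using g by (rule irreducible_carrier[OF \<rho>])
      show ?thesis unfolding X_def
        using \<rho>c T tw[OF g] by (simp add: mult_minus_distrib_mat[of _ n n] minus_mult_distrib_mat[of _ n n]
          mult_smult_distrib[of _ n n _ n] mult_smult_assoc_mat[of _ n n _ n])
    qed
    then obtain S where S: "S \<in> carrier_mat n n" "X * S = 1\<^sub>m n" "S * X = 1\<^sub>m n"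
      using schur_invertible[OF \<rho> \<rho> X _ nz] by metis
    have "v = (S * X) *\<^sub>v v" using S(3) v by simp
    also have "\<dots> = S *\<^sub>v (X *\<^sub>v v)" using assoc_mult_mat_vec[OF S(1) X v(1)] .
    also have "\<dots> = 0\<^sub>v n" using S(1) by (auto simp: Xv)
    finally show False using v by simp
  qed
  then have "T = c \<cdot>\<^sub>m 1\<^sub>m n"
    unfolding X_def by (rule mat_minus_eq_zeroD[rotated 2]) (use T in auto)
  then show thesis by (rule that)
qed

locale fin_group = group G for G (structure) +
  assumes fin_carrier: "finite (carrier G)"
begin

lemma card_carrier_pos: "card (carrier G) > 0"
  using fin_carrier one_closed by (auto simp: card_gt_0_iff)

lemma sum_translate:
  assumes "h \<in> carrier G"
  shows "(\<Sum>g\<in>carrier G. f (h \<otimes> g)) = (\<Sum>g\<in>carrier G. f g)"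
proof (rule sum.reindex_bij_witness[where i = "\<lambda>g. inv h \<otimes> g" and j = "\<lambda>g. h \<otimes> g"])
qed (use assms in \<open>auto simp: m_assoc[symmetric]\<close>)

lemma sum_inv: "(\<Sum>g\<in>carrier G. f (inv g)) = (\<Sum>g\<in>carrier G. f g)"
  by (rule sum.reindex_bij_witness[where i = "\<lambda>g. inv g" and j = "\<lambda>g. inv g"]) auto

text \<open>\<open>T\<close> is the sum of \<rho>(g) E \<sigma>(inv g) over the group, with E the
  elementary matrix at (k, l). Translating g by h moves \<rho>(h) on the left to \<sigma>(h) on the
  right.\<close>

lemma sum_irreducible_entries:
  assumes \<rho>: "irreducible_representation G n \<rho>" and \<sigma>: "irreducible_representation G m \<sigma>"
    and kl: "k < n" "l < m"
  defines "T \<equiv> mat n m (\<lambda>(i, j). \<Sum>g\<in>carrier G. \<rho> g $$ (i, k) * \<sigma> (inv g) $$ (l, j))"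
  assumes h: "h \<in> carrier G"
  shows "\<rho> h * T = T * \<sigma> h"
proof (rule eq_matI)
  have T: "T \<in> carrier_mat n m" by (simp add: T_def)
  note c = irreducible_carrier[OF \<rho>] irreducible_carrier[OF \<sigma>]
  note m = representation_mult[OF irreducible_imp_representation[OF \<rho>]]
    representation_mult[OF irreducible_imp_representation[OF \<sigma>]]
  fix i j assume "i < dim_row (T * \<sigma> h)" "j < dim_col (T * \<sigma> h)"
  then have ij: "i < n" "j < m" using T c(2)[OF h] by auto
  have "(\<rho> h * T) $$ (i, j) = (\<Sum>i'<n. \<rho> h $$ (i, i') * (\<Sum>g\<in>carrier G. \<rho> g $$ (i', k) * \<sigma> (inv g) $$ (l, j)))"
    using ij by (subst index_mult_mat_sum[OF c(1)[OF h] T]) (auto simp: T_def)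
  also have "\<dots> = (\<Sum>g\<in>carrier G. (\<Sum>i'<n. \<rho> h $$ (i, i') * \<rho> g $$ (i', k)) * \<sigma> (inv g) $$ (l, j))"
    unfolding sum_distrib_left sum_distrib_right by (subst sum.swap) (simp add: mult_ac)
  also have "\<dots> = (\<Sum>g\<in>carrier G. \<rho> (h \<otimes> g) $$ (i, k) * \<sigma> (inv (h \<otimes> g) \<otimes> h) $$ (l, j))"
  proof (rule sum.cong)
    fix g assume g: "g \<in> carrier G"
    have "inv (h \<otimes> g) \<otimes> h = inv g" using g h by (simp add: inv_mult_group m_assoc)
    moreover have "\<rho> (h \<otimes> g) $$ (i, k) = (\<Sum>i'<n. \<rho> h $$ (i, i') * \<rho> g $$ (i', k))"
      unfolding m(1)[OF h g] by (rule index_mult_mat_sum[OF c(1)[OF h] c(1)[OF g] ij(1) kl(1)])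
    ultimately show "(\<Sum>i'<n. \<rho> h $$ (i, i') * \<rho> g $$ (i', k)) * \<sigma> (inv g) $$ (l, j) =
      \<rho> (h \<otimes> g) $$ (i, k) * \<sigma> (inv (h \<otimes> g) \<otimes> h) $$ (l, j)" by simp
  qed simp
  also have "\<dots> = (\<Sum>g\<in>carrier G. \<rho> g $$ (i, k) * \<sigma> (inv g \<otimes> h) $$ (l, j))"
    by (rule sum_translate[OF h])
  also have "\<dots> = (\<Sum>g\<in>carrier G. \<Sum>j'<m. \<rho> g $$ (i, k) * (\<sigma> (inv g) $$ (l, j') * \<sigma> h $$ (j', j)))"
  proof (rule sum.cong)
    fix g assume g: "g \<in> carrier G"
    have "\<sigma> (inv g \<otimes> h) $$ (l, j) = (\<Sum>j'<m. \<sigma> (inv g) $$ (l, j') * \<sigma> h $$ (j', j))"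
      unfolding m(2)[OF inv_closed[OF g] h]
      by (rule index_mult_mat_sum[OF c(2)[OF inv_closed[OF g]] c(2)[OF h] kl(2) ij(2)])
    then show "\<rho> g $$ (i, k) * \<sigma> (inv g \<otimes> h) $$ (l, j) =
      (\<Sum>j'<m. \<rho> g $$ (i, k) * (\<sigma> (inv g) $$ (l, j') * \<sigma> h $$ (j', j)))"
      by (simp add: sum_distrib_left)
  qed simp
  also have "\<dots> = (\<Sum>j'<m. (\<Sum>g\<in>carrier G. \<rho> g $$ (i, k) * \<sigma> (inv g) $$ (l, j')) * \<sigma> h $$ (j', j))"
    unfolding sum_distrib_right by (subst sum.swap) (simp add: mult_ac)
  also have "\<dots> = (T * \<sigma> h) $$ (i, j)"
    using ij by (subst index_mult_mat_sum[OF T c(2)[OF h]]) (auto simp: T_def)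
  finally show "(\<rho> h * T) $$ (i, j) = (T * \<sigma> h) $$ (i, j)" .
next
  show "dim_row (\<rho> h * T) = dim_row (T * \<sigma> h)" "dim_col (\<rho> h * T) = dim_col (T * \<sigma> h)"
    using irreducible_carrier[OF \<rho> h] irreducible_carrier[OF \<sigma> h] by (auto simp: T_def)
qed

lemma entry_orthogonality_diff:
  assumes \<rho>: "irreducible_representation G n \<rho>" and \<sigma>: "irreducible_representation G m \<sigma>"
    and ne: "character_of G \<rho> \<noteq> character_of G \<sigma>" and "i < n" "k < n" "l < m" "j < m"
  shows "(\<Sum>g\<in>carrier G. \<rho> g $$ (i, k) * \<sigma> (inv g) $$ (l, j)) = 0"
proof -
  define T where "T = mat n m (\<lambda>(i, j). \<Sum>g\<in>carrier G. \<rho> g $$ (i, k) * \<sigma> (inv g) $$ (l, j))"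
  have "T = 0\<^sub>m n m"
  proof (rule ccontr)
    assume "T \<noteq> 0\<^sub>m n m"
    then have "character_of G \<rho> = character_of G \<sigma>"
      by (intro schur_same_character[OF \<rho> \<sigma>, of T])
        (auto simp: T_def intro!: sum_irreducible_entries[OF \<rho> \<sigma>] assms)
    then show False using ne by simp
  qed
  then have "T $$ (i, j) = 0" using assms by simp
  then show ?thesis using assms by (simp add: T_def)
qed

text \<open>The averaged matrix is a scalar c. Its trace, evaluated with \<rho>(inv g) \<rho>(g) =
  1, gives n c = |G| if k = l and 0 otherwise.\<close>

lemma entry_orthogonality_same:
  assumes \<rho>: "irreducible_representation G n \<rho>" and ij: "i < n" "k < n" "l < n" "j < n"
  shows "(\<Sum>g\<in>carrier G. \<rho> g $$ (i, k) * \<rho> (inv g) $$ (l, j)) =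
    (if i = j \<and> k = l then of_nat (card (carrier G)) / of_nat n else 0)"
proof -
  define T where "T = mat n n (\<lambda>(i, j). \<Sum>g\<in>carrier G. \<rho> g $$ (i, k) * \<rho> (inv g) $$ (l, j))"
  note rep = irreducible_imp_representation[OF \<rho>]
  obtain c where c: "T = c \<cdot>\<^sub>m 1\<^sub>m n"
  proof (rule schur_scalar[OF \<rho>])
    show "T \<in> carrier_mat n n" by (simp add: T_def)
    show "\<rho> g * T = T * \<rho> g" if "g \<in> carrier G" for g
      unfolding T_def by (rule sum_irreducible_entries[OF \<rho> \<rho> ij(2,3) that])
  qed
  have Tij: "(\<Sum>g\<in>carrier G. \<rho> g $$ (i, k) * \<rho> (inv g) $$ (l, j)) = (if i = j then c else 0)"
    if "i < n" "j < n" for i j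
  proof -
    have "T $$ (i, j) = (if i = j then c else 0)" using that c by simp
    then show ?thesis using that by (simp add: T_def)
  qed
  have "of_nat n * c = (\<Sum>i<n. \<Sum>g\<in>carrier G. \<rho> g $$ (i, k) * \<rho> (inv g) $$ (l, i))"
    by (simp add: Tij)
  also have "\<dots> = (\<Sum>g\<in>carrier G. \<Sum>i<n. \<rho> (inv g) $$ (l, i) * \<rho> g $$ (i, k))"
    by (subst sum.swap) (simp add: mult.commute)
  also have "\<dots> = (\<Sum>g\<in>carrier G. if k = l then 1 else 0)"
  proof (rule sum.cong)
    fix g assume g: "g \<in> carrier G"
    have "(\<Sum>i<n. \<rho> (inv g) $$ (l, i) * \<rho> g $$ (i, k)) = (\<rho> (inv g) * \<rho> g) $$ (l, k)"
      
      by (rule index_mult_mat_sum[symmetric, OF irreducible_carrier[OF \<rho> inv_closed[OF g]]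
        irreducible_carrier[OF \<rho> g] ij(3,2)])
    also have "\<rho> (inv g) * \<rho> g = 1\<^sub>m n"
      using representation_mult[OF rep inv_closed[OF g] g] representation_one[OF is_group rep] g by simp
    finally show "(\<Sum>i<n. \<rho> (inv g) $$ (l, i) * \<rho> g $$ (i, k)) = (if k = l then 1 else 0)"
      using ij by auto
  qed simp
  finally have "of_nat n * c = (if k = l then of_nat (card (carrier G)) else 0)" by simp
  then have "c = (if k = l then of_nat (card (carrier G)) / of_nat n else 0)"
    using ij(1) by (auto simp: field_simps split: if_splits)
  then show ?thesis using Tij[OF ij(1,4)] by simp
qed

end

text \<open>Relations between matrix entries depend on the matrices and not only on their traces.
  Fixing one model for every character allows them to be stated with the plain test \<chi> =
  \<psi>.\<close>

definition irr_model :: "('g, 'b) monoid_scheme \<Rightarrow> ('g \<Rightarrow> complex) \<Rightarrow> nat \<times> ('g \<Rightarrow> complex mat)" where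
  "irr_model G \<chi> = (SOME m. irreducible_representation G (fst m) (snd m) \<and> character_of G (snd m) = \<chi>)"

definition irr_dim :: "('g, 'b) monoid_scheme \<Rightarrow> ('g \<Rightarrow> complex) \<Rightarrow> nat" where
  "irr_dim G \<chi> = fst (irr_model G \<chi>)"

definition irr_entry :: "('g, 'b) monoid_scheme \<Rightarrow> ('g \<Rightarrow> complex) \<Rightarrow> 'g \<Rightarrow> nat \<Rightarrow> nat \<Rightarrow> complex" where
  "irr_entry G \<chi> g i j = snd (irr_model G \<chi>) g $$ (i, j)"

lemma irr_model:
  assumes "\<chi> \<in> Irr G"
  shows "irreducible_representation G (irr_dim G \<chi>) (snd (irr_model G \<chi>))"
    and "character_of G (snd (irr_model G \<chi>)) = \<chi>"
proof -
  have "\<exists>m. irreducible_representation G (fst m) (snd m) \<and> character_of G (snd m) = \<chi>"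
    using assms by (auto simp: Irr_def)
  from someI_ex[OF this] show "irreducible_representation G (irr_dim G \<chi>) (snd (irr_model G \<chi>))"
    and "character_of G (snd (irr_model G \<chi>)) = \<chi>"
    by (auto simp: irr_model_def irr_dim_def)
qed

lemma irr_dim_pos: "\<chi> \<in> Irr G \<Longrightarrow> irr_dim G \<chi> > 0"
  using irr_model(1) by (auto simp: irreducible_representation_def)

lemma irr_fun_rep: "group G \<Longrightarrow> \<chi> \<in> Irr G \<Longrightarrow> fun_rep G {..<irr_dim G \<chi>} (irr_entry G \<chi>)"
  using representation_imp_fun_rep[OF _ irreducible_imp_representation[OF irr_model(1)]]
  by (simp add: irr_entry_def[abs_def])

lemma irr_fun_char: "\<chi> \<in> Irr G \<Longrightarrow> fun_char G {..<irr_dim G \<chi>} (irr_entry G \<chi>) = \<chi>"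
  unfolding irr_entry_def[abs_def]
  using character_of_eq_fun_char[OF irreducible_imp_representation[OF irr_model(1)], symmetric] irr_model(2)
  by (rule trans)

lemma irr_char_sum: "\<chi> \<in> Irr G \<Longrightarrow> g \<in> carrier G \<Longrightarrow> \<chi> g = (\<Sum>i<irr_dim G \<chi>. irr_entry G \<chi> g i i)"
  by (subst irr_fun_char[symmetric]) (auto simp: fun_char_def)

text \<open>An inverse instead of a complex conjugate makes the form bilinear and symmetric for
  arbitrary functions. On characters it agrees with the hermitian product by
  \<open>genuine_char_inv\<close>.\<close>

definition cip :: "('g, 'b) monoid_scheme \<Rightarrow> ('g \<Rightarrow> complex) \<Rightarrow> ('g \<Rightarrow> complex) \<Rightarrow> complex" where
  "cip G f h = (\<Sum>g\<in>carrier G. f g * h (inv\<^bsub>G\<^esub> g)) / of_nat (card (carrier G))"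

lemma cip_sum_left: "cip G (\<lambda>g. \<Sum>i\<in>A. c i * f i g) h = (\<Sum>i\<in>A. c i * cip G (f i) h)"
  unfolding cip_def sum_distrib_right sum_divide_distrib sum_distrib_left
  by (subst sum.swap) (simp add: mult_ac)

lemma cip_add_left: "cip G (\<lambda>g. f g + f' g) h = cip G f h + cip G f' h"
  by (simp add: cip_def algebra_simps sum.distrib add_divide_distrib)

lemma cip_cong_group:
  assumes "group G" "\<And>g. g \<in> carrier G \<Longrightarrow> f g = f' g" "\<And>g. g \<in> carrier G \<Longrightarrow> h g = h' g"
  shows "cip G f h = cip G f' h'"
  using assms by (auto simp: cip_def group.inv_closed intro!: sum.cong arg_cong2[of _ _ _ _ "(/)"])

section \<open>Decomposition of characters and inner products\<close>

context fin_group
begin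

lemma irr_entry_orthogonality:
  assumes "\<chi> \<in> Irr G" "\<psi> \<in> Irr G" "i < irr_dim G \<chi>" "k < irr_dim G \<chi>" "l < irr_dim G \<psi>" "j < irr_dim G \<psi>"
  shows "(\<Sum>g\<in>carrier G. irr_entry G \<chi> g i k * irr_entry G \<psi> (inv g) l j) =
    (if \<chi> = \<psi> \<and> i = j \<and> k = l then of_nat (card (carrier G)) / of_nat (irr_dim G \<chi>) else 0)"
proof (cases "\<chi> = \<psi>")
  case True
  then show ?thesis
    using entry_orthogonality_same[OF irr_model(1)[OF assms(1)], of i k l j] assms
    by (simp add: irr_entry_def)
next
  case False
  then show ?thesis
    using entry_orthogonality_diff[OF irr_model(1)[OF assms(1)] irr_model(1)[OF assms(2)], of i k l j]
      assms irr_model(2)[of \<chi> G] irr_model(2)[of \<psi> G]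
    by (simp add: irr_entry_def)
qed

lemma cip_commute: "cip G f h = cip G h f"
proof -
  have "(\<Sum>g\<in>carrier G. f g * h (inv g)) = (\<Sum>g\<in>carrier G. f (inv g) * h (inv (inv g)))"
    by (rule sum_inv[symmetric])
  then show ?thesis by (simp add: cip_def mult.commute)
qed

lemma cip_cong:
  "(\<And>g. g \<in> carrier G \<Longrightarrow> f g = f' g) \<Longrightarrow> (\<And>g. g \<in> carrier G \<Longrightarrow> h g = h' g) \<Longrightarrow> cip G f h = cip G f' h'"
  by (rule cip_cong_group[OF is_group])

lemma cip_Irr:
  assumes "\<chi> \<in> Irr G" "\<psi> \<in> Irr G"
  shows "cip G \<chi> \<psi> = (if \<chi> = \<psi> then 1 else 0)"
proof -
  let ?d = "irr_dim G \<chi>" and ?e = "irr_dim G \<psi>" and ?c = "of_nat (card (carrier G)) :: complex"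
  have "(\<Sum>g\<in>carrier G. \<chi> g * \<psi> (inv g)) =
    (\<Sum>g\<in>carrier G. \<Sum>i<?d. \<Sum>j<?e. irr_entry G \<chi> g i i * irr_entry G \<psi> (inv g) j j)"
    using irr_char_sum[OF assms(1)] irr_char_sum[OF assms(2)]
    by (intro sum.cong refl) (simp add: sum_product)
  also have "\<dots> = (\<Sum>i<?d. \<Sum>j<?e. \<Sum>g\<in>carrier G. irr_entry G \<chi> g i i * irr_entry G \<psi> (inv g) j j)"
    by (subst sum.swap, intro sum.cong refl, subst sum.swap, rule refl)
  also have "\<dots> = (\<Sum>i<?d. \<Sum>j<?e. if \<chi> = \<psi> \<and> i = j then ?c / of_nat ?d else 0)"
    by (intro sum.cong refl) (auto simp: irr_entry_orthogonality[OF assms])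
  also have "\<dots> = (if \<chi> = \<psi> then ?c else 0)"
    using irr_dim_pos[OF assms(1)] by auto
  finally show ?thesis using card_carrier_pos by (simp add: cip_def)
qed

lemma Irr_genuine: "\<chi> \<in> Irr G \<Longrightarrow> genuine_char G \<chi>"
  by (rule Irr_imp_genuine_char)

text \<open>Strong induction on the degree: a proper nonzero invariant subspace yields, through
  \<open>fun_rep_split\<close>, two representations of smaller degree whose characters add
  up.\<close>

lemma decompose_aux:
  "fun_rep G {..<n::nat} \<rho> \<Longrightarrow>
    \<exists>M. set_mset M \<subseteq> Irr G \<and> (\<forall>g\<in>carrier G. fun_char G {..<n} \<rho> g = (\<Sum>\<psi>\<in>#M. \<psi> g))"
proof (induction n arbitrary: \<rho> rule: less_induct)
  case (less n)
  let ?M = "\<lambda>g. mat n n (\<lambda>(i, j). \<rho> g i j)"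
  note rep = fun_rep_imp_representation[OF is_group less.prems]
  consider "n = 0" | "irreducible_representation G n ?M"
    | W where "n > 0" "invariant_subspace G n ?M W" "W \<noteq> {0\<^sub>v n}" "W \<noteq> carrier_vec n"
    using rep(1) unfolding irreducible_representation_def by blast
  then show ?case
  proof cases
    case 1
    then show ?thesis by (intro exI[of _ "{#}"]) (auto simp: fun_char_def)
  next
    case 2
    then have "character_of G ?M \<in> Irr G" by (auto simp: Irr_def)
    then show ?thesis using rep(2) by (intro exI[of _ "{#character_of G ?M#}"]) simp
  next
    case 3
    \<comment> \<open>Vectors become functions padded by 0 beyond \<open>n\<close>, the format of
      \<open>fun_rep_split\<close>.\<close>
    define W' where "W' = (\<lambda>w i. if i < n then w $ i else 0) ` W"
    have W: "W \<subseteq> carrier_vec n" "0\<^sub>v n \<in> W" "\<And>v w. v \<in> W \<Longrightarrow> w \<in> W \<Longrightarrow> v + w \<in> W"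
      "\<And>c v. v \<in> W \<Longrightarrow> c \<cdot>\<^sub>v v \<in> W" "\<And>g v. g \<in> carrier G \<Longrightarrow> v \<in> W \<Longrightarrow> ?M g *\<^sub>v v \<in> W"
      using 3(2) unfolding invariant_subspace_def subspace_vec_iff by blast+
    have dim: "dim_vec w = n" if "w \<in> W" for w using W(1) that by auto
    have zero: "(\<lambda>i. 0) \<in> W'" unfolding W'_def
      using W(2) by (intro image_eqI[of _ _ "0\<^sub>v n"]) auto
    have cl: "(\<lambda>i. f i + a * g i) \<in> W'" if "f \<in> W'" "g \<in> W'" for f g a
    proof -
      obtain v w where vw: "v \<in> W" "w \<in> W" "f = (\<lambda>i. if i < n then v $ i else 0)"
        "g = (\<lambda>i. if i < n then w $ i else 0)" using \<open>f \<in> W'\<close> \<open>g \<in> W'\<close> by (auto simp: W'_def)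
      then show ?thesis unfolding W'_def
        using dim by (intro image_eqI[of _ _ "v + a \<cdot>\<^sub>v w"]) (auto simp: fun_eq_iff W)
    qed
    have inv: "\<exists>f'\<in>W'. \<forall>i\<in>{..<n}. f' i = (\<Sum>k\<in>{..<n}. \<rho> g i k * f k)"
      if "g \<in> carrier G" "f \<in> W'" for g f
    proof -
      obtain w where w: "w \<in> W" "f = (\<lambda>i. if i < n then w $ i else 0)"
        using \<open>f \<in> W'\<close> by (auto simp: W'_def)
      have "?M g *\<^sub>v w \<in> W" using W(5) that w by blast
      then have "(\<lambda>i. if i < n then (?M g *\<^sub>v w) $ i else 0) \<in> W'" by (auto simp: W'_def)
      then show ?thesis
        by (rule bexI[rotated]) (auto simp: w(2) scalar_prod_def dim[OF w(1)] lessThan_atLeast0 intro!: sum.cong)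
    qed
    obtain r s \<rho>1 \<rho>2 where rs: "r + s = card {..<n}" and
      reps: "fun_rep G {..<r} \<rho>1" "fun_rep G {..<s} \<rho>2" and
      ch: "\<And>g. g \<in> carrier G \<Longrightarrow> fun_char G {..<n} \<rho> g = fun_char G {..<r} \<rho>1 g + fun_char G {..<s} \<rho>2 g" and
      z1: "\<And>f i. r = 0 \<Longrightarrow> f \<in> W' \<Longrightarrow> i \<in> {..<n} \<Longrightarrow> f i = 0" and
      z2: "\<And>h. s = 0 \<Longrightarrow> \<exists>f\<in>W'. \<forall>i\<in>{..<n}. f i = h i"
      by (rule fun_rep_split[OF is_group less.prems zero cl inv]) (assumption | rule that)+
    have "r \<noteq> 0"
    proof
      assume "r = 0"
      have "w = 0\<^sub>v n" if "w \<in> W" for w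
      proof (rule eq_vecI)
        fix i assume "i < dim_vec (0\<^sub>v n)"
        moreover have "(\<lambda>i. if i < n then w $ i else 0) \<in> W'" using that by (auto simp: W'_def)
        ultimately show "w $ i = 0\<^sub>v n $ i" using z1[OF \<open>r = 0\<close>, of "\<lambda>i. if i < n then w $ i else 0" i] by simp
      qed (use dim[OF that] in simp)
      then show False using 3 W(2) by blast
    qed
    moreover have "s \<noteq> 0"
    proof
      assume "s = 0"
      have "v \<in> W" if "v \<in> carrier_vec n" for v
      proof -
        obtain f where f: "f \<in> W'" "\<forall>i\<in>{..<n}. f i = v $ i" using z2[OF \<open>s = 0\<close>] by blast
        then obtain w where w: "w \<in> W" "f = (\<lambda>i. if i < n then w $ i else 0)" by (auto simp: W'_def)
        then have "v = w" using f(2) that dim[OF w(1)] by (intro eq_vecI) auto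
        then show ?thesis using w by simp
      qed
      then show False using 3 W(1) by blast
    qed
    ultimately have "r < n" "s < n" using rs by auto
    obtain M1 where M1: "set_mset M1 \<subseteq> Irr G" "\<forall>g\<in>carrier G. fun_char G {..<r} \<rho>1 g = (\<Sum>\<psi>\<in>#M1. \<psi> g)"
      using less.IH[OF \<open>r < n\<close> reps(1)] by blast
    obtain M2 where M2: "set_mset M2 \<subseteq> Irr G" "\<forall>g\<in>carrier G. fun_char G {..<s} \<rho>2 g = (\<Sum>\<psi>\<in>#M2. \<psi> g)"
      using less.IH[OF \<open>s < n\<close> reps(2)] by blast
    show ?thesis using M1 M2 ch by (intro exI[of _ "M1 + M2"]) simp
  qed
qed

lemma genuine_char_decompose:
  assumes "genuine_char G f"
  shows "\<exists>M. set_mset M \<subseteq> Irr G \<and> (\<forall>g\<in>carrier G. f g = (\<Sum>\<psi>\<in>#M. \<psi> g))"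
proof -
  obtain n \<rho> where "fun_rep G {..<n::nat} \<rho>" "f = fun_char G {..<n} \<rho>"
    using genuine_charE[OF is_group assms] .
  then show ?thesis using decompose_aux by simp
qed

lemma cip_sum_mset: "cip G (\<lambda>g. \<Sum>\<psi>\<in>#M. \<psi> g) h = (\<Sum>\<psi>\<in>#M. cip G \<psi> h)"
proof (induction M)
  case empty
  then show ?case by (simp add: cip_def)
next
  case (add x M)
  then show ?case by (simp add: cip_add_left)
qed

lemma sum_mset_cip_Irr:
  assumes "set_mset M \<subseteq> Irr G" "\<chi> \<in> Irr G"
  shows "(\<Sum>\<psi>\<in>#M. cip G \<psi> \<chi>) = of_nat (count M \<chi>)"
  using assms by (induction M) (auto simp: cip_Irr)

lemma cip_genuine:
  assumes "set_mset M \<subseteq> Irr G" "\<And>g. g \<in> carrier G \<Longrightarrow> f g = (\<Sum>\<psi>\<in>#M. \<psi> g)" "\<chi> \<in> Irr G"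
  shows "cip G f \<chi> = of_nat (count M \<chi>)"
  using assms sum_mset_cip_Irr[OF assms(1,3)] cip_cong[where h = \<chi> and h' = \<chi>, OF assms(2) refl]
  by (simp add: cip_sum_mset)

text \<open>The sum runs over the multiset with repetitions, so the right-hand side is the sum of
  the squared multiplicities.\<close>

lemma cip_self_genuine:
  assumes M: "set_mset M \<subseteq> Irr G" "\<And>g. g \<in> carrier G \<Longrightarrow> f g = (\<Sum>\<psi>\<in>#M. \<psi> g)"
  shows "cip G f f = of_nat (\<Sum>\<psi>\<in>#M. count M \<psi>)"
proof -
  have "cip G f f = (\<Sum>\<psi>\<in>#M. cip G \<psi> f)"
    using cip_cong[where h = f and h' = f, OF M(2) refl] by (simp add: cip_sum_mset)
  also have "\<dots> = (\<Sum>\<psi>\<in>#M. of_nat (count M \<psi>))"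
    by (intro arg_cong[of _ _ sum_mset] image_mset_cong)
      (use M cip_genuine[OF M] cip_commute in \<open>auto simp: subset_iff\<close>)
  finally show ?thesis by (simp add: multiset.map_comp o_def)
qed

lemma size_le_sum_count: "size M \<le> (\<Sum>\<psi>\<in>#M. count M \<psi>)"
proof -
  have "(\<Sum>\<psi>\<in>#M. 1::nat) \<le> (\<Sum>\<psi>\<in>#M. count M \<psi>)"
    by (rule sum_mset_mono) (simp add: Suc_le_eq)
  then show ?thesis by simp
qed

lemma norm_one_imp_Irr:
  assumes "genuine_char G f" "cip G f f = 1"
  shows "\<exists>\<chi>\<in>Irr G. \<forall>g\<in>carrier G. f g = \<chi> g"
proof -
  obtain M where M: "set_mset M \<subseteq> Irr G" "\<And>g. g \<in> carrier G \<Longrightarrow> f g = (\<Sum>\<psi>\<in>#M. \<psi> g)"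
    using genuine_char_decompose[OF assms(1)] by auto
  have "of_nat (\<Sum>\<psi>\<in>#M. count M \<psi>) = (of_nat 1 :: complex)"
    using cip_self_genuine[OF M] assms(2) by simp
  then have s: "(\<Sum>\<psi>\<in>#M. count M \<psi>) = 1" by (simp only: of_nat_eq_iff)
  then have "size M \<le> 1" using size_le_sum_count[of M] by simp
  moreover have "M \<noteq> {#}" using s by auto
  then have "size M \<noteq> 0" by simp
  ultimately have "size M = 1" by linarith
  then obtain \<chi> where M1: "M = {#\<chi>#}" using size_1_singleton_mset by auto
  show ?thesis
  proof (intro bexI ballI)
    show "\<chi> \<in> Irr G" using M(1) unfolding M1 by simp
    show "f g = \<chi> g" if "g \<in> carrier G" for g using M(2)[OF that] unfolding M1 by simp
  qed
qed

text \<open>Norm 2 allows at most two constituents, and a lone constituent would have norm 1. As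
  \<chi> occurs once, exactly one other character remains.\<close>

lemma norm_two_split:
  assumes "genuine_char G f" "cip G f f = 2" "\<chi> \<in> Irr G" "cip G f \<chi> = 1"
  shows "\<exists>\<psi>\<in>Irr G. \<psi> \<noteq> \<chi> \<and> (\<forall>g\<in>carrier G. f g = \<chi> g + \<psi> g)"
proof -
  obtain M where M: "set_mset M \<subseteq> Irr G" "\<And>g. g \<in> carrier G \<Longrightarrow> f g = (\<Sum>\<psi>\<in>#M. \<psi> g)"
    using genuine_char_decompose[OF assms(1)] by auto
  have "of_nat (\<Sum>\<psi>\<in>#M. count M \<psi>) = (of_nat 2 :: complex)"
    using cip_self_genuine[OF M] assms(2) by simp
  then have s: "(\<Sum>\<psi>\<in>#M. count M \<psi>) = 2" by (simp only: of_nat_eq_iff)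
  then have "size M \<le> 2" using size_le_sum_count[of M] by simp
  have "of_nat (count M \<chi>) = (of_nat 1 :: complex)" using cip_genuine[OF M assms(3)] assms(4) by simp
  then have c: "count M \<chi> = 1" by (simp only: of_nat_eq_iff)
  then have "\<chi> \<in># M" by (metis count_eq_zero_iff zero_neq_one)
  then obtain M' where M': "M = add_mset \<chi> M'" by (auto dest: multi_member_split)
  have "M' \<noteq> {#}" using s M' by auto
  then have "size M' \<noteq> 0" by simp
  moreover have "Suc (size M') \<le> 2" using \<open>size M \<le> 2\<close> unfolding M' by simp
  ultimately have "size M' = 1" by linarith
  then obtain \<psi> where "M' = {#\<psi>#}" using size_1_singleton_mset by auto
  then have M2: "M = {#\<chi>, \<psi>#}" using M' by simp
  show ?thesis
  proof (intro bexI conjI ballI)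
    show "\<psi> \<in> Irr G" using M(1) unfolding M2 by simp
    show "\<psi> \<noteq> \<chi>" using c unfolding M2 by auto
    show "f g = \<chi> g + \<psi> g" if "g \<in> carrier G" for g using M(2)[OF that] unfolding M2 by simp
  qed
qed

end

lemma sum_rotate:
  "(\<Sum>a\<in>A. \<Sum>b\<in>B. \<Sum>c\<in>C. f a b c) = (\<Sum>b\<in>B. \<Sum>c\<in>C. \<Sum>a\<in>A. f a b c)"
  by (rule trans[OF sum.swap]) (intro sum.cong refl sum.swap)

lemma sum_reverse:
  "(\<Sum>a\<in>A. \<Sum>b\<in>B. \<Sum>c\<in>C. f a b c) = (\<Sum>c\<in>C. \<Sum>b\<in>B. \<Sum>a\<in>A. f a b c)"
  by (rule trans[OF sum_rotate sum.swap])

section \<open>Roots of unity, eigenvalue multiplicities and congruences for degrees\<close>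

definition unity_root :: "nat \<Rightarrow> nat \<Rightarrow> complex" where
  "unity_root N k = cis (2 * pi * real k / real N)"

lemma unity_root_mult: "unity_root N j * unity_root N k = unity_root N (j + k)"
  by (simp add: unity_root_def cis_mult add_divide_distrib algebra_simps)

lemma unity_root_power: "unity_root N j ^ k = unity_root N (j * k)"
  by (simp add: unity_root_def Complex.DeMoivre mult_ac)

lemma unity_root_self: "N > 0 \<Longrightarrow> unity_root N (N * k) = 1"
proof (induction k)
  case 0
  then show ?case by (simp add: unity_root_def)
next
  case (Suc k)
  moreover have "unity_root N N = 1" using Suc by (simp add: unity_root_def)
  ultimately show ?case using unity_root_mult[of N N "N * k"] by simp
qed

lemma unity_root_zero [simp]: "unity_root N 0 = 1"
  by (simp add: unity_root_def)

lemma unity_root_add_mult: "N > 0 \<Longrightarrow> unity_root N (j + N * k) = unity_root N j"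
  by (simp add: unity_root_self flip: unity_root_mult)

lemma unity_root_mod: "N > 0 \<Longrightarrow> unity_root N (j mod N) = unity_root N j"
  using unity_root_add_mult[of N "j mod N" "j div N"] by (simp add: mult.commute)

lemma unity_root_eq_1_iff:
  assumes "N > 0" shows "unity_root N j = 1 \<longleftrightarrow> N dvd j"
proof
  assume "unity_root N j = 1"
  then have "unity_root N (j mod N) = unity_root N 0"
    using assms by (simp only: unity_root_mod unity_root_zero)
  moreover have "inj_on (unity_root N) {..<N}"
    using bij_betw_roots_unity[OF assms] unfolding bij_betw_def unity_root_def[abs_def] by simp
  ultimately have "j mod N = 0" using assms by (metis inj_onD lessThan_iff mod_less_divisor)
  then show "N dvd j" by auto
qed (use unity_root_self[OF assms] in auto)

lemma cnj_unity_root: "N > 0 \<Longrightarrow> cnj (unity_root N j) * unity_root N j = 1"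
  by (simp add: unity_root_def cis_cnj cis_mult)

lemma sum_unity_root:
  assumes "N > 0"
  shows "(\<Sum>j<N. unity_root N (k * j)) = (if N dvd k then of_nat N else 0)"
proof (cases "N dvd k")
  case True
  then have "unity_root N (k * j) = 1" for j using unity_root_eq_1_iff[OF assms] by simp
  then show ?thesis using True by simp
next
  case False
  then have ne: "unity_root N k \<noteq> 1" using unity_root_eq_1_iff[OF assms] by simp
  have "(\<Sum>j<N. unity_root N (k * j)) = (\<Sum>j<N. unity_root N k ^ j)" by (simp add: unity_root_power)
  also have "\<dots> = (unity_root N k ^ N - 1) / (unity_root N k - 1)" by (rule geometric_sum[OF ne])
  also have "unity_root N k ^ N = 1" using unity_root_self[OF assms, of k] by (simp add: unity_root_power mult.commute)
  finally show ?thesis using False by simp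
qed

lemma sum_periodic_shift:
  fixes F :: "nat \<Rightarrow> complex"
  assumes "\<And>s. F (s + N) = F s"
  shows "(\<Sum>y<N. F (x + y)) = (\<Sum>y<N. F y)"
proof (induction x)
  case (Suc x)
  have "(\<Sum>y<N. F (Suc x + y)) + F x = (\<Sum>y<Suc N. F (x + y))"
    by (subst sum.lessThan_Suc_shift) (simp add: add.commute)
  also have "\<dots> = (\<Sum>y<N. F (x + y)) + F x" using assms[of x] by simp
  finally show ?case using Suc by simp
qed simp

lemma cnj_Nats: "z \<in> \<nat> \<Longrightarrow> cnj z = z"
  by (auto elim: Nats_cases)

context fin_group
begin

lemma fun_rep_pow_Suc:
  assumes "g \<in> carrier G" "fun_rep G I \<rho>" "i \<in> I" "j \<in> I"
  shows "\<rho> (g [^] (x + y :: nat)) i j = (\<Sum>k\<in>I. \<rho> (g [^] x) i k * \<rho> (g [^] y) k j)"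
  using assms by (simp add: nat_pow_mult[symmetric] fun_rep_mult)

text \<open>The numbers \<open>m j\<close> are the eigenvalue multiplicities of \<open>g\<close>: each of them is the trace of
  an idempotent.\<close>

lemma fourier_multiplicity_Nats:
  assumes f: "genuine_char G f" and g: "g \<in> carrier G" "g [^] N = \<one>" and N: "N > 0"
  shows "(\<Sum>x<N. unity_root N (j * x) * f (g [^] x)) / of_nat N \<in> \<nat>"
proof -
  obtain n \<rho> where rep: "fun_rep G {..<n::nat} \<rho>" and fc: "f = fun_char G {..<n} \<rho>"
    using genuine_charE[OF is_group f] .
  let ?N = "of_nat N :: complex"
  have N0: "?N \<noteq> 0" using N by simp
  \<comment> \<open>The projection onto the eigenspace of \<rho>(g) for the inverse of the root
    \<open>unity_root N j\<close>. It is idempotent because the double sum over x and y depends on x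
    + y only and the summand has period \<open>N\<close>.\<close>
  define E where "E i k = (\<Sum>x<N. unity_root N (j * x) * \<rho> (g [^] x) i k) / ?N" for i k
  have per: "unity_root N (j * (s + N)) * \<rho> (g [^] (s + N)) i k = unity_root N (j * s) * \<rho> (g [^] s) i k" for s i k
  proof -
    have "g [^] (s + N) = g [^] s" using g by (simp add: nat_pow_mult[symmetric])
    moreover have "unity_root N (j * (s + N)) = unity_root N (j * s)"
      using unity_root_add_mult[OF N, of "j * s" j] by (simp add: algebra_simps)
    ultimately show ?thesis by simp
  qed
  have "(\<Sum>i<n. E i i) \<in> \<nat>"
  proof (rule trace_idempotent_Nats[where E = E])
    fix i l assume il: "i \<in> {..<n}" "l \<in> {..<n}"
    have "(\<Sum>k<n. E i k * E k l) = (\<Sum>k<n. \<Sum>x<N. \<Sum>y<N. unity_root N (j * x) * \<rho> (g [^] x) i k *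
        (unity_root N (j * y) * \<rho> (g [^] y) k l)) / (?N * ?N)"
      by (simp add: E_def sum_product flip: sum_divide_distrib)
    also have "(\<Sum>k<n. \<Sum>x<N. \<Sum>y<N. unity_root N (j * x) * \<rho> (g [^] x) i k *
        (unity_root N (j * y) * \<rho> (g [^] y) k l)) =
        (\<Sum>x<N. \<Sum>y<N. \<Sum>k<n. unity_root N (j * x) * \<rho> (g [^] x) i k *
        (unity_root N (j * y) * \<rho> (g [^] y) k l))"
      by (rule sum_rotate)
    also have "\<dots> = (\<Sum>x<N. \<Sum>y<N. unity_root N (j * (x + y)) * \<rho> (g [^] (x + y)) i l)"
    proof (intro sum.cong refl)
      fix x y
      have "(\<Sum>k<n. unity_root N (j * x) * \<rho> (g [^] x) i k * (unity_root N (j * y) * \<rho> (g [^] y) k l)) =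
        (unity_root N (j * x) * unity_root N (j * y)) * (\<Sum>k<n. \<rho> (g [^] x) i k * \<rho> (g [^] y) k l)"
        by (simp add: sum_distrib_left mult_ac)
      then show "(\<Sum>k<n. unity_root N (j * x) * \<rho> (g [^] x) i k * (unity_root N (j * y) * \<rho> (g [^] y) k l)) =
        unity_root N (j * (x + y)) * \<rho> (g [^] (x + y)) i l"
        by (simp add: unity_root_mult distrib_left fun_rep_pow_Suc[OF g(1) rep il])
    qed
    also have "\<dots> = (\<Sum>x<N. \<Sum>y<N. unity_root N (j * y) * \<rho> (g [^] y) i l)"
      by (intro sum.cong refl sum_periodic_shift[where F = "\<lambda>s. unity_root N (j * s) * \<rho> (g [^] s) i l"] per)
    also have "\<dots> = ?N * (\<Sum>y<N. unity_root N (j * y) * \<rho> (g [^] y) i l)" by simp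
    also have "\<dots> / (?N * ?N) = E i l" using N0 by (simp add: E_def)
    finally show "(\<Sum>k<n. E i k * E k l) = E i l" .
  qed simp
  also have "(\<Sum>i<n. E i i) = (\<Sum>x<N. unity_root N (j * x) * f (g [^] x)) / ?N"
    unfolding E_def sum_divide_distrib[symmetric] fc fun_char_def
    by (subst sum.swap) (simp add: g(1) sum_distrib_left)
  finally show ?thesis .
qed

text \<open>Discrete Fourier inversion on the powers of g, valid for any function: summing over j
  first isolates the exponent congruent to y.\<close>

lemma fourier_inversion:
  fixes f :: "'a \<Rightarrow> complex"
  assumes g: "g \<in> carrier G" "g [^] N = \<one>" and N: "N > 0"
  defines "m \<equiv> \<lambda>j. (\<Sum>x<N. unity_root N (j * x) * f (g [^] x)) / of_nat N"
  shows "f (g [^] (y::nat)) = (\<Sum>j<N. m j * cnj (unity_root N (j * y)))"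
proof -
  let ?N = "of_nat N :: complex"
  have N0: "?N \<noteq> 0" using N by simp
  \<comment> \<open>M stands for -1 modulo \<open>N\<close>; conjugation becomes multiplication of
    exponents by \<open>M\<close>, and all exponents remain natural numbers.\<close>
  define M where "M = N - 1"
  have NM: "N = M + 1" using N by (simp add: M_def)
  have cnj_eq: "unity_root N (j * x) * cnj (unity_root N (j * y)) = unity_root N ((x + M * y) * j)" for x j
  proof -
    have "unity_root N (M * y * j) * unity_root N (j * y) = unity_root N (N * (y * j))"
      unfolding unity_root_mult by (simp add: NM algebra_simps)
    then have "unity_root N (M * y * j) * unity_root N (j * y) = cnj (unity_root N (j * y)) * unity_root N (j * y)"
      using unity_root_self[OF N] cnj_unity_root[OF N] by simp
    then have "unity_root N (M * y * j) = cnj (unity_root N (j * y))"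
      by (simp add: unity_root_def)
    moreover have "unity_root N ((x + M * y) * j) = unity_root N (j * x) * unity_root N (M * y * j)"
      unfolding unity_root_mult by (simp add: algebra_simps)
    ultimately show ?thesis by simp
  qed
  have "(\<Sum>j<N. m j * cnj (unity_root N (j * y))) =
      (\<Sum>j<N. \<Sum>x<N. f (g [^] x) * unity_root N ((x + M * y) * j)) / ?N"
    unfolding m_def sum_divide_distrib[symmetric] times_divide_eq_left sum_distrib_right cnj_eq[symmetric]
    by (simp add: mult_ac)
  also have "(\<Sum>j<N. \<Sum>x<N. f (g [^] x) * unity_root N ((x + M * y) * j)) =
      (\<Sum>x<N. f (g [^] x) * (if N dvd x + M * y then ?N else 0))"
    by (subst sum.swap) (simp add: sum_distrib_left[symmetric] sum_unity_root[OF N])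
  also have "\<dots> = (\<Sum>x<N. if x = y mod N then f (g [^] x) * ?N else 0)"
  proof (rule sum.cong)
    fix x assume "x \<in> {..<N}"
    then have x: "x < N" by simp
    have "N dvd x + M * y \<longleftrightarrow> N dvd int x - int y"
    proof -
      have "int (x + M * y) = int x - int y + int y * int N"
        by (simp add: NM algebra_simps)
      then have "int N dvd int (x + M * y) \<longleftrightarrow> int N dvd int x - int y"
        by (simp only: dvd_add_times_triv_right_iff)
      then show ?thesis by (simp only: int_dvd_int_iff)
    qed
    also have "\<dots> \<longleftrightarrow> int x mod int N = int y mod int N" by (simp add: mod_eq_dvd_iff)
    also have "\<dots> \<longleftrightarrow> x = y mod N" using x by (metis mod_less of_nat_eq_iff of_nat_mod)
    finally show "f (g [^] x) * (if N dvd x + M * y then ?N else 0) =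
      (if x = y mod N then f (g [^] x) * ?N else 0)" by simp
  qed simp
  also have "\<dots> = f (g [^] (y mod N)) * ?N" using N by simp
  also have "g [^] (y mod N) = g [^] y"
  proof -
    have "g [^] y = g [^] (N * (y div N) + y mod N)" by simp
    also have "\<dots> = g [^] (N * (y div N)) \<otimes> g [^] (y mod N)" using g by (simp only: nat_pow_mult)
    also have "g [^] (N * (y div N)) = \<one>" using nat_pow_pow[OF g(1), of N "y div N"] g(2) by simp
    finally show ?thesis using g by simp
  qed
  finally show ?thesis using N0 by simp
qed

text \<open>On powers of g a character is a combination of roots of unity whose coefficients are
  multiplicities, hence real. Passing to the inverse conjugates only the roots.\<close>

lemma genuine_char_inv:
  assumes f: "genuine_char G f" and g: "g \<in> carrier G"
  shows "f (inv g) = cnj (f g)"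
proof -
  let ?N = "card (carrier G)"
  have N: "?N > 0" by (rule card_carrier_pos)
  have gN: "g [^] ?N = \<one>" using pow_order_eq_1[OF g] by (simp add: Coset.order_def)
  let ?m = "\<lambda>j. (\<Sum>x<?N. unity_root ?N (j * x) * f (g [^] x)) / of_nat ?N"
  have "Suc (?N - 1) = ?N" using N by simp
  then have "g [^] (?N - 1) \<otimes> g = \<one>" using gN nat_pow_Suc[of g "?N - 1"] by metis
  then have "inv g = g [^] (?N - 1)" using g nat_pow_closed[OF g] inv_equality by metis
  note inv = this
  have cm: "cnj (?m j) = ?m j" for j
    by (rule cnj_Nats[OF fourier_multiplicity_Nats[OF f g gN N]])
  have "f (inv g) = (\<Sum>j<?N. ?m j * cnj (unity_root ?N (j * (?N - 1))))"
    unfolding inv by (rule fourier_inversion[OF g gN N])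
  also have "\<dots> = (\<Sum>j<?N. cnj (?m j * cnj (unity_root ?N (j * 1))))"
  proof (intro sum.cong refl)
    fix j
    have "j * (?N - 1) + j = ?N * j" using N by (cases ?N) (auto simp: algebra_simps)
    then have "unity_root ?N (j * (?N - 1)) * unity_root ?N j = 1"
      by (simp add: unity_root_mult unity_root_self[OF N])
    then have "unity_root ?N (j * (?N - 1)) * unity_root ?N j = cnj (unity_root ?N j) * unity_root ?N j"
      using cnj_unity_root[OF N] by simp
    then have "unity_root ?N (j * (?N - 1)) = cnj (unity_root ?N j)"
      by (simp add: unity_root_def)
    then show "?m j * cnj (unity_root ?N (j * (?N - 1))) = cnj (?m j * cnj (unity_root ?N (j * 1)))"
      by (simp only: complex_cnj_mult cm complex_cnj_cnj mult_1_right)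
  qed
  also have "\<dots> = cnj (f (g [^] (1::nat)))"
    by (subst fourier_inversion[OF g gN N, of f 1]) simp
  finally show ?thesis using g by simp
qed

text \<open>On the powers of g the function f - \<epsilon> vanishes at exponents prime to p, so its
  Fourier coefficients have period N / p. They are integers, namely eigenvalue multiplicities
  corrected by \<epsilon> at index 0, and they add up to f(1) - \<epsilon> over the range of length
  N, which consists of p periods.\<close>

lemma degree_cong_value:
  assumes f: "genuine_char G f" and g: "g \<in> carrier G" "g [^] N = \<one>"
    and N: "N = p ^ k" and p: "prime p" and k: "k \<ge> 1"
    and val: "\<And>x. coprime x p \<Longrightarrow> f (g [^] (x::nat)) = of_int \<epsilon>"
  shows "int p dvd int (char_degree G f) - \<epsilon>"
proof -
  have N0: "N > 0" using p N by (simp add: prime_gt_0_nat)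
  let ?N = "of_nat N :: complex"
  define a where "a = p ^ (k - 1)"
  have Na: "N = p * a" using k N by (cases k) (auto simp: a_def)
  define m where "m j = (\<Sum>x<N. unity_root N (j * x) * f (g [^] x)) / ?N" for j
  have "\<exists>n. m j = of_nat n" for j
    using fourier_multiplicity_Nats[OF f g N0, of j] unfolding m_def by (auto elim: Nats_cases)
  then obtain n where n: "\<And>j. m j = of_nat (n j)" by metis
  \<comment> \<open>Fourier coefficients of the constant \<epsilon>, concentrated at the multiples
    of \<open>N\<close>.\<close>
  define e where "e j = (\<Sum>x<N. unity_root N (j * x) * of_int \<epsilon>) / ?N" for j
  have e: "e j = (if N dvd j then of_int \<epsilon> else 0)" for j
    using N0 by (simp add: e_def sum_unity_root[OF N0] sum_distrib_right[symmetric])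
  have per: "m (j + a) - e (j + a) = m j - e j" for j
  proof -
    have d: "m j - e j = (\<Sum>x<N. unity_root N (j * x) * (f (g [^] x) - of_int \<epsilon>)) / ?N" for j
      by (simp add: m_def e_def diff_divide_distrib[symmetric] sum_subtractf[symmetric] right_diff_distrib)
    \<comment> \<open>Either p divides x, and then the shift by a = N / p changes the exponent by a
      multiple of N, or x is prime to p and the second factor is 0.\<close>
    have "unity_root N ((j + a) * x) * (f (g [^] x) - of_int \<epsilon>) = unity_root N (j * x) * (f (g [^] x) - of_int \<epsilon>)" for x
    proof (cases "p dvd x")
      case True
      then obtain y where "x = p * y" by auto
      then have "(j + a) * x = j * x + N * y" by (simp add: Na algebra_simps)
      then show ?thesis by (simp add: unity_root_add_mult[OF N0])
    next
      case False
      then have "coprime x p" using p by (simp add: coprime_commute prime_imp_coprime)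
      then show ?thesis by (simp add: val)
    qed
    then show ?thesis unfolding d by (intro arg_cong2[of _ _ _ _ "(/)"] sum.cong refl)
  qed
  define z where "z j = int (n j) - (if N dvd j then \<epsilon> else 0)" for j
  have z: "of_int (z j) = m j - e j" for j by (simp add: z_def n e)
  have zper: "z (j + a) = z j" for j
  proof -
    have "(of_int (z (j + a)) :: complex) = of_int (z j)" by (simp only: z per)
    then show ?thesis by (simp only: of_int_eq_iff)
  qed
  have zper': "z (j + i * a) = z j" for i j
  proof (induction i)
    case (Suc i)
    have "j + Suc i * a = (j + i * a) + a" by simp
    then show ?case using zper[of "j + i * a"] Suc by metis
  qed simp
  have "(\<Sum>j<N. z j) = (\<Sum>i<p. \<Sum>j<a. z (j + i * a))"
  proof -
    have "sum z {i * a..<i * a + a} = (\<Sum>j<a. z (j + i * a))" for i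
      using sum.shift_bounds_nat_ivl[of z 0 "i * a" a] by (simp add: lessThan_atLeast0 add.commute)
    then show ?thesis unfolding Na by (subst sum.nat_group[symmetric]) simp
  qed
  also have "\<dots> = int p * (\<Sum>j<a. z j)" by (simp add: zper')
  finally have "int p dvd (\<Sum>j<N. z j)" by simp
  moreover have "(of_int (\<Sum>j<N. z j) :: complex) = of_int (int (char_degree G f) - \<epsilon>)"
  proof -
    have "f (g [^] (0::nat)) = (\<Sum>j<N. m j * cnj (unity_root N (j * 0)))"
      unfolding m_def by (rule fourier_inversion[OF g N0])
    then have "(\<Sum>j<N. m j) = of_nat (char_degree G f)"
      using char_degree_genuine[OF is_group f] by simp
    moreover have "(\<Sum>j<N. e j) = of_int \<epsilon>"
    proof -
      have "(\<Sum>j<N. e j) = (\<Sum>j<N. if j = 0 then of_int \<epsilon> else 0)"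
        by (intro sum.cong refl) (auto simp: e dest: dvd_imp_le)
      then show ?thesis using N0 by simp
    qed
    ultimately show ?thesis by (simp add: z sum_subtractf)
  qed
  ultimately show ?thesis by (simp only: of_int_eq_iff)
qed

text \<open>The left-hand side is, up to the factor \<open>card (carrier G) / d\<close>, a system of matrix units
  acting on the \<open>\<chi>\<close>-isotypic component, so it factors through a basis of multiplicity space.\<close>

lemma isotypic_factorization:
  assumes rep: "fun_rep G J \<Lambda>" and \<chi>: "\<chi> \<in> Irr G"
  defines "d \<equiv> irr_dim G \<chi>"
  obtains r :: nat and P :: "nat \<Rightarrow> 'j \<Rightarrow> nat \<Rightarrow> complex" and Q :: "nat \<Rightarrow> nat \<Rightarrow> 'j \<Rightarrow> complex" where
    "cip G (fun_char G J \<Lambda>) \<chi> = of_nat r"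
    "\<And>A' A u v. A' \<in> J \<Longrightarrow> A \<in> J \<Longrightarrow> u < d \<Longrightarrow> v < d \<Longrightarrow>
      (\<Sum>x\<in>carrier G. \<Lambda> x A' A * irr_entry G \<chi> (inv x) u v) =
      of_nat (card (carrier G)) / of_nat d * (\<Sum>w<r. P w A' v * Q w u A)"
    "\<And>w w' u v. w < r \<Longrightarrow> w' < r \<Longrightarrow> u < d \<Longrightarrow> v < d \<Longrightarrow>
      (\<Sum>A\<in>J. Q w u A * P w' A v) = (if u = v \<and> w = w' then 1 else 0)"
proof -
  let ?c = "of_nat (card (carrier G)) :: complex"
  let ?e = "irr_entry G \<chi>"
  have c0: "?c \<noteq> 0" using card_carrier_pos by simp
  have d0: "d > 0" unfolding d_def by (rule irr_dim_pos[OF \<chi>])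
  have fin: "finite J" using rep by (rule fun_rep_finite)
  note irep = irr_fun_rep[OF is_group \<chi>, folded d_def]
  \<comment> \<open>After this normalization \<open>E u v\<close> multiplies like the matrix unit
    with row v and column u, which is the content of \<open>EE\<close>.\<close>
  define E where "E u v A' A = of_nat d / ?c * (\<Sum>x\<in>carrier G. \<Lambda> x A' A * ?e (inv x) u v)" for u v A' A
  have EE: "mat_prod J (E u v) (E u' v') A' A = (if u = v' then E u' v A' A else 0)"
    if "u < d" "v < d" "u' < d" "v' < d" "A' \<in> J" "A \<in> J" for u v u' v' A' A
  proof -
    have "mat_prod J (E u v) (E u' v') A' A = (of_nat d / ?c) * (of_nat d / ?c) *
      (\<Sum>k\<in>J. \<Sum>x\<in>carrier G. \<Sum>y\<in>carrier G. \<Lambda> x A' k * ?e (inv x) u v * (\<Lambda> y k A * ?e (inv y) u' v'))"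
      unfolding mat_prod_def E_def by (simp add: sum_product sum_distrib_left mult_ac)
    also have "(\<Sum>k\<in>J. \<Sum>x\<in>carrier G. \<Sum>y\<in>carrier G. \<Lambda> x A' k * ?e (inv x) u v * (\<Lambda> y k A * ?e (inv y) u' v')) =
      (\<Sum>y\<in>carrier G. \<Sum>x\<in>carrier G. \<Sum>k\<in>J. \<Lambda> x A' k * ?e (inv x) u v * (\<Lambda> y k A * ?e (inv y) u' v'))"
      by (rule sum_reverse)
    also have "\<dots> = (\<Sum>y\<in>carrier G. \<Sum>x\<in>carrier G. \<Lambda> (x \<otimes> y) A' A * ?e (inv x) u v * ?e (inv y) u' v')"
      using that by (intro sum.cong refl) (simp add: fun_rep_mult[OF rep] sum_distrib_left sum_distrib_right mult_ac)
    \<comment> \<open>The substitution z = x y removes y from \<Lambda>, so that orthogonality of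
      entries can be applied to the sum over y.\<close>
    also have "\<dots> = (\<Sum>y\<in>carrier G. \<Sum>z\<in>carrier G. \<Lambda> z A' A * ?e (y \<otimes> inv z) u v * ?e (inv y) u' v')"
    proof (rule sum.cong, rule refl)
      fix y assume y: "y \<in> carrier G"
      show "(\<Sum>x\<in>carrier G. \<Lambda> (x \<otimes> y) A' A * ?e (inv x) u v * ?e (inv y) u' v') =
        (\<Sum>z\<in>carrier G. \<Lambda> z A' A * ?e (y \<otimes> inv z) u v * ?e (inv y) u' v')"
        by (rule sum.reindex_bij_witness[where i = "\<lambda>z. z \<otimes> inv y" and j = "\<lambda>x. x \<otimes> y"])
          (use y in \<open>auto simp: m_assoc inv_mult_group m_assoc[symmetric]\<close>)
    qed
    also have "\<dots> = (\<Sum>y\<in>carrier G. \<Sum>z\<in>carrier G. \<Sum>w<d. \<Lambda> z A' A * ?e (inv z) w v * (?e y u w * ?e (inv y) u' v'))"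
      using that by (intro sum.cong refl) (simp add: fun_rep_mult[OF irep] sum_distrib_left sum_distrib_right mult_ac)
    also have "\<dots> = (\<Sum>w<d. \<Sum>z\<in>carrier G. \<Sum>y\<in>carrier G. \<Lambda> z A' A * ?e (inv z) w v * (?e y u w * ?e (inv y) u' v'))"
      by (rule sum_reverse)
    also have "\<dots> = (\<Sum>w<d. \<Sum>z\<in>carrier G. \<Lambda> z A' A * ?e (inv z) w v * (if u = v' \<and> w = u' then ?c / of_nat d else 0))"
      using that by (intro sum.cong refl)
        (simp add: sum_distrib_left[symmetric] irr_entry_orthogonality[OF \<chi> \<chi>, folded d_def])
    also have "\<dots> = (\<Sum>w<d. (if w = u' then 1 else 0) * (if u = v' then ?c / of_nat d * (\<Sum>z\<in>carrier G. \<Lambda> z A' A * ?e (inv z) w v) else 0))"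
      by (intro sum.cong refl) (auto simp: sum_distrib_left sum_distrib_right mult_ac)
    also have "\<dots> = (if u = v' then ?c / of_nat d * (\<Sum>z\<in>carrier G. \<Lambda> z A' A * ?e (inv z) u' v) else 0)"
      using that by (simp add: sum_mult_delta)
    also have "of_nat d / ?c * (of_nat d / ?c) * \<dots> = (if u = v' then E u' v A' A else 0)"
      using c0 d0 by (simp add: E_def)
    finally show ?thesis .
  qed
  \<comment> \<open>All diagonal units have the same trace by cyclicity. The sum of all d traces is
    d times the inner product with \<chi>, which identifies the rank \<open>r\<close> of
    \<open>E 0 0\<close> with the multiplicity.\<close>
  have tr: "(\<Sum>A\<in>J. E u u A A) = (\<Sum>A\<in>J. E 0 0 A A)" if "u < d" for u
  proof -
    have "(\<Sum>A\<in>J. E u u A A) = (\<Sum>A\<in>J. mat_prod J (E 0 u) (E u 0) A A)"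
      using that d0 by (intro sum.cong refl) (simp add: EE)
    also have "\<dots> = (\<Sum>A\<in>J. mat_prod J (E u 0) (E 0 u) A A)" by (rule trace_mm)
    also have "\<dots> = (\<Sum>A\<in>J. E 0 0 A A)" using that d0 by (intro sum.cong refl) (simp add: EE)
    finally show ?thesis .
  qed
  have idem: "(\<Sum>k\<in>J. E 0 0 A' k * E 0 0 k A) = E 0 0 A' A" if "A' \<in> J" "A \<in> J" for A' A
    using EE[of 0 0 0 0 A' A] that d0 by (simp add: mat_prod_def)
  have "\<exists>r (p :: 'j \<Rightarrow> nat \<Rightarrow> complex) q.
      (\<forall>i\<in>J. \<forall>j\<in>J. E 0 0 i j = (\<Sum>u<r. p i u * q u j)) \<and>
      (\<forall>u<r. \<forall>v<r. (\<Sum>i\<in>J. q u i * p i v) = (if u = v then 1 else 0)) \<and>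
      of_nat r = (\<Sum>i\<in>J. E 0 0 i i)"
    by (rule idempotent_factorization[OF fin]) (rule idem)
  then obtain r and p :: "'j \<Rightarrow> nat \<Rightarrow> complex" and q where
    H: "(\<forall>i\<in>J. \<forall>j\<in>J. E 0 0 i j = (\<Sum>u<r. p i u * q u j)) \<and>
      (\<forall>u<r. \<forall>v<r. (\<Sum>i\<in>J. q u i * p i v) = (if u = v then 1 else 0)) \<and>
      of_nat r = (\<Sum>i\<in>J. E 0 0 i i)"
    by (elim exE) (rule that)
  then have pq: "\<And>i j. i \<in> J \<Longrightarrow> j \<in> J \<Longrightarrow> E 0 0 i j = (\<Sum>u<r. p i u * q u j)"
    and qp: "\<And>u v. u < r \<Longrightarrow> v < r \<Longrightarrow> (\<Sum>i\<in>J. q u i * p i v) = (if u = v then 1 else 0)"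
    and r: "of_nat r = (\<Sum>i\<in>J. E 0 0 i i)" by (elim conjE, blast)+
  have "of_nat d * (of_nat r :: complex) = (\<Sum>u<d. \<Sum>A\<in>J. E 0 0 A A)" by (simp only: r sum_constant card_lessThan)
  also have "\<dots> = (\<Sum>u<d. \<Sum>A\<in>J. E u u A A)" by (intro sum.cong refl tr[symmetric]) simp
  also have "\<dots> = (\<Sum>u<d. \<Sum>A\<in>J. \<Sum>x\<in>carrier G. of_nat d / ?c * (\<Lambda> x A A * ?e (inv x) u u))"
    by (simp add: E_def sum_distrib_left)
  also have "\<dots> = (\<Sum>x\<in>carrier G. \<Sum>u<d. \<Sum>A\<in>J. of_nat d / ?c * (\<Lambda> x A A * ?e (inv x) u u))"
    by (rule sum_rotate[symmetric])
  also have "\<dots> = of_nat d * cip G (fun_char G J \<Lambda>) \<chi>"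
    unfolding cip_def sum_divide_distrib sum_distrib_left[of "of_nat d"]
  proof (rule sum.cong, rule refl)
    fix x assume x: "x \<in> carrier G"
    have "(\<Sum>u<d. \<Sum>A\<in>J. of_nat d / ?c * (\<Lambda> x A A * ?e (inv x) u u)) =
        (\<Sum>A\<in>J. \<Sum>u<d. of_nat d / ?c * (\<Lambda> x A A * ?e (inv x) u u))" by (rule sum.swap)
    also have "\<dots> = of_nat d / ?c * ((\<Sum>A\<in>J. \<Lambda> x A A) * (\<Sum>u<d. ?e (inv x) u u))"
      by (subst sum_product) (simp only: sum_distrib_left)
    also have "(\<Sum>A\<in>J. \<Lambda> x A A) = fun_char G J \<Lambda> x" using x by (simp add: fun_char_def)
    also have "(\<Sum>u<d. ?e (inv x) u u) = \<chi> (inv x)"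
      unfolding d_def using x by (intro irr_char_sum[OF \<chi>, symmetric]) simp
    finally show "(\<Sum>u<d. \<Sum>A\<in>J. of_nat d / ?c * (\<Lambda> x A A * ?e (inv x) u u)) =
        of_nat d * (fun_char G J \<Lambda> x * \<chi> (inv x) / ?c)" by simp
  qed
  finally have mult: "cip G (fun_char G J \<Lambda>) \<chi> = of_nat r" using d0 by simp
  \<comment> \<open>The factorization p q of \<open>E 0 0\<close> is carried to all units through E
    u v = (E 0 v) (E 0 0) (E u 0).\<close>
  define P where "P w A' v = mat_prod J (E 0 v) p A' w" for w A' v
  define Q where "Q w u A = mat_prod J q (E u 0) w A" for w u A
  have PQ: "(\<Sum>x\<in>carrier G. \<Lambda> x A' A * ?e (inv x) u v) = ?c / of_nat d * (\<Sum>w<r. P w A' v * Q w u A)"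
    if "A' \<in> J" "A \<in> J" "u < d" "v < d" for A' A u v
  proof -
    have "(\<Sum>w<r. P w A' v * Q w u A) = mat_prod {..<r} (mat_prod J (E 0 v) p) (mat_prod J q (E u 0)) A' A"
      by (simp add: P_def Q_def mat_prod_def)
    also have "\<dots> = mat_prod J (E 0 v) (mat_prod J (mat_prod {..<r} p q) (E u 0)) A' A" by (simp only: mat_prod_assoc)
    also have "\<dots> = mat_prod J (E 0 v) (mat_prod J (E 0 0) (E u 0)) A' A"
      by (rule mat_prod_cong, rule refl, rule mat_prod_cong) (use pq in \<open>simp_all add: mat_prod_def\<close>)
    also have "\<dots> = mat_prod J (E 0 v) (E u 0) A' A"
      using that d0 by (intro mat_prod_cong refl) (simp add: EE)
    also have "\<dots> = E u v A' A" using that d0 by (simp add: EE)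
    finally show ?thesis using c0 d0 by (simp add: E_def)
  qed
  have QP: "(\<Sum>A\<in>J. Q w u A * P w' A v) = (if u = v \<and> w = w' then 1 else 0)"
    if "w < r" "w' < r" "u < d" "v < d" for w w' u v
  proof -
    have "(\<Sum>A\<in>J. Q w u A * P w' A v) = mat_prod J (mat_prod J q (E u 0)) (mat_prod J (E 0 v) p) w w'"
      by (simp add: P_def Q_def mat_prod_def)
    also have "\<dots> = mat_prod J q (mat_prod J (mat_prod J (E u 0) (E 0 v)) p) w w'" by (simp only: mat_prod_assoc)
    also have "\<dots> = mat_prod J q (mat_prod J (\<lambda>A' A. if u = v then E 0 0 A' A else 0) p) w w'"
      by (rule mat_prod_cong, rule refl, rule mat_prod_cong) (use that d0 in \<open>simp_all add: EE\<close>)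
    also have "\<dots> = (if u = v then mat_prod J q (mat_prod J (mat_prod {..<r} p q) p) w w' else 0)"
    proof (cases "u = v")
      case True
      have "mat_prod J q (mat_prod J (E 0 0) p) w w' = mat_prod J q (mat_prod J (mat_prod {..<r} p q) p) w w'"
        by (rule mat_prod_cong, rule refl, rule mat_prod_cong) (use pq in \<open>simp_all add: mat_prod_def\<close>)
      then show ?thesis using True by simp
    qed (simp add: mat_prod_def)
    also have "mat_prod J q (mat_prod J (mat_prod {..<r} p q) p) w w' = mat_prod {..<r} (mat_prod J q p) (mat_prod J q p) w w'" by (simp only: mat_prod_assoc)
    also have "\<dots> = mat_prod {..<r} (\<lambda>i j. if i = j then 1 else 0) (\<lambda>i j. if i = j then 1 else 0) w w'"
      using that by (intro mat_prod_cong) (simp_all add: mat_prod_def qp)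
    also have "\<dots> = (if w = w' then 1 else 0)" using that by (simp add: mat_prod_one)
    finally show ?thesis by simp
  qed
  show thesis by (rule that[OF mult PQ QP])
qed

end

section \<open>Hook characters of symmetric groups\<close>

definition Sym_on :: "'x set \<Rightarrow> ('x \<Rightarrow> 'x) monoid" where
  "Sym_on X = \<lparr>carrier = {g. g permutes X}, Group.monoid.mult = (\<circ>), one = id\<rparr>"

lemma Sym_on_simps [simp]:
  "carrier (Sym_on X) = {g. g permutes X}" "g \<otimes>\<^bsub>Sym_on X\<^esub> h = g \<circ> h" "\<one>\<^bsub>Sym_on X\<^esub> = id"
  by (simp_all add: Sym_on_def)

lemma sym_group_eq_Sym_on: "sym_group n = Sym_on {1..n}"
  by (simp add: sym_group_def Sym_on_def)

lemma group_Sym_on: "group (Sym_on X)"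
proof (rule groupI)
  fix g assume "g \<in> carrier (Sym_on X)"
  then have "g permutes X" by simp
  then show "\<exists>h\<in>carrier (Sym_on X). h \<otimes>\<^bsub>Sym_on X\<^esub> g = \<one>\<^bsub>Sym_on X\<^esub>"
    using permutes_inv permutes_inv_o by (metis mem_Collect_eq Sym_on_simps)
qed (auto simp: permutes_id permutes_compose comp_assoc)

lemma fin_group_Sym_on: "finite X \<Longrightarrow> fin_group (Sym_on X)"
  by (intro fin_group.intro group_Sym_on fin_group_axioms.intro) (simp add: finite_permutations)

lemma inv_Sym_on:
  assumes "g permutes X" shows "inv\<^bsub>Sym_on X\<^esub> g = inv_into UNIV g"
proof -
  interpret group "Sym_on X" by (rule group_Sym_on)
  show ?thesis
    by (rule inv_equality) (use assms in \<open>auto simp: permutes_inv permutes_inv_o\<close>)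
qed

text \<open>Right translation turns the stabilizer of \<omega> into the set of elements that carry a
  base point to \<omega>; these sets partition the group.\<close>

lemma (in fin_group) sum_card_stabilizer:
  assumes closed: "\<And>g \<omega>. g \<in> carrier G \<Longrightarrow> \<omega> \<in> \<Omega> \<Longrightarrow> act g \<omega> \<in> \<Omega>"
    and mult: "\<And>g h \<omega>. g \<in> carrier G \<Longrightarrow> h \<in> carrier G \<Longrightarrow> \<omega> \<in> \<Omega> \<Longrightarrow> act (g \<otimes> h) \<omega> = act g (act h \<omega>)"
    and one: "\<And>\<omega>. \<omega> \<in> \<Omega> \<Longrightarrow> act \<one> \<omega> = \<omega>"
    and trans: "\<And>\<omega> \<omega>'. \<omega> \<in> \<Omega> \<Longrightarrow> \<omega>' \<in> \<Omega> \<Longrightarrow> \<exists>g\<in>carrier G. act g \<omega> = \<omega>'"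
    and fin: "finite \<Omega>" and ne: "\<Omega> \<noteq> {}"
  shows "(\<Sum>\<omega>\<in>\<Omega>. card {g \<in> carrier G. act g \<omega> = \<omega>}) = card (carrier G)"
proof -
  obtain \<omega>0 where w0: "\<omega>0 \<in> \<Omega>" using ne by blast
  have "card {g \<in> carrier G. act g \<omega> = \<omega>} = card {g \<in> carrier G. act g \<omega>0 = \<omega>}" if w: "\<omega> \<in> \<Omega>" for \<omega>
  proof -
    obtain k where k: "k \<in> carrier G" "act k \<omega>0 = \<omega>" using trans[OF w0 w] by blast
    have "act (inv k) \<omega> = \<omega>0" using mult[OF inv_closed[OF k(1)] k(1) w0] k one[OF w0] by simp
    then have "bij_betw (\<lambda>g. g \<otimes> k) {g \<in> carrier G. act g \<omega> = \<omega>} {g \<in> carrier G. act g \<omega>0 = \<omega>}"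
      by (intro bij_betw_byWitness[where f' = "\<lambda>g. g \<otimes> inv k"])
        (use k w w0 in \<open>auto simp: m_assoc mult\<close>)
    then show ?thesis by (rule bij_betw_same_card)
  qed
  then have "(\<Sum>\<omega>\<in>\<Omega>. card {g \<in> carrier G. act g \<omega> = \<omega>}) = (\<Sum>\<omega>\<in>\<Omega>. card {g \<in> carrier G. act g \<omega>0 = \<omega>})"
    by simp
  also have "\<dots> = card (\<Union>\<omega>\<in>\<Omega>. {g \<in> carrier G. act g \<omega>0 = \<omega>})"
    by (rule card_UN_disjoint[symmetric]) (use fin fin_carrier in auto)
  also have "(\<Union>\<omega>\<in>\<Omega>. {g \<in> carrier G. act g \<omega>0 = \<omega>}) = carrier G" using closed w0 by auto
  finally show ?thesis .
qed

text \<open>Bijections between fibres of equal colour glue to a permutation. The colour used later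
  records membership in two subsets.\<close>

lemma permutes_matching_colours:
  assumes fin: "finite X" and card: "\<And>c. card {x \<in> X. f x = c} = card {x \<in> X. f' x = c}"
  shows "\<exists>g. g permutes X \<and> (\<forall>x\<in>X. f' (g x) = f x)"
proof -
  have "\<exists>h. bij_betw h {x \<in> X. f x = c} {x \<in> X. f' x = c}" for c
    using fin card by (intro finite_same_card_bij) auto
  then obtain h where h: "\<And>c. bij_betw (h c) {x \<in> X. f x = c} {x \<in> X. f' x = c}" by metis
  define g where "g x = (if x \<in> X then h (f x) x else x)" for x
  have gX: "g x \<in> X \<and> f' (g x) = f x" if "x \<in> X" for x
    using h[of "f x"] that by (auto simp: g_def bij_betw_def)
  have "inj_on g X"
  proof (rule inj_onI)
    fix x y assume xy: "x \<in> X" "y \<in> X" "g x = g y"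
    then have "f x = f y" using gX by metis
    then show "x = y" using h[of "f x"] xy by (auto simp: g_def bij_betw_def dest: inj_onD)
  qed
  then have "bij_betw g X X" using gX fin by (intro bij_betw_imageI endo_inj_surj) auto
  then have "g permutes X" by (rule bij_imp_permutes) (simp add: g_def)
  then show ?thesis using gX by blast
qed

section \<open>Signs of permutations relative to a ranking\<close>

definition pairs :: "'x set \<Rightarrow> 'x set set" where
  "pairs A = {e. e \<subseteq> A \<and> card e = 2}"

definition inv_sign :: "('x \<Rightarrow> nat) \<Rightarrow> ('x \<Rightarrow> 'x) \<Rightarrow> 'x set \<Rightarrow> complex" where
  "inv_sign r g e = (if \<exists>a b. e = {a, b} \<and> r a < r b \<and> r (g b) < r (g a) then - 1 else 1)"

definition set_sign :: "('x \<Rightarrow> nat) \<Rightarrow> ('x \<Rightarrow> 'x) \<Rightarrow> 'x set \<Rightarrow> complex" where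
  "set_sign r g A = (\<Prod>e\<in>pairs A. inv_sign r g e)"

lemma pairsE:
  assumes "e \<in> pairs A" obtains a b where "e = {a, b}" "a \<in> A" "b \<in> A" "a \<noteq> b"
  using assms by (auto simp: pairs_def card_2_iff)

lemma pairsI: "a \<in> A \<Longrightarrow> b \<in> A \<Longrightarrow> a \<noteq> b \<Longrightarrow> {a, b} \<in> pairs A"
  by (auto simp: pairs_def)

lemma finite_pairs: "finite A \<Longrightarrow> finite (pairs A)"
  by (rule finite_subset[of _ "Pow A"]) (auto simp: pairs_def)

lemma inv_sign_pair:
  assumes "r a \<noteq> r b" "r (g a) \<noteq> r (g b)"
  shows "inv_sign r g {a, b} = (if (r a < r b) = (r (g a) < r (g b)) then 1 else - 1)"
proof -
  have "(\<exists>x y. {a, b} = {x, y} \<and> r x < r y \<and> r (g y) < r (g x)) \<longleftrightarrow>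
    (r a < r b \<and> r (g b) < r (g a)) \<or> (r b < r a \<and> r (g a) < r (g b))" (is "?L = ?R")
  proof
    assume ?R
    then show ?L
    proof
      assume "r a < r b \<and> r (g b) < r (g a)"
      then show ?L by blast
    next
      assume "r b < r a \<and> r (g a) < r (g b)"
      then show ?L by (intro exI[of _ b] exI[of _ a]) (simp add: insert_commute)
    qed
  qed (auto simp: doubleton_eq_iff)
  then show ?thesis using assms by (auto simp: inv_sign_def)
qed

lemma inv_sign_square [simp]: "inv_sign r g e * inv_sign r g e = 1"
  by (simp add: inv_sign_def)

lemma set_sign_square [simp]: "set_sign r g A * set_sign r g A = 1"
  by (simp add: set_sign_def flip: prod.distrib)

lemma bij_betw_pairs:
  assumes "inj_on h A"
  shows "bij_betw ((`) h) (pairs A) (pairs (h ` A))"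
proof (rule bij_betw_imageI)
  show "inj_on ((`) h) (pairs A)"
    using assms by (intro inj_on_subset[OF inj_on_image_Pow]) (auto simp: pairs_def)
  show "(`) h ` pairs A = pairs (h ` A)"
  proof (intro equalityI subsetI)
    fix e assume "e \<in> (`) h ` pairs A"
    then show "e \<in> pairs (h ` A)"
      using assms by (auto simp: pairs_def card_image inj_on_subset intro: card_image[THEN trans])
  next
    fix e assume "e \<in> pairs (h ` A)"
    then obtain a b where "e = {a, b}" "a \<in> h ` A" "b \<in> h ` A" "a \<noteq> b" by (rule pairsE)
    then obtain a' b' where "e = h ` {a', b'}" "a' \<in> A" "b' \<in> A" "a' \<noteq> b'" by auto
    then show "e \<in> (`) h ` pairs A" by (intro image_eqI[of _ _ "{a', b'}"] pairsI)
  qed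
qed

lemma inv_sign_comp:
  assumes r: "inj_on r X" and g: "g permutes X" and h: "h permutes X" and e: "e \<in> pairs X"
  shows "inv_sign r (g \<circ> h) e = inv_sign r g (h ` e) * inv_sign r h e"
proof -
  obtain a b where ab: "e = {a, b}" "a \<in> X" "b \<in> X" "a \<noteq> b" using e by (rule pairsE)
  have X: "h a \<in> X" "h b \<in> X" "g (h a) \<in> X" "g (h b) \<in> X"
    using ab permutes_in_image[OF g] permutes_in_image[OF h] by simp_all
  have ne: "h a \<noteq> h b" "g (h a) \<noteq> g (h b)"
    using ab permutes_inj[OF g] permutes_inj[OF h] by (auto dest: injD)
  have rr: "r a \<noteq> r b" "r (h a) \<noteq> r (h b)" "r (g (h a)) \<noteq> r (g (h b))"
    using ab X ne r by (auto dest: inj_onD)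
  show ?thesis
    using rr unfolding ab(1) image_insert image_empty
    by (subst (1 2 3) inv_sign_pair) auto
qed

text \<open>A cocycle rule: a pair is inverted by the composite exactly when one of the two steps
  inverts it. It makes the signed permutation matrices of the exterior powers
  multiplicative.\<close>

lemma set_sign_comp:
  assumes "inj_on r X" "g permutes X" "h permutes X" "A \<subseteq> X"
  shows "set_sign r (g \<circ> h) A = set_sign r g (h ` A) * set_sign r h A"
proof -
  have "set_sign r (g \<circ> h) A = (\<Prod>e\<in>pairs A. inv_sign r g (h ` e) * inv_sign r h e)"
    unfolding set_sign_def using assms by (intro prod.cong refl inv_sign_comp) (auto simp: pairs_def)
  also have "\<dots> = (\<Prod>e\<in>pairs A. inv_sign r g (h ` e)) * set_sign r h A"
    by (simp add: prod.distrib set_sign_def)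
  also have "(\<Prod>e\<in>pairs A. inv_sign r g (h ` e)) = set_sign r g (h ` A)"
    unfolding set_sign_def
    by (rule prod.reindex_bij_betw[OF bij_betw_pairs])
      (rule inj_on_subset[OF permutes_inj[OF assms(3)] subset_UNIV])
  finally show ?thesis .
qed

lemma set_sign_fix:
  assumes "\<And>x. x \<in> A \<Longrightarrow> g x = x"
  shows "set_sign r g A = 1"
  unfolding set_sign_def inv_sign_def
  by (intro prod.neutral ballI) (use assms in \<open>auto simp: pairs_def\<close>)

lemma set_sign_inv:
  assumes "inj_on r X" "g permutes X" "A \<subseteq> X" "g ` A = A"
  shows "set_sign r (inv_into UNIV g) A = set_sign r g A"
proof -
  have "1 = set_sign r (inv_into UNIV g \<circ> g) A"
    using permutes_inv_o(2)[OF assms(2)] by (simp add: set_sign_fix)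
  also have "\<dots> = set_sign r (inv_into UNIV g) A * set_sign r g A"
    using set_sign_comp[OF assms(1) permutes_inv[OF assms(2)] assms(2,3)] assms(4) by simp
  finally have "set_sign r (inv_into UNIV g) A * set_sign r g A * set_sign r g A = set_sign r g A"
    by (metis mult_1_left)
  then show ?thesis by (simp only: mult.assoc set_sign_square mult_1_right)
qed

lemma prod_involution:
  fixes f :: "'a \<Rightarrow> complex"
  assumes "finite S" "\<And>x. x \<in> S \<Longrightarrow> t x \<in> S \<and> t (t x) = x \<and> t x \<noteq> x \<and> f (t x) * f x = 1"
  shows "prod f S = 1"
  using assms
proof (induction "card S" arbitrary: S rule: less_induct)
  case less
  show ?case
  proof (cases "S = {}")
    case False
    then obtain x where x: "x \<in> S" by blast
    have t: "t x \<in> S" "t (t x) = x" "t x \<noteq> x" "f (t x) * f x = 1" using less.prems x by auto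
    let ?S = "S - {x, t x}"
    have "prod f ?S = 1"
    proof (rule less.hyps)
      show "card ?S < card S" using x less.prems(1) by (intro psubset_card_mono) auto
      show "finite ?S" using less.prems(1) by simp
      fix y assume y: "y \<in> ?S"
      then have "t y \<noteq> x" "t y \<noteq> t x" using less.prems(2) t x by (metis DiffD1 DiffD2 insertCI)+
      then show "t y \<in> ?S \<and> t (t y) = y \<and> t y \<noteq> y \<and> f (t y) * f y = 1" using less.prems(2) y by auto
    qed
    moreover have "prod f (insert x (insert (t x) S')) = f x * (f (t x) * prod f S')"
      if "finite S'" "x \<notin> S'" "t x \<notin> S'" for S'
      using that t(3) by simp
    moreover have "S = insert x (insert (t x) ?S)" using x t by auto
    ultimately have "prod f S = f x * (f (t x) * 1)"
      using less.prems(1) by (metis Diff_iff finite_Diff insertCI)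
    then show ?thesis using t(4) by (simp add: mult.commute)
  qed simp
qed

text \<open>Pairs moved by the transposition cancel against their images, as it is an involution.
  Among the pairs it preserves, all except {a, b} are fixed pointwise, so a single factor -1
  remains.\<close>

lemma set_sign_transpose:
  assumes r: "inj_on r A" and fin: "finite A" and ab: "a \<in> A" "b \<in> A" "a \<noteq> b"
  shows "set_sign r (transpose a b) A = - 1"
proof -
  let ?t = "transpose a b"
  have per: "?t permutes A" using ab by (simp add: permutes_swap_id)
  let ?M = "{e \<in> pairs A. ?t ` e \<noteq> e}" and ?F = "{e \<in> pairs A. ?t ` e = e}"
  have tt: "?t ` ?t ` e = e" for e by (simp add: image_image)
  have 1: "(\<Prod>e\<in>?M. inv_sign r ?t e) = 1"
  proof (rule prod_involution[where t = "(`) ?t"])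
    show "finite ?M" using finite_pairs[OF fin] by simp
    fix e assume e: "e \<in> ?M"
    have "?t ` e \<in> pairs (?t ` A)"
      using e bij_betw_pairs[of ?t A] by (auto simp: bij_betw_def)
    then have p: "?t ` e \<in> pairs A" using permutes_image[OF per] by simp
    have "inv_sign r (?t \<circ> ?t) e = inv_sign r ?t (?t ` e) * inv_sign r ?t e"
      using e by (intro inv_sign_comp[OF r per per]) simp
    moreover have "inv_sign r (?t \<circ> ?t) e = 1" by (simp add: inv_sign_def)
    ultimately show "?t ` e \<in> ?M \<and> ?t ` ?t ` e = e \<and> ?t ` e \<noteq> e \<and>
        inv_sign r ?t (?t ` e) * inv_sign r ?t e = 1"
      using e p tt by auto
  qed
  have 2: "inv_sign r ?t e = (if e = {a, b} then - 1 else 1)" if "e \<in> ?F" for e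
  proof -
    have eP: "e \<in> pairs A" using that by simp
    obtain c d where cd: "e = {c, d}" "c \<in> A" "d \<in> A" "c \<noteq> d" by (rule pairsE[OF eP])
    have eq: "{?t c, ?t d} = {c, d}" using that cd(1) by auto
    have rr: "r a \<noteq> r b" "r c \<noteq> r d" using r ab cd by (auto dest: inj_onD)
    show ?thesis
    proof (cases "e = {a, b}")
      case True
      then show ?thesis using rr inv_sign_pair[of r a b ?t] by auto
    next
      case False
      then have "?t c = c" "?t d = d" using eq cd by (auto simp: doubleton_eq_iff transpose_def split: if_splits)
      then show ?thesis using False cd(1) rr inv_sign_pair[of r c d ?t] by simp
    qed
  qed
  have "{a, b} \<in> ?F" using ab by (auto intro: pairsI)
  moreover have "finite ?F" using finite_pairs[OF fin] by simp
  ultimately have "(\<Prod>e\<in>?F. inv_sign r ?t e) = - 1" using 2 by (simp add: prod.delta)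
  moreover have "set_sign r ?t A = (\<Prod>e\<in>?M. inv_sign r ?t e) * (\<Prod>e\<in>?F. inv_sign r ?t e)"
    unfolding set_sign_def
    by (subst prod.union_disjoint[symmetric]) (use finite_pairs[OF fin] in \<open>auto intro!: prod.cong\<close>)
  ultimately show ?thesis using 1 by simp
qed

text \<open>With s(c, d) the sign of the order of c and d, the inversion sign is s(c, d) s(g c, g
  d). As g permutes \<open>C\<close> and \<open>D\<close>, both factors have the same product, and
  the total is the square of a sign.\<close>

lemma prod_inv_sign_cross:
  assumes r: "inj_on r X" and g: "g permutes X" and fin: "finite C" "finite D"
    and sub: "C \<subseteq> X" "D \<subseteq> X" and dis: "C \<inter> D = {}" and inv: "g ` C = C" "g ` D = D"
  shows "(\<Prod>c\<in>C. \<Prod>d\<in>D. inv_sign r g {c, d}) = 1"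
proof -
  define s :: "'a \<Rightarrow> 'a \<Rightarrow> complex" where "s c d = (if r c < r d then 1 else - 1)" for c d
  have "inv_sign r g {c, d} = s c d * s (g c) (g d)" if "c \<in> C" "d \<in> D" for c d
  proof -
    have "c \<noteq> d" "g c \<noteq> g d" using that dis permutes_inj[OF g] by (auto dest: injD)
    moreover have "c \<in> X" "d \<in> X" "g c \<in> X" "g d \<in> X"
      using that sub permutes_in_image[OF g] by auto
    ultimately have "r c \<noteq> r d" "r (g c) \<noteq> r (g d)" using r by (auto dest: inj_onD)
    then show ?thesis by (subst inv_sign_pair) (auto simp: s_def)
  qed
  then have "(\<Prod>c\<in>C. \<Prod>d\<in>D. inv_sign r g {c, d}) = (\<Prod>c\<in>C. \<Prod>d\<in>D. s c d) * (\<Prod>c\<in>C. \<Prod>d\<in>D. s (g c) (g d))"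
    by (simp add: prod.distrib)
  also have "(\<Prod>c\<in>C. \<Prod>d\<in>D. s (g c) (g d)) = (\<Prod>c\<in>C. \<Prod>d\<in>D. s c d)"
  proof -
    have bC: "bij_betw g C C" and bD: "bij_betw g D D"
      using inv permutes_inj[OF g] by (auto simp: bij_betw_def intro: inj_on_subset)
    have "(\<Prod>c\<in>C. \<Prod>d\<in>D. s (g c) (g d)) = (\<Prod>c\<in>C. \<Prod>d\<in>D. s c (g d))"
      by (rule prod.reindex_bij_betw[OF bC, of "\<lambda>c. \<Prod>d\<in>D. s c (g d)"])
    also have "\<dots> = (\<Prod>c\<in>C. \<Prod>d\<in>D. s c d)"
      by (intro prod.cong refl prod.reindex_bij_betw[OF bD])
    finally show ?thesis .
  qed
  also have "(\<Prod>c\<in>C. \<Prod>d\<in>D. s c d) * (\<Prod>c\<in>C. \<Prod>d\<in>D. s c d) = 1"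
    unfolding prod.distrib[symmetric] by (intro prod.neutral ballI) (simp add: s_def)
  finally show ?thesis .
qed

lemma prod_pairs_Un:
  fixes F :: "'x set \<Rightarrow> complex"
  assumes fin: "finite C" "finite D" and dis: "C \<inter> D = {}"
  shows "(\<Prod>e\<in>pairs (C \<union> D). F e) = (\<Prod>e\<in>pairs C. F e) * (\<Prod>e\<in>pairs D. F e) * (\<Prod>c\<in>C. \<Prod>d\<in>D. F {c, d})"
proof -
  let ?Z = "(\<lambda>(c, d). {c, d}) ` (C \<times> D)"
  have eq: "pairs (C \<union> D) = pairs C \<union> pairs D \<union> ?Z"
  proof (intro equalityI subsetI)
    fix e assume "e \<in> pairs (C \<union> D)"
    then obtain a b where ab: "e = {a, b}" "a \<in> C \<union> D" "b \<in> C \<union> D" "a \<noteq> b" by (rule pairsE)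
    then consider "a \<in> C" "b \<in> C" | "a \<in> D" "b \<in> D" | "a \<in> C" "b \<in> D" | "b \<in> C" "a \<in> D" by blast
    then show "e \<in> pairs C \<union> pairs D \<union> ?Z"
      using ab(1,4) by cases (auto intro: pairsI simp: insert_commute)
  next
    fix e assume "e \<in> pairs C \<union> pairs D \<union> ?Z"
    then show "e \<in> pairs (C \<union> D)" using dis by (auto simp: pairs_def card_insert_if disjoint_iff)
  qed
  have d1: "pairs C \<inter> pairs D = {}" 
  proof (rule ccontr)
    assume "pairs C \<inter> pairs D \<noteq> {}"
    then obtain e where "e \<subseteq> C \<inter> D" "card e = 2" by (auto simp: pairs_def)
    then show False using dis by simp
  qed
  have d2: "(pairs C \<union> pairs D) \<inter> ?Z = {}" using dis by (auto simp: pairs_def)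
  have inj: "inj_on (\<lambda>(c, d). {c, d}) (C \<times> D)" using dis by (auto simp: inj_on_def doubleton_eq_iff)
  have "(\<Prod>e\<in>?Z. F e) = (\<Prod>c\<in>C. \<Prod>d\<in>D. F {c, d})"
    by (subst prod.reindex[OF inj]) (simp add: prod.cartesian_product')
  moreover have "finite ?Z" using fin by simp
  moreover have "finite (pairs C)" "finite (pairs D)" using fin by (simp_all add: finite_pairs)
  ultimately show ?thesis
    unfolding eq using prod.union_disjoint[of "pairs C \<union> pairs D" ?Z F]
      prod.union_disjoint[of "pairs C" "pairs D" F] d1 d2 by simp
qed

lemma pairs_singleton [simp]: "pairs {x} = {}"
  by (auto simp: pairs_def subset_singleton_iff)

lemma pairs_empty [simp]: "pairs {} = {}"
  by (auto simp: pairs_def)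

lemma set_sign_add_fixpoint:
  assumes r: "inj_on r X" and g: "g permutes X" and fin: "finite C" and sub: "C \<subseteq> X" "x \<in> X"
    and x: "x \<notin> C" "g x = x" and inv: "g ` C = C"
  shows "set_sign r g (insert x C) = set_sign r g C"
proof -
  have "set_sign r g (C \<union> {x}) = set_sign r g C * set_sign r g {x} * (\<Prod>c\<in>C. \<Prod>d\<in>{x}. inv_sign r g {c, d})"
    unfolding set_sign_def using fin x by (intro prod_pairs_Un) auto
  also have "(\<Prod>c\<in>C. \<Prod>d\<in>{x}. inv_sign r g {c, d}) = 1"
    using fin sub x inv by (intro prod_inv_sign_cross[OF r g]) auto
  finally show ?thesis by (simp add: set_sign_def)
qed

section \<open>Exterior powers of the permutation module and their inner products\<close>

definition lam_entry :: "('x \<Rightarrow> nat) \<Rightarrow> ('x \<Rightarrow> 'x) \<Rightarrow> 'x set \<Rightarrow> 'x set \<Rightarrow> complex" where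
  "lam_entry r g A' A = (if g ` A = A' then set_sign r g A else 0)"

definition jsubsets :: "'x set \<Rightarrow> nat \<Rightarrow> 'x set set" where
  "jsubsets X j = {A. A \<subseteq> X \<and> card A = j}"

text \<open>The character of the \<open>j\<close>-th exterior power of the permutation module on \<open>X\<close>; the ranking
  \<open>r\<close> orders the factors of the wedge products.\<close>

definition lam :: "'x set \<Rightarrow> ('x \<Rightarrow> nat) \<Rightarrow> nat \<Rightarrow> ('x \<Rightarrow> 'x) \<Rightarrow> complex" where
  "lam X r j = fun_char (Sym_on X) (jsubsets X j) (lam_entry r)"

lemma finite_jsubsets: "finite X \<Longrightarrow> finite (jsubsets X j)"
  by (rule finite_subset[of _ "Pow X"]) (auto simp: jsubsets_def)

lemma jsubsets_image:
  assumes "g permutes X" "A \<in> jsubsets X j" shows "g ` A \<in> jsubsets X j"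
  using assms permutes_image[OF assms(1)] permutes_inj[OF assms(1)]
  by (auto simp: jsubsets_def card_image inj_on_subset dest: permutes_in_image)

lemma fun_rep_lam:
  assumes fin: "finite X" and r: "inj_on r X"
  shows "fun_rep (Sym_on X) (jsubsets X j) (lam_entry r)"
  unfolding fun_rep_def
proof (intro conjI ballI)
  show "finite (jsubsets X j)" using fin by (rule finite_jsubsets)
next
  fix g h A' A assume a: "g \<in> carrier (Sym_on X)" "h \<in> carrier (Sym_on X)" "A' \<in> jsubsets X j" "A \<in> jsubsets X j"
  then have gh: "g permutes X" "h permutes X" by simp_all
  have "(\<Sum>K\<in>jsubsets X j. lam_entry r g A' K * lam_entry r h K A) =
    (\<Sum>K\<in>jsubsets X j. if h ` A = K then lam_entry r g A' (h ` A) * set_sign r h A else 0)"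
    by (intro sum.cong) (auto simp: lam_entry_def)
  also have "\<dots> = lam_entry r g A' (h ` A) * set_sign r h A"
    using jsubsets_image[OF gh(2) a(4)] finite_jsubsets[OF fin] by simp
  also have "\<dots> = lam_entry r (g \<circ> h) A' A"
    using set_sign_comp[OF r gh, of A] a(4) by (auto simp: lam_entry_def jsubsets_def image_comp)
  finally show "lam_entry r (g \<otimes>\<^bsub>Sym_on X\<^esub> h) A' A =
    (\<Sum>K\<in>jsubsets X j. lam_entry r g A' K * lam_entry r h K A)" by simp
qed (auto simp: lam_entry_def set_sign_fix)

lemma lam_eq: "g permutes X \<Longrightarrow> lam X r j g = (\<Sum>A\<in>jsubsets X j. if g ` A = A then set_sign r g A else 0)"
  by (simp add: lam_def fun_char_def lam_entry_def)

lemma genuine_lam: "finite X \<Longrightarrow> inj_on r X \<Longrightarrow> genuine_char (Sym_on X) (lam X r j)"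
  unfolding lam_def by (intro genuine_charI group_Sym_on fun_rep_lam)

definition stab2 :: "'x set \<Rightarrow> 'x set \<Rightarrow> 'x set \<Rightarrow> ('x \<Rightarrow> 'x) set" where
  "stab2 X A B = {g. g permutes X \<and> g ` A = A \<and> g ` B = B}"

text \<open>The transposition of a and b stabilizes \<open>A\<close> and fixes \<open>B\<close>
  pointwise. Composing with it permutes the common stabilizer and reverses only the sign on
  \<open>A\<close>, so the sum equals its own negative.\<close>

lemma sum_stab2_sign_zero:
  assumes fin: "finite X" and r: "inj_on r X" and AB: "A \<subseteq> X" "B \<subseteq> X"
    and ab: "a \<in> A - B" "b \<in> A - B" "a \<noteq> b"
  shows "(\<Sum>g\<in>stab2 X A B. set_sign r g A * set_sign r g B) = 0"
proof -
  let ?t = "transpose a b" and ?f = "\<lambda>g. set_sign r g A * set_sign r g B"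
  have per: "?t permutes X" using ab AB by (intro permutes_swap_id) auto
  have tA: "?t ` A = A" using ab permutes_image[of ?t A] by (simp add: permutes_swap_id)
  have tB: "?t x = x" if "x \<in> B" for x using that ab by (auto simp: transpose_def)
  then have tB': "?t ` B = B" by simp
  have sA: "set_sign r ?t A = - 1"
    using ab AB finite_subset[OF _ fin] inj_on_subset[OF r] by (intro set_sign_transpose) auto
  have "(\<Sum>g\<in>stab2 X A B. ?f (g \<circ> ?t)) = (\<Sum>g\<in>stab2 X A B. ?f g)"
  proof (rule sum.reindex_bij_witness[where i = "\<lambda>g. g \<circ> ?t" and j = "\<lambda>g. g \<circ> ?t"])
    fix g assume "g \<in> stab2 X A B"
    then have g: "g permutes X" "g ` A = A" "g ` B = B" by (simp_all add: stab2_def)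
    have "(g \<circ> ?t) ` A = A" "(g \<circ> ?t) ` B = B"
      by (simp_all only: image_comp[symmetric] tA tB' g)
    then show "g \<circ> ?t \<in> stab2 X A B"
      using permutes_compose[OF per g(1)] by (simp add: stab2_def)
    then show "g \<circ> ?t \<in> stab2 X A B" .
  qed (simp_all add: comp_assoc)
  moreover have "(\<Sum>g\<in>stab2 X A B. ?f (g \<circ> ?t)) = (\<Sum>g\<in>stab2 X A B. - ?f g)"
  proof (rule sum.cong)
    fix g assume "g \<in> stab2 X A B"
    then have g: "g permutes X" by (simp add: stab2_def)
    show "?f (g \<circ> ?t) = - ?f g"
      using set_sign_comp[OF r g per AB(1)] set_sign_comp[OF r g per AB(2)] sA set_sign_fix[of B ?t r] tA tB tB'
      by simp
  qed simp
  ultimately have "(\<Sum>g\<in>stab2 X A B. ?f g) = - (\<Sum>g\<in>stab2 X A B. ?f g)" by (simp add: sum_negf)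
  then show ?thesis by simp
qed

text \<open>If A - B has a single point, g must fix it, and adjoining a fixed point to a stable set
  leaves the sign unchanged. Used for A and B alike, this makes the product of the two signs equal
  to 1.\<close>

lemma set_sign_eq_inter:
  assumes fin: "finite X" and r: "inj_on r X" and AB: "A \<subseteq> X" "B \<subseteq> X"
    and g: "g \<in> stab2 X A B" and c: "card (A - B) \<le> 1"
  shows "set_sign r g A = set_sign r g (A \<inter> B)"
proof -
  have gp: "g permutes X" "g ` A = A" "g ` B = B" using g by (auto simp: stab2_def)
  have inj: "inj g" using gp(1) by (rule permutes_inj)
  have gAB: "g ` (A - B) = A - B" "g ` (A \<inter> B) = A \<inter> B"
    using gp by (simp_all add: image_set_diff[OF inj] image_Int[OF inj])
  have finA: "finite A" using AB(1) fin by (rule finite_subset)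
  show ?thesis
  proof (cases "A - B = {}")
    case True
    then have "A \<inter> B = A" by blast
    then show ?thesis by simp
  next
    case False
    then have "card (A - B) = 1" using c finA by (simp add: le_Suc_eq)
    then obtain x where x: "A - B = {x}" by (auto simp: card_1_singleton_iff)
    then have gx: "g x = x" using gAB(1) by auto
    have "A = insert x (A \<inter> B)" using x by auto
    moreover have "set_sign r g (insert x (A \<inter> B)) = set_sign r g (A \<inter> B)"
      using x gx gAB(2) AB finA by (intro set_sign_add_fixpoint[OF r gp(1)]) auto
    ultimately show ?thesis by simp
  qed
qed

lemma sum_stab2_sign:
  assumes fin: "finite X" and r: "inj_on r X" and AB: "A \<subseteq> X" "B \<subseteq> X"
  shows "(\<Sum>g\<in>stab2 X A B. set_sign r g A * set_sign r g B) =
    (if card (A - B) \<le> 1 \<and> card (B - A) \<le> 1 then of_nat (card (stab2 X A B)) else 0)"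
proof (cases "card (A - B) \<le> 1 \<and> card (B - A) \<le> 1")
  case True
  have "set_sign r g A * set_sign r g B = 1" if g: "g \<in> stab2 X A B" for g
  proof -
    have "g \<in> stab2 X B A" using g by (auto simp: stab2_def)
    then show ?thesis
      using set_sign_eq_inter[OF fin r AB g] set_sign_eq_inter[OF fin r AB(2,1), of g] True
      by (simp add: Int_commute)
  qed
  then show ?thesis using True by simp
next
  case False
  have ex: "\<exists>a b. a \<in> S \<and> b \<in> S \<and> a \<noteq> b" if "\<not> card S \<le> 1" for S :: "'a set"
    using that card_le_Suc0_iff_eq[of S] by (metis One_nat_def card.infinite le0)
  have "stab2 X A B = stab2 X B A" by (auto simp: stab2_def)
  then show ?thesis
    using False ex[of "A - B"] ex[of "B - A"] sum_stab2_sign_zero[OF fin r AB]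
      sum_stab2_sign_zero[OF fin r AB(2,1)]
    by (auto simp: mult.commute)
qed

text \<open>The orbits of the symmetric group on pairs of subsets of \<open>X\<close>, as far as
  they are nonempty.\<close>

definition type_pairs :: "'x set \<Rightarrow> nat \<Rightarrow> nat \<Rightarrow> nat \<Rightarrow> ('x set \<times> 'x set) set" where
  "type_pairs X c x y = {(A, B). A \<subseteq> X \<and> B \<subseteq> X \<and> card (A \<inter> B) = c \<and> card (A - B) = x \<and> card (B - A) = y}"

lemma finite_type_pairs: "finite X \<Longrightarrow> finite (type_pairs X c x y)"
  by (rule finite_subset[of _ "Pow X \<times> Pow X"]) (auto simp: type_pairs_def)

lemma type_pairs_transitive:
  assumes fin: "finite X" and w: "(A, B) \<in> type_pairs X c x y" "(A', B') \<in> type_pairs X c x y"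
  shows "\<exists>g. g permutes X \<and> g ` A = A' \<and> g ` B = B'"
proof -
  have AB: "A \<subseteq> X" "B \<subseteq> X" "A' \<subseteq> X" "B' \<subseteq> X" using w by (auto simp: type_pairs_def)
  have cardU: "card (X - (C \<union> D)) = card X - (c + x + y)"
    if "(C, D) \<in> type_pairs X c x y" for C D
  proof -
    have CD: "C \<subseteq> X" "D \<subseteq> X" "card (C \<inter> D) = c" "card (C - D) = x" "card (D - C) = y"
      using that by (auto simp: type_pairs_def)
    then have f: "finite C" "finite D" using fin finite_subset by auto
    have "card (C \<union> D) = card ((C \<inter> D) \<union> (C - D) \<union> (D - C))" by (rule arg_cong[of _ _ card]) auto
    also have "\<dots> = c + x + y" using f CD by (subst card_Un_disjoint, auto)+
    finally show ?thesis using CD f by (subst card_Diff_subset) auto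
  qed
  \<comment> \<open>The colour of a point records in which of the two sets it lies; the four fibre
    sizes are determined by c, x, y and the size of \<open>X\<close>.\<close>
  define f where "f C D z = (z \<in> C, z \<in> D)" for C D :: "'a set" and z
  have fib: "{z \<in> X. f C D z = q} = (case q of (True, True) \<Rightarrow> C \<inter> D | (True, False) \<Rightarrow> C - D
      | (False, True) \<Rightarrow> D - C | (False, False) \<Rightarrow> X - (C \<union> D))" if "C \<subseteq> X" "D \<subseteq> X" for C D q
    using that by (auto simp: f_def split: prod.splits bool.splits)
  have "\<exists>g. g permutes X \<and> (\<forall>z\<in>X. f A' B' (g z) = f A B z)"
  proof (rule permutes_matching_colours[OF fin])
    fix q
    show "card {z \<in> X. f A B z = q} = card {z \<in> X. f A' B' z = q}"
      using w cardU[OF w(1)] cardU[OF w(2)]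
      by (simp add: fib[OF AB(1,2)] fib[OF AB(3,4)] split: prod.splits bool.splits)
        (auto simp: type_pairs_def)
  qed
  then obtain g where g: "g permutes X" "\<And>z. z \<in> X \<Longrightarrow> f A' B' (g z) = f A B z" by blast
  have "g ` C = C'" if C: "C \<subseteq> X" "C' \<subseteq> X" "\<And>z. z \<in> X \<Longrightarrow> g z \<in> C' \<longleftrightarrow> z \<in> C" for C C'
  proof (intro equalityI subsetI)
    fix z assume "z \<in> C'"
    moreover then obtain z' where "z' \<in> X" "z = g z'"
      using C(2) permutes_image[OF g(1)] by blast
    ultimately show "z \<in> g ` C" using C(3) by auto
  qed (use C in auto)
  then show ?thesis using g AB by (intro exI[of _ g]) (auto simp: f_def)
qed

text \<open>A nonempty type is a single orbit, so its stabilizers add up to the order of the group.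
  It is nonempty exactly when disjoint pieces of sizes c, x and y fit into \<open>X\<close>.\<close>

lemma sum_card_stab2:
  assumes fin: "finite X"
  shows "(\<Sum>(A, B)\<in>type_pairs X c x y. card (stab2 X A B)) =
    (if c + x + y \<le> card X then card {g. g permutes X} else 0)"
proof (cases "type_pairs X c x y = {}")
  case True
  have "\<not> c + x + y \<le> card X"
  proof
    assume "c + x + y \<le> card X"
    then obtain U where U: "U \<subseteq> X" "card U = c + x + y" by (meson obtain_subset_with_card_n)
    have fU: "finite U" using U fin finite_subset by blast
    obtain C where C: "C \<subseteq> U" "card C = c" using U obtain_subset_with_card_n[of c U] by auto
    have "card (U - C) = x + y" using C U fU by (simp add: card_Diff_subset finite_subset)
    then obtain D where D: "D \<subseteq> U - C" "card D = x" using obtain_subset_with_card_n[of x "U - C"] by auto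
    have "finite D" using D fU by (meson finite_Diff finite_subset)
    then have "card (U - C - D) = y" using \<open>card (U - C) = x + y\<close> D
      by (simp add: card_Diff_subset)
    moreover have "(C \<union> D) \<inter> (U - D) = C" "(C \<union> D) - (U - D) = D" "(U - D) - (C \<union> D) = U - C - D"
      using C D by auto
    ultimately have "(C \<union> D, U - D) \<in> type_pairs X c x y" using C D U by (auto simp: type_pairs_def)
    then show False using True by simp
  qed
  then show ?thesis using True by simp
next
  case False
  interpret fin_group "Sym_on X" by (rule fin_group_Sym_on[OF fin])
  have "(\<Sum>\<omega>\<in>type_pairs X c x y. card {g \<in> carrier (Sym_on X). map_prod ((`) g) ((`) g) \<omega> = \<omega>}) = card (carrier (Sym_on X))"
  proof (rule sum_card_stabilizer[OF _ _ _ _ finite_type_pairs[OF fin] False])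
    fix g \<omega> assume "g \<in> carrier (Sym_on X)" and w: "\<omega> \<in> type_pairs X c x y"
    then have g: "g permutes X" by simp
    have inj: "inj g" using g by (rule permutes_inj)
    then have injS: "inj_on g S" for S by (rule inj_on_subset) simp
    obtain A B where AB: "\<omega> = (A, B)" by (cases \<omega>)
    have "g ` A \<subseteq> X" "g ` B \<subseteq> X"
      using w AB permutes_image[OF g] by (auto simp: type_pairs_def)
    then show "map_prod ((`) g) ((`) g) \<omega> \<in> type_pairs X c x y"
      using w unfolding AB
      by (simp add: type_pairs_def image_Int[OF inj, symmetric] image_set_diff[OF inj, symmetric] card_image[OF injS])
  next
    fix \<omega> \<omega>' assume "\<omega> \<in> type_pairs X c x y" "\<omega>' \<in> type_pairs X c x y"
    then show "\<exists>g\<in>carrier (Sym_on X). map_prod ((`) g) ((`) g) \<omega> = \<omega>'"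
      using type_pairs_transitive[OF fin, of "fst \<omega>" "snd \<omega>" c x y "fst \<omega>'" "snd \<omega>'"]
      by (auto simp: map_prod_def split_def)
  qed (auto simp: image_comp)
  moreover have "(\<Sum>(A, B)\<in>type_pairs X c x y. card (stab2 X A B)) =
      (\<Sum>\<omega>\<in>type_pairs X c x y. card {g \<in> carrier (Sym_on X). map_prod ((`) g) ((`) g) \<omega> = \<omega>})"
    by (intro sum.cong refl) (auto simp: stab2_def)
  ultimately have "(\<Sum>(A, B)\<in>type_pairs X c x y. card (stab2 X A B)) = card {g. g permutes X}" by simp
  moreover have "c + x + y \<le> card X"
  proof -
    obtain A B where "(A, B) \<in> type_pairs X c x y" using False by auto
    then have AB: "A \<subseteq> X" "B \<subseteq> X" "card (A \<inter> B) = c" "card (A - B) = x" "card (B - A) = y"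
      by (auto simp: type_pairs_def)
    then have f: "finite A" "finite B" using fin finite_subset by auto
    have "c + x + y = card ((A \<inter> B) \<union> (A - B) \<union> (B - A))"
      using f AB by (subst card_Un_disjoint, auto)+
    also have "\<dots> \<le> card X" using AB fin by (intro card_mono) auto
    finally show ?thesis .
  qed
  ultimately show ?thesis by simp
qed

text \<open>The inner product counts the orbits of pairs (A, B) whose stabilizer acts with trivial
  sign product, and by \<open>sum_stab2_sign\<close> these are the types with x, y \<le> 1. Equal
  sizes allow x = y = 0, and x = y = 1 if 0 < i < card X; sizes differing by one allow a single
  type.\<close>

lemma cip_lam:
  assumes fin: "finite X" and r: "inj_on r X" and ij: "i \<le> card X" "j \<le> card X"
  shows "cip (Sym_on X) (lam X r i) (lam X r j) =
    (if i = j then 1 else 0) + (if i = j \<and> 0 < i \<and> i < card X then 1 else 0) +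
    (if j = Suc i then 1 else 0) + (if i = Suc j then 1 else 0)"
proof -
  let ?G = "{g. g permutes X}"
  have finG: "finite ?G" by (rule finite_permutations[OF fin])
  have G0: "card ?G \<noteq> 0" using finG permutes_id[of X] by (metis card_eq_0_iff empty_iff mem_Collect_eq)
  let ?J = "jsubsets X i \<times> jsubsets X j"
  define S where "S = {\<omega> \<in> ?J. case \<omega> of (A, B) \<Rightarrow> card (A - B) \<le> 1 \<and> card (B - A) \<le> 1}"
  have "(\<Sum>g\<in>carrier (Sym_on X). lam X r i g * lam X r j (inv\<^bsub>Sym_on X\<^esub> g)) =
      (\<Sum>g\<in>?G. \<Sum>(A, B)\<in>?J. if g \<in> stab2 X A B then set_sign r g A * set_sign r g B else 0)"
  proof (rule sum.cong)
    fix g assume "g \<in> ?G"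
    then have g: "g permutes X" by simp
    have "lam X r j (inv\<^bsub>Sym_on X\<^esub> g) = (\<Sum>B\<in>jsubsets X j. if g ` B = B then set_sign r g B else 0)"
      unfolding inv_Sym_on[OF g] lam_eq[OF permutes_inv[OF g]]
    proof (rule sum.cong)
      fix B assume B: "B \<in> jsubsets X j"
      have "inv_into UNIV g ` B = B \<longleftrightarrow> g ` B = B"
      proof
        assume "inv_into UNIV g ` B = B"
        then have "g ` B = g ` inv_into UNIV g ` B" by simp
        also have "\<dots> = B" using permutes_inverses(1)[OF g] by (simp add: image_image)
        finally show "g ` B = B" .
      next
        assume "g ` B = B"
        then have "inv_into UNIV g ` B = inv_into UNIV g ` g ` B" by simp
        also have "\<dots> = B" using permutes_inverses(2)[OF g] by (simp add: image_image)
        finally show "inv_into UNIV g ` B = B" .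
      qed
      then show "(if inv_into UNIV g ` B = B then set_sign r (inv_into UNIV g) B else 0) =
          (if g ` B = B then set_sign r g B else 0)"
        using set_sign_inv[OF r g, of B] B by (auto simp: jsubsets_def)
    qed simp
    then show "lam X r i g * lam X r j (inv\<^bsub>Sym_on X\<^esub> g) =
        (\<Sum>(A, B)\<in>?J. if g \<in> stab2 X A B then set_sign r g A * set_sign r g B else 0)"
      by (simp add: lam_eq[OF g] sum_product sum.cartesian_product' stab2_def g)
        (intro sum.cong refl, auto)
  qed simp
  also have "\<dots> = (\<Sum>(A, B)\<in>?J. \<Sum>g\<in>stab2 X A B. set_sign r g A * set_sign r g B)"
  proof -
    have "(\<Sum>g\<in>?G. if g \<in> stab2 X A B then F g else 0) = (\<Sum>g\<in>stab2 X A B. F g)" for A B and F :: "_ \<Rightarrow> complex"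
      using finG by (simp add: sum.If_cases stab2_def Collect_conj_eq Int_commute flip: sum.inter_filter)
    then show ?thesis by (subst sum.swap) (auto simp: split_def intro: sum.cong)
  qed
  also have "\<dots> = (\<Sum>(A, B)\<in>?J. if card (A - B) \<le> 1 \<and> card (B - A) \<le> 1 then of_nat (card (stab2 X A B)) else 0)"
    by (intro sum.cong refl) (auto simp: sum_stab2_sign[OF fin r] jsubsets_def)
  also have "\<dots> = (\<Sum>(A, B)\<in>S. of_nat (card (stab2 X A B)))"
    by (rule sum.mono_neutral_cong_right) (auto simp: S_def finite_jsubsets[OF fin] split: if_splits)
  also have "\<dots> = of_nat (\<Sum>(A, B)\<in>S. card (stab2 X A B))"
    by (simp add: split_def)
  also have "(\<Sum>(A, B)\<in>S. card (stab2 X A B)) =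
     (if i = j then card ?G else 0) + (if i = j \<and> 0 < i \<and> i < card X then card ?G else 0) +
     (if j = Suc i then card ?G else 0) + (if i = Suc j then card ?G else 0)"
  proof -
    have cards: "card A = card (A \<inter> B) + card (A - B)" "card B = card (A \<inter> B) + card (B - A)"
      if "A \<subseteq> X" "B \<subseteq> X" for A B
      using that fin card_Int_Diff[of A B] card_Int_Diff[of B A] finite_subset by (auto simp: Int_commute)
    have Siff: "(A, B) \<in> S \<longleftrightarrow> A \<subseteq> X \<and> B \<subseteq> X \<and> card (A \<inter> B) + card (A - B) = i \<and>
        card (A \<inter> B) + card (B - A) = j \<and> card (A - B) \<le> 1 \<and> card (B - A) \<le> 1" for A B
      using cards[of A B] by (auto simp: S_def jsubsets_def)
    have tp: "(A, B) \<in> type_pairs X c x y \<longleftrightarrow> A \<subseteq> X \<and> B \<subseteq> X \<and>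
        card (A \<inter> B) = c \<and> card (A - B) = x \<and> card (B - A) = y" for A B c x y
      by (simp add: type_pairs_def)
    consider "i = j" "0 < i" | "i = j" "i = 0" | "j = Suc i" | "i = Suc j" | "i \<noteq> j" "j \<noteq> Suc i" "i \<noteq> Suc j"
      by linarith
    then show ?thesis
    proof cases
      case 1
      have ar: "(c + x = i \<and> c + y = j \<and> x \<le> 1 \<and> y \<le> 1) \<longleftrightarrow>
        (c = i \<and> x = 0 \<and> y = 0) \<or> (c = i - 1 \<and> x = 1 \<and> y = 1)" for c x y :: nat
        using 1 by arith
      have "S = type_pairs X i 0 0 \<union> type_pairs X (i - 1) 1 1"
      proof (rule Set.set_eqI)
        fix \<omega> show "\<omega> \<in> S \<longleftrightarrow> \<omega> \<in> type_pairs X i 0 0 \<union> type_pairs X (i - 1) 1 1"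
          by (cases \<omega>) (simp only: Un_iff Siff tp ar, blast)
      qed
      moreover have "type_pairs X i 0 0 \<inter> type_pairs X (i - 1) 1 1 = {}" by (auto simp: type_pairs_def)
      ultimately have "(\<Sum>(A, B)\<in>S. card (stab2 X A B)) =
          (\<Sum>(A, B)\<in>type_pairs X i 0 0. card (stab2 X A B)) + (\<Sum>(A, B)\<in>type_pairs X (i - 1) 1 1. card (stab2 X A B))"
        by (simp only: sum.union_disjoint finite_type_pairs[OF fin])
      then show ?thesis
        using 1 ij by (simp only: sum_card_stab2[OF fin]) auto
    next
      case 2
      have ar: "(c + x = i \<and> c + y = j \<and> x \<le> 1 \<and> y \<le> 1) \<longleftrightarrow> (c = 0 \<and> x = 0 \<and> y = 0)" for c x y :: nat
        using 2 by arith
      have "S = type_pairs X 0 0 0"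
      proof (rule Set.set_eqI)
        fix \<omega> show "\<omega> \<in> S \<longleftrightarrow> \<omega> \<in> type_pairs X 0 0 0" by (cases \<omega>) (simp only: Siff tp ar)
      qed
      then show ?thesis using 2 by (simp only: sum_card_stab2[OF fin]) auto
    next
      case 3
      have ar: "(c + x = i \<and> c + y = j \<and> x \<le> 1 \<and> y \<le> 1) \<longleftrightarrow> (c = i \<and> x = 0 \<and> y = 1)" for c x y :: nat
        using 3 by arith
      have "S = type_pairs X i 0 1"
      proof (rule Set.set_eqI)
        fix \<omega> show "\<omega> \<in> S \<longleftrightarrow> \<omega> \<in> type_pairs X i 0 1" by (cases \<omega>) (simp only: Siff tp ar)
      qed
      then show ?thesis using 3 ij by (simp only: sum_card_stab2[OF fin]) auto
    next
      case 4
      have ar: "(c + x = i \<and> c + y = j \<and> x \<le> 1 \<and> y \<le> 1) \<longleftrightarrow> (c = j \<and> x = 1 \<and> y = 0)" for c x y :: nat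
        using 4 by arith
      have "S = type_pairs X j 1 0"
      proof (rule Set.set_eqI)
        fix \<omega> show "\<omega> \<in> S \<longleftrightarrow> \<omega> \<in> type_pairs X j 1 0" by (cases \<omega>) (simp only: Siff tp ar)
      qed
      then show ?thesis using 4 ij by (simp only: sum_card_stab2[OF fin]) auto
    next
      case 5
      have ar: "\<not> (c + x = i \<and> c + y = j \<and> x \<le> 1 \<and> y \<le> 1)" for c x y :: nat
        using 5 by arith
      have "\<omega> \<notin> S" for \<omega> by (cases \<omega>) (simp only: Siff ar simp_thms)
      then have "S = {}" by blast
      then show ?thesis using 5 by simp
    qed
  qed
  finally show ?thesis using G0 by (simp add: cip_def)
qed

section \<open>Hook characters, those of the partitions (m - i, 1^i) with m = card X\<close>

primrec hook :: "'x set \<Rightarrow> ('x \<Rightarrow> nat) \<Rightarrow> nat \<Rightarrow> ('x \<Rightarrow> 'x) \<Rightarrow> complex" where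
  "hook X r 0 = lam X r 0"
| "hook X r (Suc i) = (\<lambda>g\<in>carrier (Sym_on X). lam X r (Suc i) g - hook X r i g)"

lemma cip_hook_Suc:
  assumes "finite X"
  shows "cip (Sym_on X) f (hook X r (Suc i)) = cip (Sym_on X) f (lam X r (Suc i)) - cip (Sym_on X) f (hook X r i)"
proof -
  interpret fin_group "Sym_on X" by (rule fin_group_Sym_on[OF assms])
  have "inv\<^bsub>Sym_on X\<^esub> g permutes X" if "g permutes X" for g using inv_closed[of g] that by simp
  then show ?thesis
    by (simp add: cip_def right_diff_distrib sum_subtractf diff_divide_distrib)
qed

text \<open>Alternating subtraction collapses the three bands of \<open>cip_lam\<close> to two: hook
  i is met by the powers i and i + 1, once by each.\<close>

lemma cip_lam_hook:
  assumes fin: "finite X" and r: "inj_on r X" and "i < card X" "j \<le> card X"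
  shows "cip (Sym_on X) (lam X r j) (hook X r i) = (if j = i then 1 else 0) + (if j = Suc i then 1 else 0)"
  using assms(3)
proof (induction i)
  case 0
  then show ?case using assms(4) by (auto simp: cip_lam[OF fin r])
next
  case (Suc i)
  then show ?case using assms(4) by (auto simp: cip_hook_Suc[OF fin] cip_lam[OF fin r] simp del: hook.simps)
qed

text \<open>The power i + 1 has norm 2 and contains hook i once, so removing hook i leaves one
  irreducible character, the next hook.\<close>

lemma hook_Irr:
  assumes fin: "finite X" and r: "inj_on r X" and i: "i < card X"
  shows "hook X r i \<in> Irr (Sym_on X)"
proof -
  interpret fin_group "Sym_on X" by (rule fin_group_Sym_on[OF fin])
  \<comment> \<open>Characters are extensional here, so agreement on the group is already
    equality.\<close>
  have ext: "f = f'" if "f \<in> extensional (carrier (Sym_on X))" "f' \<in> Irr (Sym_on X)"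
      "\<forall>g\<in>carrier (Sym_on X). f g = f' g" for f f'
    using that by (intro extensionalityI[of _ "carrier (Sym_on X)"]) (auto simp: Irr_def character_of_def)
  show ?thesis using i
  proof (induction i)
    case 0
    have "cip (Sym_on X) (lam X r 0) (lam X r 0) = 1" using cip_lam[OF fin r, of 0 0] by simp
    then obtain \<chi> where \<chi>: "\<chi> \<in> Irr (Sym_on X)" "\<forall>g\<in>carrier (Sym_on X). lam X r 0 g = \<chi> g"
      using norm_one_imp_Irr[OF genuine_lam[OF fin r]] by blast
    then have "lam X r 0 = \<chi>" by (intro ext) (auto simp: lam_def fun_char_def)
    then show ?case using \<chi> by simp
  next
    case (Suc i)
    have "cip (Sym_on X) (lam X r (Suc i)) (lam X r (Suc i)) = 2"
      using Suc.prems cip_lam[OF fin r, of "Suc i" "Suc i"] by simp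
    note a = this
    have b: "cip (Sym_on X) (lam X r (Suc i)) (hook X r i) = 1"
      using Suc.prems cip_lam_hook[OF fin r, of i "Suc i"] by simp
    obtain \<psi> where \<psi>: "\<psi> \<in> Irr (Sym_on X)"
      "\<forall>g\<in>carrier (Sym_on X). lam X r (Suc i) g = hook X r i g + \<psi> g"
      using norm_two_split[OF genuine_lam[OF fin r] a Suc.IH[OF Suc_lessD[OF Suc.prems]] b] by blast
    then have "hook X r (Suc i) = \<psi>" by (intro ext) auto
    then show ?case using \<psi> by simp
  qed
qed

lemma hook_inj:
  assumes fin: "finite X" and r: "inj_on r X"
  shows "inj_on (hook X r) {..<card X}"
proof (rule linorder_inj_onI')
  fix i j assume ij: "i \<in> {..<card X}" "j \<in> {..<card X}" "i < j"
  show "hook X r i \<noteq> hook X r j"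
  proof
    assume eq: "hook X r i = hook X r j"
    have "cip (Sym_on X) (lam X r i) (hook X r i) = 1" using ij by (subst cip_lam_hook[OF fin r]) auto
    moreover have "cip (Sym_on X) (lam X r i) (hook X r j) = 0" using ij by (subst cip_lam_hook[OF fin r]) auto
    ultimately show False unfolding eq by simp
  qed
qed

text \<open>A full cycle stabilizes only the empty set and \<open>X\<close>, and j < card X excludes
  \<open>X\<close>. The recursion for hooks then alternates between 1 and -1.\<close>

lemma lam_on_full_cycle:
  assumes \<sigma>: "\<sigma> permutes X" and trans: "\<And>A. A \<subseteq> X \<Longrightarrow> \<sigma> ` A = A \<Longrightarrow> A = {} \<or> A = X"
    and fin: "finite X" and j: "j < card X"
  shows "lam X r j \<sigma> = (if j = 0 then 1 else 0)"
proof -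
  have "(if \<sigma> ` A = A then set_sign r \<sigma> A else 0) = (if A = {} then 1 else 0)" if A: "A \<in> jsubsets X j" for A
  proof (cases "A = {}")
    case True
    then show ?thesis by (simp add: set_sign_def)
  next
    case False
    have "A \<subseteq> X" "A \<noteq> X" using A j by (auto simp: jsubsets_def)
    then have "\<sigma> ` A \<noteq> A" using trans False by blast
    then show ?thesis using False by simp
  qed
  then have "lam X r j \<sigma> = (\<Sum>A\<in>jsubsets X j. if A = {} then 1 else 0)"
    unfolding lam_eq[OF \<sigma>] by (intro sum.cong refl)
  also have "\<dots> = (if {} \<in> jsubsets X j then 1 else 0)"
    using finite_jsubsets[OF fin, of j] by (rule sum.delta)
  also have "\<dots> = (if j = 0 then 1 else 0)" by (auto simp: jsubsets_def)
  finally show ?thesis .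
qed

lemma hook_on_full_cycle:
  assumes "\<sigma> permutes X" "\<And>A. A \<subseteq> X \<Longrightarrow> \<sigma> ` A = A \<Longrightarrow> A = {} \<or> A = X" "finite X" "i < card X"
  shows "hook X r i \<sigma> = (- 1) ^ i"
  using assms(4)
proof (induction i)
  case 0
  then have "lam X r 0 \<sigma> = 1" by (subst lam_on_full_cycle[OF assms(1-3)]) auto
  then show ?case by simp
next
  case (Suc i)
  then have "lam X r (Suc i) \<sigma> = 0" by (subst lam_on_full_cycle[OF assms(1-3)]) auto
  then show ?case using Suc assms(1) by simp
qed

section \<open>The stabilizer of a set partition as a wreath product\<close>

text \<open>A pair in a disjoint union lies in one part or joins two. Parts B and B' are joined by
  card (D B) * card (D B') pairs with the common value G {B, B'}, whence the exponent.\<close>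

lemma prod_pairs_UNION:
  fixes F G :: "_ set \<Rightarrow> complex"
  assumes "finite Q" "\<And>B. B \<in> Q \<Longrightarrow> finite (D B)"
    and "\<And>B B'. B \<in> Q \<Longrightarrow> B' \<in> Q \<Longrightarrow> B \<noteq> B' \<Longrightarrow> D B \<inter> D B' = {}"
    and "\<And>B B' c d. B \<in> Q \<Longrightarrow> B' \<in> Q \<Longrightarrow> B \<noteq> B' \<Longrightarrow> c \<in> D B \<Longrightarrow> d \<in> D B' \<Longrightarrow> F {c, d} = G {B, B'}"
  shows "(\<Prod>e\<in>pairs (\<Union>B\<in>Q. D B). F e) =
    (\<Prod>B\<in>Q. \<Prod>e\<in>pairs (D B). F e) * (\<Prod>E\<in>pairs Q. G E ^ (\<Prod>B\<in>E. card (D B)))"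
  using assms
proof (induction Q rule: finite_induct)
  case empty
  then show ?case by simp
next
  case (insert B0 Q)
  let ?U = "\<Union>B\<in>Q. D B"
  have fin: "finite ?U" "finite (D B0)" using insert by auto
  have dis: "?U \<inter> D B0 = {}" using insert.hyps insert.prems(2) by fastforce
  have IH: "(\<Prod>e\<in>pairs ?U. F e) =
      (\<Prod>B\<in>Q. \<Prod>e\<in>pairs (D B). F e) * (\<Prod>E\<in>pairs Q. G E ^ (\<Prod>B\<in>E. card (D B)))"
    using insert.prems by (intro insert.IH) auto
  have cross: "(\<Prod>c\<in>?U. \<Prod>d\<in>D B0. F {c, d}) = (\<Prod>B\<in>Q. G {B, B0} ^ (\<Prod>B\<in>{B, B0}. card (D B)))"
  proof -
    have "(\<Prod>c\<in>?U. \<Prod>d\<in>D B0. F {c, d}) = (\<Prod>B\<in>Q. \<Prod>c\<in>D B. \<Prod>d\<in>D B0. F {c, d})"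
      using insert by (intro prod.UNION_disjoint) auto
    also have "\<dots> = (\<Prod>B\<in>Q. \<Prod>c\<in>D B. \<Prod>d\<in>D B0. G {B, B0})"
    proof (intro prod.cong refl)
      fix B c d assume "B \<in> Q" "c \<in> D B" "d \<in> D B0"
      moreover then have "B \<noteq> B0" using insert.hyps by auto
      ultimately show "F {c, d} = G {B, B0}" by (intro insert.prems(3)) auto
    qed
    also have "\<dots> = (\<Prod>B\<in>Q. G {B, B0} ^ (\<Prod>B\<in>{B, B0}. card (D B)))"
    proof (intro prod.cong refl)
      fix B assume "B \<in> Q"
      then have "B \<noteq> B0" using insert.hyps by auto
      then show "(\<Prod>c\<in>D B. \<Prod>d\<in>D B0. G {B, B0}) = G {B, B0} ^ (\<Prod>B\<in>{B, B0}. card (D B))"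
        by (simp add: power_mult[symmetric] mult.commute)
    qed
    finally show ?thesis .
  qed
  have "(\<Prod>e\<in>pairs (\<Union>B\<in>insert B0 Q. D B). F e) = (\<Prod>e\<in>pairs (?U \<union> D B0). F e)"
    by (simp add: Un_commute)
  also have "\<dots> = (\<Prod>e\<in>pairs ?U. F e) * (\<Prod>e\<in>pairs (D B0). F e) *
      (\<Prod>B\<in>Q. G {B, B0} ^ (\<Prod>B\<in>{B, B0}. card (D B)))"
    unfolding prod_pairs_Un[OF fin dis] cross ..
  also have "\<dots> = (\<Prod>B\<in>insert B0 Q. \<Prod>e\<in>pairs (D B). F e) *
      ((\<Prod>E\<in>pairs Q. G E ^ (\<Prod>B\<in>E. card (D B))) * (\<Prod>B\<in>Q. G {B, B0} ^ (\<Prod>B\<in>{B, B0}. card (D B))))"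
    using insert.hyps by (simp add: IH mult_ac)
  also have "(\<Prod>E\<in>pairs Q. G E ^ (\<Prod>B\<in>E. card (D B))) * (\<Prod>B\<in>Q. G {B, B0} ^ (\<Prod>B\<in>{B, B0}. card (D B))) =
      (\<Prod>E\<in>pairs (insert B0 Q). G E ^ (\<Prod>B\<in>E. card (D B)))"
    using prod_pairs_Un[of Q "{B0}" "\<lambda>E. G E ^ (\<Prod>B\<in>E. card (D B))"] insert.hyps by simp
  finally show ?case .
qed

lemma inv_unique_permutes:
  assumes "g permutes Y" "f \<circ> g = id"
  shows "f = inv_into UNIV g"
proof -
  have "f = f \<circ> (g \<circ> inv_into UNIV g)" using permutes_inv_o(1)[OF assms(1)] by simp
  also have "\<dots> = (f \<circ> g) \<circ> inv_into UNIV g" by (rule comp_assoc[symmetric])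
  finally show ?thesis using assms(2) by simp
qed

text \<open>\<open>e B\<close> numbers the points of the block B, which identifies {1..n} with the
  product of \<open>P\<close> and {..<a}; \<open>rk\<close> is an arbitrary linear order of the
  blocks.\<close>

locale blocks =
  fixes n a :: nat and P :: "nat set set" and e :: "nat set \<Rightarrow> nat \<Rightarrow> nat" and rk :: "nat set \<Rightarrow> nat"
  assumes part: "partition_on {1..n} P" and a: "a > 0"
    and e: "\<And>B. B \<in> P \<Longrightarrow> bij_betw (e B) {..<a} B"
    and rk: "inj_on rk P" and P_ne: "P \<noteq> {}"
begin

abbreviation "H \<equiv> partition_stabilizer n P"
abbreviation "Y \<equiv> {..<a}"

lemma finite_P: "finite P"
  using part by (rule finite_elements[OF finite_atLeastAtMost])

lemma block_sub: "B \<in> P \<Longrightarrow> B \<subseteq> {1..n}"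
  using part by (auto simp: partition_on_def)

lemma block_eq: "B \<in> P \<Longrightarrow> B' \<in> P \<Longrightarrow> y \<in> B \<Longrightarrow> y \<in> B' \<Longrightarrow> B = B'"
  using part by (auto simp: partition_on_def disjoint_def)

lemma e_in: "B \<in> P \<Longrightarrow> j < a \<Longrightarrow> e B j \<in> B"
  using e by (auto simp: bij_betw_def)

lemma e_surj: "B \<in> P \<Longrightarrow> y \<in> B \<Longrightarrow> \<exists>j<a. y = e B j"
  using e[of B] by (auto simp: bij_betw_def)

lemma e_inj: "B \<in> P \<Longrightarrow> i < a \<Longrightarrow> j < a \<Longrightarrow> e B i = e B j \<longleftrightarrow> i = j"
  using e[of B] by (auto simp: bij_betw_def inj_on_def)

lemma e_eq_iff: "B \<in> P \<Longrightarrow> B' \<in> P \<Longrightarrow> i < a \<Longrightarrow> j < a \<Longrightarrow> e B i = e B' j \<longleftrightarrow> B = B' \<and> i = j"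
  using e_in block_eq e_inj by metis

lemma e_range: "B \<in> P \<Longrightarrow> j < a \<Longrightarrow> e B j \<in> {1..n}"
  using e_in block_sub by blast

lemma point_cases:
  assumes "y \<in> {1..n}"
  obtains B j where "B \<in> P" "j < a" "y = e B j"
proof -
  obtain B where "B \<in> P" "y \<in> B" using assms part unfolding partition_on_def by blast
  then show thesis using e_surj that by blast
qed

definition loc :: "nat \<Rightarrow> nat set \<times> nat" where
  "loc y = (SOME q. fst q \<in> P \<and> snd q < a \<and> y = e (fst q) (snd q))"

lemma loc_e: assumes "B \<in> P" "j < a" shows "loc (e B j) = (B, j)"
proof -
  have "fst (loc (e B j)) \<in> P \<and> snd (loc (e B j)) < a \<and> e B j = e (fst (loc (e B j))) (snd (loc (e B j)))"
    unfolding loc_def by (rule someI[of _ "(B, j)"]) (use assms in simp)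
  then show ?thesis using e_eq_iff assms by (metis prod.collapse)
qed

lemma n_eq: "n = a * card P"
proof -
  have "card {1..n} = (\<Sum>B\<in>P. card B)"
    using part by (metis card_Union_disjoint finite_P finite_atLeastAtMost finite_subset block_sub partition_on_def disjoint_def pairwise_def disjnt_def)
  also have "\<dots> = (\<Sum>B\<in>P. a)"
    using e by (intro sum.cong refl) (metis bij_betw_same_card card_lessThan)
  finally show ?thesis by simp
qed

text \<open>The points are ranked block by block, so that the sign of a wedge product on \<open>{1..n}\<close>
  factors into signs on the blocks and a sign on the set of blocks.\<close>

definition rX :: "nat \<Rightarrow> nat" where
  "rX y = rk (fst (loc y)) * a + snd (loc y)"

lemma rX_e: "B \<in> P \<Longrightarrow> j < a \<Longrightarrow> rX (e B j) = rk B * a + j"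
  by (simp add: rX_def loc_e)

lemma rX_less_iff:
  assumes "B \<in> P" "B' \<in> P" "i < a" "j < a" "B \<noteq> B'"
  shows "rX (e B i) < rX (e B' j) \<longleftrightarrow> rk B < rk B'"
proof -
  have lt: "u * a + i < v * a + j" if "u < v" "i < a" for u v i j :: nat
  proof -
    have "u * a + i < Suc u * a" using that by simp
    also have "\<dots> \<le> v * a" using that by (intro mult_le_mono1) simp
    finally show ?thesis by simp
  qed
  have "rk B \<noteq> rk B'" using assms rk by (auto dest: inj_onD)
  then consider "rk B < rk B'" | "rk B' < rk B" by linarith
  then show ?thesis
  proof cases
    case 1
    then show ?thesis using lt[OF 1 assms(3), of j] assms by (simp add: rX_e)
  next
    case 2
    then show ?thesis using lt[OF 2 assms(4), of i] assms by (simp add: rX_e)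
  qed
qed

lemma inj_rX: "inj_on rX {1..n}"
proof (rule inj_onI)
  fix y z assume yz: "y \<in> {1..n}" "z \<in> {1..n}" "rX y = rX z"
  obtain B i where B: "B \<in> P" "i < a" "y = e B i" using yz(1) by (rule point_cases)
  obtain B' j where B': "B' \<in> P" "j < a" "z = e B' j" using yz(2) by (rule point_cases)
  have "B = B'"
  proof (rule ccontr)
    assume "B \<noteq> B'"
    then have "rk B \<noteq> rk B'" using B B' rk by (auto dest: inj_onD)
    then show False using rX_less_iff[OF B(1) B'(1) B(2) B'(2) \<open>B \<noteq> B'\<close>]
        rX_less_iff[OF B'(1) B(1) B'(2) B(2)] \<open>B \<noteq> B'\<close> yz(3) B(3) B'(3) by auto
  qed
  then show "y = z" using yz(3) B B' by (simp add: rX_e)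
qed

text \<open>The induced permutation of blocks, made the identity outside \<open>P\<close> because
  \<open>permutes\<close> demands it.\<close>

definition pi :: "(nat \<Rightarrow> nat) \<Rightarrow> nat set \<Rightarrow> nat set" where
  "pi h B = (if B \<in> P then h ` B else B)"

text \<open>The map from block B onto block \<open>pi h B\<close>, read in the coordinates of source
  and target. It depends on the source block, so under composition it obeys the cocycle rule
  \<open>xi_comp\<close>.\<close>

definition xi :: "(nat \<Rightarrow> nat) \<Rightarrow> nat set \<Rightarrow> nat \<Rightarrow> nat" where
  "xi h B j = (if j < a then snd (loc (h (e B j))) else j)"

lemma H_carrier: "h \<in> carrier H \<longleftrightarrow> h permutes {1..n} \<and> (`) h ` P = P"
  by (simp add: carrier_partition_stabilizer)

lemma H_mult [simp]: "g \<otimes>\<^bsub>H\<^esub> h = g \<circ> h" and H_one [simp]: "\<one>\<^bsub>H\<^esub> = id"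
  by (simp_all add: partition_stabilizer_def sym_group_def)

sublocale H: fin_group H
  by (intro fin_group.intro group_partition_stabilizer fin_group_axioms.intro
      finite_subset[OF _ finite_permutations[of "{1..n}"]]) (auto simp: H_carrier)

lemma pi_in: "h \<in> carrier H \<Longrightarrow> B \<in> P \<Longrightarrow> pi h B \<in> P"
  by (auto simp: pi_def H_carrier)

lemma H_apply_aux:
  assumes h: "h \<in> carrier H" and B: "B \<in> P" "j < a"
  shows "h (e B j) = e (pi h B) (xi h B j) \<and> xi h B j < a"
proof -
  have "h (e B j) \<in> pi h B" using B e_in by (auto simp: pi_def)
  then obtain j' where j': "j' < a" "h (e B j) = e (pi h B) j'"
    using e_surj[OF pi_in[OF h B(1)]] by blast
  then have "xi h B j = j'" using B loc_e[OF pi_in[OF h B(1)]] by (simp add: xi_def)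
  then show ?thesis using j' by simp
qed

lemmas H_apply = H_apply_aux[THEN conjunct1] and xi_less = H_apply_aux[THEN conjunct2]

lemma pi_permutes: assumes "h \<in> carrier H" shows "pi h permutes P"
proof (rule bij_imp_permutes)
  have inj: "inj h" and im: "(`) h ` P = P" using assms by (auto simp: H_carrier permutes_inj)
  have "bij_betw ((`) h) P P"
    using im inj by (auto simp: bij_betw_def inj_on_def inj_image_eq_iff)
  then show "bij_betw (pi h) P P"
    by (rule bij_betw_cong[THEN iffD1, rotated]) (simp add: pi_def)
qed (simp add: pi_def)

lemma xi_permutes: assumes h: "h \<in> carrier H" and B: "B \<in> P" shows "xi h B permutes Y"
proof (rule bij_imp_permutes)
  have "inj_on (xi h B) Y"
  proof (rule inj_onI)
    fix i j assume ij: "i \<in> Y" "j \<in> Y" "xi h B i = xi h B j"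
    then have "h (e B i) = h (e B j)" using H_apply[OF h B] by simp
    then have "e B i = e B j" using h permutes_inj by (auto simp: H_carrier dest: injD)
    then show "i = j" using ij e_inj[OF B] by simp
  qed
  then show "bij_betw (xi h B) Y Y"
    using xi_less[OF h B] by (intro bij_betw_imageI endo_inj_surj) auto
qed (simp add: xi_def)

lemma pi_comp: assumes "g \<in> carrier H" "h \<in> carrier H" shows "pi (g \<circ> h) = pi g \<circ> pi h"
  using pi_in[OF assms(2)] by (auto simp: fun_eq_iff pi_def image_comp)

lemma xi_comp:
  assumes "g \<in> carrier H" "h \<in> carrier H" "B \<in> P"
  shows "xi (g \<circ> h) B = xi g (pi h B) \<circ> xi h B"
proof
  fix j
  have "g \<circ> h \<in> carrier H" using assms H.m_closed[of g h] by simp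
  show "xi (g \<circ> h) B j = (xi g (pi h B) \<circ> xi h B) j"
  proof (cases "j < a")
    case True
    have "e (pi (g \<circ> h) B) (xi (g \<circ> h) B j) = g (h (e B j))"
      using H_apply[OF \<open>g \<circ> h \<in> carrier H\<close> assms(3) True] by simp
    also have "\<dots> = e (pi g (pi h B)) (xi g (pi h B) (xi h B j))"
      by (simp add: H_apply assms pi_in xi_less True)
    finally show ?thesis
      using True assms by (subst (asm) e_eq_iff) (auto simp: pi_in xi_less \<open>g \<circ> h \<in> carrier H\<close>)
  qed (simp add: xi_def)
qed

lemma pi_id: "pi id = id"
  by (simp add: pi_def fun_eq_iff)

lemma xi_id: "B \<in> P \<Longrightarrow> xi id B = id"
  by (auto simp: xi_def fun_eq_iff loc_e)

lemma pi_inv: assumes h: "h \<in> carrier H" shows "pi (inv\<^bsub>H\<^esub> h) = inv_into UNIV (pi h)"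
proof (rule inv_unique_permutes[OF pi_permutes[OF h]])
  have "inv\<^bsub>H\<^esub> h \<circ> h = id" using H.l_inv[OF h] by simp
  then show "pi (inv\<^bsub>H\<^esub> h) \<circ> pi h = id"
    using pi_comp[OF H.inv_closed[OF h] h] by (simp add: pi_id)
qed

lemma xi_inv:
  assumes h: "h \<in> carrier H" and B: "B \<in> P"
  shows "xi (inv\<^bsub>H\<^esub> h) (pi h B) = inv_into UNIV (xi h B)"
proof (rule inv_unique_permutes[OF xi_permutes[OF h B]])
  have "inv\<^bsub>H\<^esub> h \<circ> h = id" using H.l_inv[OF h] by simp
  then show "xi (inv\<^bsub>H\<^esub> h) (pi h B) \<circ> xi h B = id"
    using xi_comp[OF H.inv_closed[OF h] h B] by (simp add: xi_id[OF B])
qed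

abbreviation "SP \<equiv> {\<pi>. \<pi> permutes P}"
abbreviation "SY \<equiv> {y. y permutes Y}"

text \<open>The wreath product structure at the level of sets: block permutation and local
  permutations can be prescribed independently. It turns sums over H into iterated sums.\<close>

lemma wreath_bij:
  "bij_betw (\<lambda>h. (pi h, \<lambda>B\<in>P. xi h B)) (carrier H) (SP \<times> (P \<rightarrow>\<^sub>E SY))"
proof (rule bij_betw_imageI)
  show "inj_on (\<lambda>h. (pi h, \<lambda>B\<in>P. xi h B)) (carrier H)"
  proof (rule inj_onI)
    fix g h assume gh: "g \<in> carrier H" "h \<in> carrier H"
      and eq: "(pi g, \<lambda>B\<in>P. xi g B) = (pi h, \<lambda>B\<in>P. xi h B)"
    have xeq: "xi g B = xi h B" if "B \<in> P" for B
      using eq that by (metis Pair_inject restrict_apply')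
    show "g = h"
    proof
      fix y
      show "g y = h y"
      proof (cases "y \<in> {1..n}")
        case True
        then obtain B j where "B \<in> P" "j < a" "y = e B j" by (rule point_cases)
        then show ?thesis using H_apply[OF gh(1)] H_apply[OF gh(2)] xeq eq by simp
      next
        case False
        then show ?thesis using gh by (metis H_carrier permutes_not_in)
      qed
    qed
  qed
  show "(\<lambda>h. (pi h, \<lambda>B\<in>P. xi h B)) ` carrier H = SP \<times> (P \<rightarrow>\<^sub>E SY)"
  proof (intro equalityI subsetI)
    fix w assume "w \<in> (\<lambda>h. (pi h, \<lambda>B\<in>P. xi h B)) ` carrier H"
    then show "w \<in> SP \<times> (P \<rightarrow>\<^sub>E SY)" using pi_permutes xi_permutes by auto
  next
    fix w assume "w \<in> SP \<times> (P \<rightarrow>\<^sub>E SY)"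
    then obtain \<pi> x where w: "w = (\<pi>, x)" "\<pi> permutes P" "x \<in> P \<rightarrow>\<^sub>E SY" by auto
    have xp: "x B permutes Y" if "B \<in> P" for B using w(3) that by auto
    have \<pi>P: "\<pi> B \<in> P" if "B \<in> P" for B using permutes_in_image[OF w(2)] that by simp
    have xY: "x B j < a" if "B \<in> P" "j < a" for B j using permutes_in_image[OF xp[OF that(1)], of j] that by simp
    \<comment> \<open>Point j of block B is sent to point \<open>x B j\<close> of block
      \<open>\<pi> B\<close>.\<close>
    define h where "h y = (if y \<in> {1..n} then e (\<pi> (fst (loc y))) (x (fst (loc y)) (snd (loc y))) else y)" for y
    have h: "h (e B j) = e (\<pi> B) (x B j)" if "B \<in> P" "j < a" for B j
      using that e_range by (simp add: h_def loc_e)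
    have "inj_on h {1..n}"
    proof (rule inj_onI)
      fix y z assume yz: "y \<in> {1..n}" "z \<in> {1..n}" "h y = h z"
      obtain B i where B: "B \<in> P" "i < a" "y = e B i" using yz(1) by (rule point_cases)
      obtain B' j where B': "B' \<in> P" "j < a" "z = e B' j" using yz(2) by (rule point_cases)
      have "\<pi> B = \<pi> B' \<and> x B i = x B' j"
        using yz(3) B B' by (simp add: h e_eq_iff \<pi>P xY)
      moreover then have "B = B'" using permutes_inj[OF w(2)] by (auto dest: injD)
      ultimately have "i = j" using permutes_inj[OF xp[OF B(1)]] by (auto dest: injD)
      then show "y = z" using B B' \<open>B = B'\<close> by simp
    qed
    moreover have "h ` {1..n} \<subseteq> {1..n}"
    proof
      fix z assume "z \<in> h ` {1..n}"
      then obtain y where "y \<in> {1..n}" "z = h y" by blast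
      moreover from this(1) obtain B j where "B \<in> P" "j < a" "y = e B j" by (rule point_cases)
      ultimately show "z \<in> {1..n}" using e_range \<pi>P xY by (simp add: h)
    qed
    ultimately have "bij_betw h {1..n} {1..n}" by (intro bij_betw_imageI endo_inj_surj) auto
    then have hp: "h permutes {1..n}" by (rule bij_imp_permutes) (simp only: h_def if_False simp_thms)
    have hB: "h ` B = \<pi> B" if B: "B \<in> P" for B
    proof (intro equalityI subsetI)
      fix z assume "z \<in> h ` B"
      then obtain j where "j < a" "z = h (e B j)" using e_surj[OF B] by blast
      then show "z \<in> \<pi> B" using h[OF B] e_in[OF \<pi>P[OF B]] xY[OF B] by simp
    next
      fix z assume "z \<in> \<pi> B"
      then obtain j where j: "j < a" "z = e (\<pi> B) j" using e_surj[OF \<pi>P[OF B]] by blast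
      then obtain i where "i < a" "x B i = j"
        using permutes_image[OF xp[OF B]] by (metis imageE lessThan_iff)
      then have "z = h (e B i)" using j h[OF B] by simp
      then show "z \<in> h ` B" using e_in[OF B \<open>i < a\<close>] by blast
    qed
    have "(`) h ` P = \<pi> ` P" using hB by (intro image_cong) auto
    then have hH: "h \<in> carrier H" using hp permutes_image[OF w(2)] by (simp add: H_carrier)
    have "pi h = \<pi>" using hB permutes_not_in[OF w(2)] by (auto simp: fun_eq_iff pi_def)
    moreover have "xi h B = x B" if B: "B \<in> P" for B
    proof
      fix j show "xi h B j = x B j"
        using B permutes_not_in[OF xp[OF B], of j] by (auto simp: xi_def h loc_e \<pi>P xY)
    qed
    then have "(\<lambda>B\<in>P. xi h B) = x" using w(3) by (intro extensionalityI[of _ P]) (auto simp: PiE_def)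
    ultimately show "w \<in> (\<lambda>h. (pi h, \<lambda>B\<in>P. xi h B)) ` carrier H" using hH w(1) by blast
  qed
qed

lemma sum_H:
  "(\<Sum>h\<in>carrier H. F (pi h) (\<lambda>B\<in>P. xi h B)) = (\<Sum>\<pi>\<in>SP. \<Sum>x\<in>P \<rightarrow>\<^sub>E SY. F \<pi> x)"
  unfolding sum.cartesian_product using sum.reindex_bij_betw[OF wreath_bij, of "\<lambda>(\<pi>, x). F \<pi> x"] by simp

lemma card_H: "card (carrier H) = card SP * card SY ^ card P"
  using bij_betw_same_card[OF wreath_bij] by (simp add: card_cartesian_product card_PiE finite_P)

section \<open>Subsets and signs, block by block\<close>

definition assemble :: "(nat set \<Rightarrow> nat set) \<Rightarrow> nat set" where
  "assemble A = (\<Union>B\<in>P. e B ` A B)"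

lemma assemble_bij: "bij_betw assemble (P \<rightarrow>\<^sub>E Pow Y) (Pow {1..n})"
proof (rule bij_betw_byWitness[where f' = "\<lambda>S. \<lambda>B\<in>P. {j \<in> Y. e B j \<in> S}"])
  show "\<forall>A\<in>P \<rightarrow>\<^sub>E Pow Y. (\<lambda>B\<in>P. {j \<in> Y. e B j \<in> assemble A}) = A"
  proof
    fix A assume A: "A \<in> P \<rightarrow>\<^sub>E Pow Y"
    have "{j \<in> Y. e B j \<in> assemble A} = A B" if B: "B \<in> P" for B
    proof (intro equalityI subsetI)
      fix j assume "j \<in> {j \<in> Y. e B j \<in> assemble A}"
      then obtain B' i where "j < a" "B' \<in> P" "i \<in> A B'" "e B j = e B' i" by (auto simp: assemble_def)
      moreover then have "i < a" using A by auto
      ultimately show "j \<in> A B" using e_eq_iff B by auto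
    qed (use A B in \<open>auto simp: assemble_def\<close>)
    then show "(\<lambda>B\<in>P. {j \<in> Y. e B j \<in> assemble A}) = A"
      using A by (intro extensionalityI[of _ P]) (auto simp: PiE_def)
  qed
  show "\<forall>S\<in>Pow {1..n}. assemble (\<lambda>B\<in>P. {j \<in> Y. e B j \<in> S}) = S"
  proof
    fix S assume S: "S \<in> Pow {1..n}"
    show "assemble (\<lambda>B\<in>P. {j \<in> Y. e B j \<in> S}) = S"
    proof (intro equalityI subsetI)
      fix y assume y: "y \<in> S"
      then obtain B j where "B \<in> P" "j < a" "y = e B j" using S point_cases[of y] by blast
      then show "y \<in> assemble (\<lambda>B\<in>P. {j \<in> Y. e B j \<in> S})" using y by (auto simp: assemble_def)
    qed (auto simp: assemble_def)
  qed
  show "assemble ` (P \<rightarrow>\<^sub>E Pow Y) \<subseteq> Pow {1..n}" using e_range by (fastforce simp: assemble_def)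
  show "(\<lambda>S. \<lambda>B\<in>P. {j \<in> Y. e B j \<in> S}) ` Pow {1..n} \<subseteq> P \<rightarrow>\<^sub>E Pow Y" by auto
qed

lemma assemble_disjoint:
  assumes "A \<in> P \<rightarrow>\<^sub>E Pow Y" "B \<in> P" "B' \<in> P" "B \<noteq> B'"
  shows "e B ` A B \<inter> e B' ` A B' = {}"
proof -
  have "A B \<subseteq> Y" "A B' \<subseteq> Y" using assms by auto
  then show ?thesis using assms e_eq_iff by blast
qed

lemma card_block_image: "A \<in> P \<rightarrow>\<^sub>E Pow Y \<Longrightarrow> B \<in> P \<Longrightarrow> card (e B ` A B) = card (A B)"
  by (intro card_image inj_onI) (auto simp: e_inj subset_iff dest!: PiE_mem)

lemma finite_block_image: "A \<in> P \<rightarrow>\<^sub>E Pow Y \<Longrightarrow> B \<in> P \<Longrightarrow> finite (e B ` A B)"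
  using finite_subset[of "A B" Y] by auto

lemma card_assemble: "A \<in> P \<rightarrow>\<^sub>E Pow Y \<Longrightarrow> card (assemble A) = (\<Sum>B\<in>P. card (A B))"
  unfolding assemble_def
  by (subst card_UN_disjoint) (auto simp: finite_P finite_block_image assemble_disjoint card_block_image)

lemma H_image_assemble:
  assumes h: "h \<in> carrier H" and A: "A \<in> P \<rightarrow>\<^sub>E Pow Y"
  shows "h ` assemble A = assemble A \<longleftrightarrow> (\<forall>B\<in>P. xi h B ` A B = A (pi h B))"
proof -
  have AY: "A B \<subseteq> Y" if "B \<in> P" for B using A that by auto
  have im: "h ` assemble A = (\<Union>B\<in>P. e (pi h B) ` xi h B ` A B)"
  proof -
    have "h ` e B ` A B = e (pi h B) ` xi h B ` A B" if B: "B \<in> P" for B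
      unfolding image_image using AY[OF B] by (intro image_cong refl H_apply[OF h B]) auto
    then show ?thesis by (simp add: assemble_def image_UN)
  qed
  define A' where "A' = (\<lambda>B\<in>P. xi h (inv_into UNIV (pi h) B) ` A (inv_into UNIV (pi h) B))"
  note pp = pi_permutes[OF h]
  have ip: "inv_into UNIV (pi h) B \<in> P" if "B \<in> P" for B
    using permutes_in_image[OF permutes_inv[OF pp]] that by simp
  have A'pi: "A' (pi h B) = xi h B ` A B" if "B \<in> P" for B
    using that permutes_inverses(2)[OF pp] pi_in[OF h] by (simp add: A'_def)
  have A'PiE: "A' \<in> P \<rightarrow>\<^sub>E Pow Y"
    using AY ip xi_less[OF h] by (fastforce simp: A'_def)
  have "h ` assemble A = (\<Union>B\<in>P. e (pi h B) ` A' (pi h B))" unfolding im using A'pi by simp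
  also have "\<dots> = (\<Union>B\<in>pi h ` P. e B ` A' B)" by simp
  also have "\<dots> = assemble A'" using permutes_image[OF pp] by (simp add: assemble_def)
  finally have "h ` assemble A = assemble A \<longleftrightarrow> assemble A' = assemble A" by simp
  also have "\<dots> \<longleftrightarrow> A' = A"
    using assemble_bij A A'PiE by (auto simp: bij_betw_def inj_on_def)
  also have "\<dots> \<longleftrightarrow> (\<forall>B\<in>P. A' B = A B)"
    using A A'PiE by (auto simp: PiE_def intro: extensionalityI)
  also have "\<dots> \<longleftrightarrow> (\<forall>B\<in>P. A' (pi h B) = A (pi h B))"
    using permutes_image[OF pp] by (metis imageE pi_in[OF h])
  also have "\<dots> \<longleftrightarrow> (\<forall>B\<in>P. xi h B ` A B = A (pi h B))" using A'pi by simp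
  finally show ?thesis .
qed

text \<open>The sign produced by permuting homogeneous wedge factors of degrees \<open>k B\<close>:
  exchanging factors of degrees k and l costs (-1)^(k l).\<close>

definition block_sign :: "(nat set \<Rightarrow> nat set) \<Rightarrow> (nat set \<Rightarrow> nat) \<Rightarrow> complex" where
  "block_sign \<pi> k = (\<Prod>E\<in>pairs P. inv_sign rk \<pi> E ^ (\<Prod>B\<in>E. k B))"

text \<open>\<open>rX\<close> compares points of different blocks through their blocks, so
  inversions across blocks depend on \<open>pi h\<close> only; inside a block B they are the
  inversions of \<open>xi h B\<close>.\<close>

lemma set_sign_assemble:
  assumes h: "h \<in> carrier H" and A: "A \<in> P \<rightarrow>\<^sub>E Pow Y"
  shows "set_sign rX h (assemble A) =
    (\<Prod>B\<in>P. set_sign id (xi h B) (A B)) * block_sign (pi h) (\<lambda>B. card (A B))"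
proof -
  have AY: "A B \<subseteq> Y" if "B \<in> P" for B using A that by auto
  have inside: "(\<Prod>E\<in>pairs (e B ` A B). inv_sign rX h E) = set_sign id (xi h B) (A B)" if B: "B \<in> P" for B
  proof -
    have inj: "inj_on (e B) (A B)" using AY[OF B] e_inj[OF B] by (auto simp: inj_on_def)
    have "(\<Prod>E\<in>pairs (e B ` A B). inv_sign rX h E) = (\<Prod>E\<in>pairs (A B). inv_sign rX h (e B ` E))"
      by (rule prod.reindex_bij_betw[OF bij_betw_pairs[OF inj], symmetric])
    also have "\<dots> = (\<Prod>E\<in>pairs (A B). inv_sign id (xi h B) E)"
    proof (rule prod.cong)
      fix E assume "E \<in> pairs (A B)"
      then obtain i j where ij: "E = {i, j}" "i \<in> A B" "j \<in> A B" "i \<noteq> j" by (rule pairsE)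
      then have lt: "i < a" "j < a" using AY[OF B] by auto
      have ne: "xi h B i \<noteq> xi h B j" using permutes_inj[OF xi_permutes[OF h B]] ij(4) by (auto dest: injD)
      have r1: "rX (e B i) = rk B * a + i" "rX (e B j) = rk B * a + j" using lt B by (simp_all add: rX_e)
      have r2: "rX (h (e B i)) = rk (pi h B) * a + xi h B i" "rX (h (e B j)) = rk (pi h B) * a + xi h B j"
        using lt B by (simp_all add: H_apply[OF h] rX_e pi_in[OF h] xi_less[OF h])
      show "inv_sign rX h (e B ` E) = inv_sign id (xi h B) E"
        unfolding ij(1) image_insert image_empty
        using ij(4) ne by (subst (1 2) inv_sign_pair) (auto simp: r1 r2)
    qed simp
    finally show ?thesis by (simp add: set_sign_def)
  qed
  have across: "inv_sign rX h {c, d} = inv_sign rk (pi h) {B, B'}"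
    if B: "B \<in> P" "B' \<in> P" "B \<noteq> B'" "c \<in> e B ` A B" "d \<in> e B' ` A B'" for B B' c d
  proof -
    obtain i j where ij: "i \<in> A B" "j \<in> A B'" "c = e B i" "d = e B' j" using B by auto
    then have lt: "i < a" "j < a" using AY B by auto
    have ne: "pi h B \<noteq> pi h B'" using permutes_inj[OF pi_permutes[OF h]] B(3) by (auto dest: injD)
    have rkne: "rk B \<noteq> rk B'" "rk (pi h B) \<noteq> rk (pi h B')"
      using rk B ne pi_in[OF h] by (auto dest: inj_onD)
    have hc: "h c = e (pi h B) (xi h B i)" "h d = e (pi h B') (xi h B' j)"
      using ij lt B H_apply[OF h] by auto
    have "c \<noteq> d" "h c \<noteq> h d"
      using hc ij lt B ne pi_in[OF h] xi_less[OF h] by (auto simp: e_eq_iff)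
    moreover have "c \<in> {1..n}" "d \<in> {1..n}" "h c \<in> {1..n}" "h d \<in> {1..n}"
      using hc ij lt B pi_in[OF h] xi_less[OF h] e_range by auto
    ultimately have rXne: "rX c \<noteq> rX d" "rX (h c) \<noteq> rX (h d)" using inj_rX by (auto dest: inj_onD)
    have "rX c < rX d \<longleftrightarrow> rk B < rk B'" using rX_less_iff[OF B(1,2) lt B(3)] ij by simp
    moreover have "rX (h c) < rX (h d) \<longleftrightarrow> rk (pi h B) < rk (pi h B')"
      unfolding hc using B lt ne by (intro rX_less_iff pi_in[OF h] xi_less[OF h])
    ultimately show ?thesis using rXne rkne by (subst (1 2) inv_sign_pair) auto
  qed
  have "set_sign rX h (assemble A) =
    (\<Prod>B\<in>P. \<Prod>E\<in>pairs (e B ` A B). inv_sign rX h E) *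
    (\<Prod>E\<in>pairs P. inv_sign rk (pi h) E ^ (\<Prod>B\<in>E. card (e B ` A B)))"
    unfolding set_sign_def assemble_def
    by (rule prod_pairs_UNION) (auto simp: finite_P finite_block_image[OF A] assemble_disjoint[OF A] intro: across)
  also have "(\<Prod>B\<in>P. \<Prod>E\<in>pairs (e B ` A B). inv_sign rX h E) = (\<Prod>B\<in>P. set_sign id (xi h B) (A B))"
    by (intro prod.cong refl inside)
  also have "(\<Prod>E\<in>pairs P. inv_sign rk (pi h) E ^ (\<Prod>B\<in>E. card (e B ` A B))) = block_sign (pi h) (\<lambda>B. card (A B))"
    unfolding block_sign_def
    by (intro prod.cong refl arg_cong2[of _ _ _ _ "(^)"]) (auto simp: pairs_def card_block_image[OF A])
  finally show ?thesis .
qed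

text \<open>Only parities of exponents matter: (t + 1)^2 has the parity of t + 1, t^2 that of t, and
  t (t + 1) is even. Pairs inside S thus carry one extra factor beyond the power t. Pairs across S
  may be given the power t as well, since by stability of S their product is 1.\<close>

lemma block_sign_shift:
  assumes \<pi>: "\<pi> permutes P" and S: "S \<subseteq> P" "\<pi> ` S = S"
  shows "block_sign \<pi> (\<lambda>B. if B \<in> S then Suc t else t) = set_sign rk \<pi> P ^ t * set_sign rk \<pi> S"
proof -
  let ?k = "\<lambda>B. if B \<in> S then Suc t else t" and ?G = "inv_sign rk \<pi>"
  have parity: "?G E ^ m = ?G E ^ m'" if "even m = even m'" for E m m'
  proof -
    have "?G E = 1 \<or> ?G E = - 1" by (simp add: inv_sign_def)
    then show ?thesis using that by (elim disjE) (simp_all add: minus_one_power_iff)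
  qed
  have fin: "finite S" "finite (P - S)" using finite_subset[OF S(1) finite_P] finite_P by simp_all
  have PS: "S \<union> (P - S) = P" using S by auto
  have 1: "(\<Prod>E\<in>pairs S. ?G E ^ (\<Prod>B\<in>E. ?k B)) = (\<Prod>E\<in>pairs S. ?G E) ^ t * (\<Prod>E\<in>pairs S. ?G E)"
  proof -
    have "?G E ^ (\<Prod>B\<in>E. ?k B) = ?G E ^ Suc t" if E: "E \<in> pairs S" for E
    proof -
      obtain B B' where "E = {B, B'}" "B \<in> S" "B' \<in> S" "B \<noteq> B'" by (rule pairsE[OF E])
      then show ?thesis by (intro parity) simp
    qed
    then have "(\<Prod>E\<in>pairs S. ?G E ^ (\<Prod>B\<in>E. ?k B)) = (\<Prod>E\<in>pairs S. ?G E ^ Suc t)"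
      by (intro prod.cong refl)
    also have "\<dots> = (\<Prod>E\<in>pairs S. ?G E) ^ Suc t" by (rule prod_power_distrib[symmetric])
    finally show ?thesis by simp
  qed
  have 2: "(\<Prod>E\<in>pairs (P - S). ?G E ^ (\<Prod>B\<in>E. ?k B)) = (\<Prod>E\<in>pairs (P - S). ?G E) ^ t"
  proof -
    have "?G E ^ (\<Prod>B\<in>E. ?k B) = ?G E ^ t" if E: "E \<in> pairs (P - S)" for E
    proof -
      obtain B B' where "E = {B, B'}" "B \<in> P - S" "B' \<in> P - S" "B \<noteq> B'" by (rule pairsE[OF E])
      then show ?thesis by (intro parity) simp
    qed
    then have "(\<Prod>E\<in>pairs (P - S). ?G E ^ (\<Prod>B\<in>E. ?k B)) = (\<Prod>E\<in>pairs (P - S). ?G E ^ t)"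
      by (intro prod.cong refl)
    also have "\<dots> = (\<Prod>E\<in>pairs (P - S). ?G E) ^ t" by (rule prod_power_distrib[symmetric])
    finally show ?thesis .
  qed
  have 3: "(\<Prod>c\<in>S. \<Prod>d\<in>P - S. ?G {c, d} ^ (\<Prod>B\<in>{c, d}. ?k B)) = 1"
  proof -
    have "?G {c, d} ^ (\<Prod>B\<in>{c, d}. ?k B) = ?G {c, d} ^ 0" if "c \<in> S" "d \<in> P - S" for c d
    proof (rule parity)
      have "c \<noteq> d" using that by auto
      then show "even (\<Prod>B\<in>{c, d}. ?k B) = even (0::nat)" using that by simp
    qed
    then have "?G {c, d} ^ (\<Prod>B\<in>{c, d}. ?k B) = 1" if "c \<in> S" "d \<in> P - S" for c d
      using that by (simp only: power_0)
    then show ?thesis by (intro prod.neutral ballI)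
  qed
  have "\<pi> ` (P - S) = P - S"
    using image_set_diff[OF permutes_inj[OF \<pi>], of P S] permutes_image[OF \<pi>] S(2) by simp
  then have 4: "(\<Prod>c\<in>S. \<Prod>d\<in>P - S. ?G {c, d}) = 1"
    using S fin by (intro prod_inv_sign_cross[OF rk \<pi>]) auto
  have "block_sign \<pi> ?k = (\<Prod>E\<in>pairs (S \<union> (P - S)). ?G E ^ (\<Prod>B\<in>E. ?k B))"
    unfolding PS block_sign_def ..
  also have "\<dots> = (\<Prod>E\<in>pairs S. ?G E) ^ t * (\<Prod>E\<in>pairs S. ?G E) * (\<Prod>E\<in>pairs (P - S). ?G E) ^ t"
    by (subst prod_pairs_Un[OF fin]) (blast, simp only: 1 2 3 mult_1_right)
  also have "\<dots> = (\<Prod>E\<in>pairs (S \<union> (P - S)). ?G E) ^ t * (\<Prod>E\<in>pairs S. ?G E)"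
    by (subst prod_pairs_Un[OF fin]) (blast, simp only: 4 power_mult_distrib power_one mult_1_right mult_1_left mult_ac)
  finally show ?thesis unfolding PS set_sign_def .
qed

end

section \<open>Irreducible characters of H built from pairs of hooks\<close>

context blocks
begin

abbreviation "dY t \<equiv> irr_dim (Sym_on Y) (hook Y id t)"
abbreviation "rhoY t \<equiv> irr_entry (Sym_on Y) (hook Y id t)"
abbreviation "IY t \<equiv> P \<rightarrow>\<^sub>E {..<dY t}"

lemma hookY_Irr: "t < a \<Longrightarrow> hook Y id t \<in> Irr (Sym_on Y)"
  by (rule hook_Irr) auto

lemma hookP_Irr: "s < card P \<Longrightarrow> hook P rk s \<in> Irr (Sym_on P)"
  by (rule hook_Irr[OF finite_P rk])

lemma hookY_eq_iff: "t < a \<Longrightarrow> t' < a \<Longrightarrow> hook Y id t = hook Y id t' \<longleftrightarrow> t = t'"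
  using hook_inj[of Y id] by (auto dest: inj_onD)

lemma hookP_eq_iff: "s < card P \<Longrightarrow> s' < card P \<Longrightarrow> hook P rk s = hook P rk s' \<longleftrightarrow> s = s'"
  using hook_inj[OF finite_P rk] by (auto dest: inj_onD)

lemma fin_group_SY: "fin_group (Sym_on Y)" and fin_group_SP: "fin_group (Sym_on P)"
  by (simp_all add: fin_group_Sym_on finite_P)

lemma prod_P_permute: "\<pi> permutes P \<Longrightarrow> (\<Prod>B\<in>P. f (\<pi> B)) = (\<Prod>B\<in>P. f B)" for f :: "_ \<Rightarrow> complex"
  by (rule prod.reindex_bij_betw[OF permutes_imp_bij])

lemma sum_PiE_permute:
  assumes \<pi>: "\<pi> permutes P"
  shows "(\<Sum>v\<in>P \<rightarrow>\<^sub>E S. F (\<lambda>B\<in>P. v (\<pi> B))) = (\<Sum>v\<in>P \<rightarrow>\<^sub>E S. F v)"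
proof -
  have \<pi>P: "\<pi> B \<in> P" "inv_into UNIV \<pi> B \<in> P" if "B \<in> P" for B
    using that permutes_in_image[OF \<pi>] permutes_in_image[OF permutes_inv[OF \<pi>]] by auto
  have "bij_betw (\<lambda>v. \<lambda>B\<in>P. v (\<pi> B)) (P \<rightarrow>\<^sub>E S) (P \<rightarrow>\<^sub>E S)"
  proof (rule bij_betw_byWitness[where f' = "\<lambda>v. \<lambda>B\<in>P. v (inv_into UNIV \<pi> B)"])
    show "\<forall>v\<in>P \<rightarrow>\<^sub>E S. (\<lambda>B\<in>P. (\<lambda>B\<in>P. v (\<pi> B)) (inv_into UNIV \<pi> B)) = v"
      using \<pi>P permutes_inverses[OF \<pi>] by (auto simp: fun_eq_iff PiE_def extensional_def)
    show "\<forall>v\<in>P \<rightarrow>\<^sub>E S. (\<lambda>B\<in>P. (\<lambda>B\<in>P. v (inv_into UNIV \<pi> B)) (\<pi> B)) = v"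
      using \<pi>P permutes_inverses[OF \<pi>] by (auto simp: fun_eq_iff PiE_def extensional_def)
    show "(\<lambda>v. \<lambda>B\<in>P. v (\<pi> B)) ` (P \<rightarrow>\<^sub>E S) \<subseteq> P \<rightarrow>\<^sub>E S" using \<pi>P by auto
    show "(\<lambda>v. \<lambda>B\<in>P. v (inv_into UNIV \<pi> B)) ` (P \<rightarrow>\<^sub>E S) \<subseteq> P \<rightarrow>\<^sub>E S" using \<pi>P by auto
  qed
  then show ?thesis by (rule sum.reindex_bij_betw)
qed

lemma prod_sum_P:
  "(\<And>B. B \<in> P \<Longrightarrow> finite (S B)) \<Longrightarrow>
    (\<Prod>B\<in>P. \<Sum>y\<in>S B. f B y) = (\<Sum>g\<in>Pi\<^sub>E P S. \<Prod>B\<in>P. f B (g B))" for f :: "_ \<Rightarrow> _ \<Rightarrow> complex"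
  by (rule prod_sum_PiE[OF finite_P]) simp

text \<open>The extension to \<open>H\<close> of the outer tensor power of the \<open>t\<close>-th hook representation.\<close>

definition ten :: "nat \<Rightarrow> (nat \<Rightarrow> nat) \<Rightarrow> (nat set \<Rightarrow> nat) \<Rightarrow> (nat set \<Rightarrow> nat) \<Rightarrow> complex" where
  "ten t h u v = (\<Prod>B\<in>P. rhoY t (xi h B) (u (pi h B)) (v B))"

lemma fun_rep_ten:
  assumes t: "t < a"
  shows "fun_rep H (IY t) (ten t)"
  unfolding fun_rep_def
proof (intro conjI ballI)
  note rep = irr_fun_rep[OF group_Sym_on hookY_Irr[OF t]]
  show "finite (IY t)" by (intro finite_PiE finite_P) simp
  fix g h u w assume gh: "g \<in> carrier H" "h \<in> carrier H" and uw: "u \<in> IY t" "w \<in> IY t"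
  have pin: "pi g (pi h B) \<in> P" if "B \<in> P" for B using gh pi_in that by blast
  have "ten t (g \<otimes>\<^bsub>H\<^esub> h) u w =
    (\<Prod>B\<in>P. \<Sum>k<dY t. rhoY t (xi g (pi h B)) (u (pi g (pi h B))) k * rhoY t (xi h B) k (w B))"
    unfolding ten_def H_mult
  proof (rule prod.cong)
    fix B assume B: "B \<in> P"
    have "rhoY t (xi g (pi h B) \<otimes>\<^bsub>Sym_on Y\<^esub> xi h B) (u (pi g (pi h B))) (w B) =
      (\<Sum>k<dY t. rhoY t (xi g (pi h B)) (u (pi g (pi h B))) k * rhoY t (xi h B) k (w B))"
      using B gh uw pin pi_in by (intro fun_rep_mult[OF rep]) (auto simp: xi_permutes)
    then show "rhoY t (xi (g \<circ> h) B) (u (pi (g \<circ> h) B)) (w B) =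
      (\<Sum>k<dY t. rhoY t (xi g (pi h B)) (u (pi g (pi h B))) k * rhoY t (xi h B) k (w B))"
      by (simp add: xi_comp[OF gh B] pi_comp[OF gh])
  qed simp
  also have "\<dots> = (\<Sum>v\<in>IY t. \<Prod>B\<in>P. rhoY t (xi g (pi h B)) (u (pi g (pi h B))) (v B) * rhoY t (xi h B) (v B) (w B))"
    by (rule prod_sum_P) simp
  \<comment> \<open>Reindexing the intermediate families by \<open>pi h\<close> makes the row index
    of the second factor \<open>v (pi h B)\<close>, as \<open>ten\<close> requires.\<close>
  also have "\<dots> = (\<Sum>v\<in>IY t. \<Prod>B\<in>P. rhoY t (xi g (pi h B)) (u (pi g (pi h B))) ((\<lambda>B\<in>P. v (pi h B)) B) *
      rhoY t (xi h B) ((\<lambda>B\<in>P. v (pi h B)) B) (w B))"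
    by (rule sum_PiE_permute[OF pi_permutes[OF gh(2)], symmetric])
  also have "\<dots> = (\<Sum>v\<in>IY t. ten t g u v * ten t h v w)"
  proof (rule sum.cong)
    fix v
    have "(\<Prod>B\<in>P. rhoY t (xi g (pi h B)) (u (pi g (pi h B))) (v (pi h B))) = ten t g u v"
      unfolding ten_def
      by (rule prod_P_permute[OF pi_permutes[OF gh(2)], of "\<lambda>B. rhoY t (xi g B) (u (pi g B)) (v B)"])
    then show "(\<Prod>B\<in>P. rhoY t (xi g (pi h B)) (u (pi g (pi h B))) ((\<lambda>B\<in>P. v (pi h B)) B) *
      rhoY t (xi h B) ((\<lambda>B\<in>P. v (pi h B)) B) (w B)) = ten t g u v * ten t h v w"
      by (simp add: prod.distrib) (simp add: ten_def)
  qed simp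
  finally show "ten t (g \<otimes>\<^bsub>H\<^esub> h) u w = (\<Sum>v\<in>IY t. ten t g u v * ten t h v w)" .
next
  note rep = irr_fun_rep[OF group_Sym_on hookY_Irr[OF t]]
  fix u v assume uv: "u \<in> IY t" "v \<in> IY t"
  have "ten t \<one>\<^bsub>H\<^esub> u v = (\<Prod>B\<in>P. if u B = v B then 1 else 0)"
    unfolding ten_def
  proof (rule prod.cong)
    fix B assume B: "B \<in> P"
    have "rhoY t \<one>\<^bsub>Sym_on Y\<^esub> (u B) (v B) = (if u B = v B then 1 else 0)"
      using uv B by (intro fun_rep_one[OF rep]) auto
    then show "rhoY t (xi \<one>\<^bsub>H\<^esub> B) (u (pi \<one>\<^bsub>H\<^esub> B)) (v B) = (if u B = v B then 1 else 0)"
      by (simp add: xi_id[OF B] pi_id)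
  qed simp
  also have "\<dots> = (if u = v then 1 else 0)"
  proof (cases "u = v")
    case False
    then obtain B where "B \<in> P" "u B \<noteq> v B" using uv by (metis PiE_ext)
    then have "(\<Prod>B\<in>P. if u B = v B then 1 else 0 :: complex) = 0"
      using finite_P by (intro prod_zero) auto
    then show ?thesis using False by simp
  qed simp
  finally show "ten t \<one>\<^bsub>H\<^esub> u v = (if u = v then 1 else 0)" .
qed

text \<open>The trace of \<open>ten t\<close>, and in \<open>tr2\<close> that of its value at the
  inverse, as functions of the wreath coordinates, so that \<open>sum_H\<close> applies.\<close>

definition tr1 :: "nat \<Rightarrow> (nat set \<Rightarrow> nat set) \<Rightarrow> (nat set \<Rightarrow> nat \<Rightarrow> nat) \<Rightarrow> complex" where
  "tr1 t \<pi> x = (\<Sum>u\<in>IY t. \<Prod>B\<in>P. rhoY t (x B) (u (\<pi> B)) (u B))"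

definition tr2 :: "nat \<Rightarrow> (nat set \<Rightarrow> nat set) \<Rightarrow> (nat set \<Rightarrow> nat \<Rightarrow> nat) \<Rightarrow> complex" where
  "tr2 t \<pi> x = (\<Sum>v\<in>IY t. \<Prod>B\<in>P. rhoY t (inv_into UNIV (x B)) (v B) (v (\<pi> B)))"

lemma trace_ten: "(\<Sum>u\<in>IY t. ten t h u u) = tr1 t (pi h) (\<lambda>B\<in>P. xi h B)"
  by (simp add: ten_def tr1_def)

lemma trace_ten_inv:
  assumes h: "h \<in> carrier H"
  shows "(\<Sum>u\<in>IY t. ten t (inv\<^bsub>H\<^esub> h) u u) = tr2 t (pi h) (\<lambda>B\<in>P. xi h B)"
  unfolding tr2_def
proof (rule sum.cong)
  fix v
  have "ten t (inv\<^bsub>H\<^esub> h) v v =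
    (\<Prod>B\<in>P. rhoY t (xi (inv\<^bsub>H\<^esub> h) (pi h B)) (v (pi (inv\<^bsub>H\<^esub> h) (pi h B))) (v (pi h B)))"
    unfolding ten_def by (rule prod_P_permute[OF pi_permutes[OF h], symmetric])
  also have "\<dots> = (\<Prod>B\<in>P. rhoY t (inv_into UNIV ((\<lambda>B\<in>P. xi h B) B)) (v B) (v (pi h B)))"
    using permutes_inverses(2)[OF pi_permutes[OF h]]
    by (intro prod.cong refl) (simp add: xi_inv[OF h] pi_inv[OF h])
  finally show "ten t (inv\<^bsub>H\<^esub> h) v v = (\<Prod>B\<in>P. rhoY t (inv_into UNIV ((\<lambda>B\<in>P. xi h B) B)) (v B) (v (pi h B)))" .
qed simp

text \<open>Exchanging two blocks exchanges two wedge products of degree \<open>t\<close>, which costs the sign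
  \<open>(- 1) ^ t\<close>; whence the twist by a power of the sign character of the group of block permutations.\<close>

definition beta :: "nat \<Rightarrow> nat \<Rightarrow> (nat set \<Rightarrow> nat set) \<Rightarrow> complex" where
  "beta t s \<pi> = set_sign rk \<pi> P ^ t * hook P rk s \<pi>"

definition psi :: "nat \<Rightarrow> nat \<Rightarrow> (nat \<Rightarrow> nat) \<Rightarrow> complex" where
  "psi t s = (\<lambda>h\<in>carrier H. tr1 t (pi h) (\<lambda>B\<in>P. xi h B) * beta t s (pi h))"

text \<open>\<open>psi t s\<close> belongs to the tensor product of \<open>ten t\<close> with the
  s-th hook representation of the group of block permutations, pulled back along \<open>pi\<close>
  and twisted by the t-th power of the sign.\<close>

lemma genuine_psi:
  assumes t: "t < a" and s: "s < card P"
  shows "genuine_char H (psi t s)"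
proof -
  let ?d = "irr_dim (Sym_on P) (hook P rk s)" and ?e = "irr_entry (Sym_on P) (hook P rk s)"
  define \<sigma> where "\<sigma> h i j = set_sign rk (pi h) P ^ t * ?e (pi h) i j" for h i j
  note rep = irr_fun_rep[OF group_Sym_on hookP_Irr[OF s]]
  have rep\<sigma>: "fun_rep H {..<?d} \<sigma>"
    unfolding fun_rep_def
  proof (intro conjI ballI)
    fix g h i j assume gh: "g \<in> carrier H" "h \<in> carrier H" and ij: "i \<in> {..<?d}" "j \<in> {..<?d}"
    have "set_sign rk (pi g \<circ> pi h) P = set_sign rk (pi g) P * set_sign rk (pi h) P"
      using set_sign_comp[OF rk pi_permutes[OF gh(1)] pi_permutes[OF gh(2)] order_refl]
        permutes_image[OF pi_permutes[OF gh(2)]] by simp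
    moreover have "?e (pi g \<otimes>\<^bsub>Sym_on P\<^esub> pi h) i j = (\<Sum>k<?d. ?e (pi g) i k * ?e (pi h) k j)"
      using gh ij by (intro fun_rep_mult[OF rep]) (auto simp: pi_permutes)
    ultimately show "\<sigma> (g \<otimes>\<^bsub>H\<^esub> h) i j = (\<Sum>k<?d. \<sigma> g i k * \<sigma> h k j)"
      by (simp add: \<sigma>_def pi_comp[OF gh] power_mult_distrib sum_distrib_left mult_ac)
  next
    fix i j assume ij: "i \<in> {..<?d}" "j \<in> {..<?d}"
    then have "?e \<one>\<^bsub>Sym_on P\<^esub> i j = (if i = j then 1 else 0)" by (rule fun_rep_one[OF rep])
    then show "\<sigma> \<one>\<^bsub>H\<^esub> i j = (if i = j then 1 else 0)" by (simp add: \<sigma>_def pi_id set_sign_fix)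
  qed simp
  have "psi t s = (\<lambda>h\<in>carrier H. fun_char H (IY t) (ten t) h * fun_char H {..<?d} \<sigma> h)"
  proof (unfold psi_def, rule restrict_ext)
    fix h assume h: "h \<in> carrier H"
    have "hook P rk s (pi h) = (\<Sum>i<?d. ?e (pi h) i i)"
      using h by (intro irr_char_sum[OF hookP_Irr[OF s]]) (simp add: pi_permutes)
    then show "tr1 t (pi h) (\<lambda>B\<in>P. xi h B) * beta t s (pi h) =
      fun_char H (IY t) (ten t) h * fun_char H {..<?d} \<sigma> h"
      using h by (simp add: fun_char_def trace_ten \<sigma>_def beta_def sum_distrib_left)
  qed
  then show ?thesis
    using genuine_charI[OF group_partition_stabilizer fun_rep_prod(1)[OF fun_rep_ten[OF t] rep\<sigma>]]
    by (simp add: fun_rep_prod(2)[OF fun_rep_ten[OF t] rep\<sigma>])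
qed

lemma psi_inv:
  assumes h: "h \<in> carrier H"
  shows "psi t s (inv\<^bsub>H\<^esub> h) = tr2 t (pi h) (\<lambda>B\<in>P. xi h B) * beta t s (inv_into UNIV (pi h))"
  using H.inv_closed[OF h] trace_ten_inv[OF h, of t] trace_ten[of t "inv\<^bsub>H\<^esub> h"]
  by (simp add: psi_def pi_inv[OF h])

lemma finite_SY: "finite SY"
  by (rule finite_permutations) simp

lemma card_SY_pos: "card SY > 0"
  using finite_SY permutes_id[of Y] unfolding card_gt_0_iff by blast

text \<open>For a fixed block permutation the sum factors into one orthogonality relation per block.
  Together they force t = t' and u = v, and the number of families u cancels the
  denominators.\<close>

lemma sum_tr1_tr2:
  assumes t: "t < a" "t' < a" and \<pi>: "\<pi> permutes P"
  shows "(\<Sum>x\<in>P \<rightarrow>\<^sub>E SY. tr1 t \<pi> x * tr2 t' \<pi> x) = (if t = t' then of_nat (card SY) ^ card P else 0)"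
proof -
  interpret Y: fin_group "Sym_on Y" by (rule fin_group_SY)
  let ?c = "of_nat (card SY) :: complex"
  have \<pi>P: "\<pi> B \<in> P" if "B \<in> P" for B using that permutes_in_image[OF \<pi>] by simp
  have "(\<Sum>x\<in>P \<rightarrow>\<^sub>E SY. tr1 t \<pi> x * tr2 t' \<pi> x) = (\<Sum>x\<in>P \<rightarrow>\<^sub>E SY. \<Sum>u\<in>IY t. \<Sum>v\<in>IY t'. \<Prod>B\<in>P.
      rhoY t (x B) (u (\<pi> B)) (u B) * rhoY t' (inv_into UNIV (x B)) (v B) (v (\<pi> B)))"
    unfolding tr1_def tr2_def sum_product prod.distrib ..
  also have "\<dots> = (\<Sum>u\<in>IY t. \<Sum>v\<in>IY t'. \<Sum>x\<in>P \<rightarrow>\<^sub>E SY. \<Prod>B\<in>P.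
      rhoY t (x B) (u (\<pi> B)) (u B) * rhoY t' (inv_into UNIV (x B)) (v B) (v (\<pi> B)))"
    by (rule sum_rotate)
  also have "\<dots> = (\<Sum>u\<in>IY t. \<Sum>v\<in>IY t'. \<Prod>B\<in>P. \<Sum>y\<in>SY.
      rhoY t y (u (\<pi> B)) (u B) * rhoY t' (inv_into UNIV y) (v B) (v (\<pi> B)))"
    by (intro sum.cong refl prod_sum_P[symmetric] finite_SY)
  also have "\<dots> = (\<Sum>u\<in>IY t. \<Sum>v\<in>IY t'. \<Prod>B\<in>P.
      if t = t' \<and> u (\<pi> B) = v (\<pi> B) \<and> u B = v B then ?c / of_nat (dY t) else 0)"
  proof (intro sum.cong prod.cong refl)
    fix u v B assume uv: "u \<in> IY t" "v \<in> IY t'" and B: "B \<in> P"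
    have "(\<Sum>y\<in>SY. rhoY t y (u (\<pi> B)) (u B) * rhoY t' (inv_into UNIV y) (v B) (v (\<pi> B))) =
      (\<Sum>y\<in>carrier (Sym_on Y). rhoY t y (u (\<pi> B)) (u B) * rhoY t' (inv\<^bsub>Sym_on Y\<^esub> y) (v B) (v (\<pi> B)))"
      by (intro sum.cong) (auto simp: inv_Sym_on)
    also have "\<dots> = (if hook Y id t = hook Y id t' \<and> u (\<pi> B) = v (\<pi> B) \<and> u B = v B
        then of_nat (card (carrier (Sym_on Y))) / of_nat (dY t) else 0)"
      using uv B \<pi>P by (intro Y.irr_entry_orthogonality hookY_Irr t) auto
    finally show "(\<Sum>y\<in>SY. rhoY t y (u (\<pi> B)) (u B) * rhoY t' (inv_into UNIV y) (v B) (v (\<pi> B))) =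
      (if t = t' \<and> u (\<pi> B) = v (\<pi> B) \<and> u B = v B then ?c / of_nat (dY t) else 0)"
      by (simp add: hookY_eq_iff[OF t])
  qed
  also have "\<dots> = (if t = t' then ?c ^ card P else 0)"
  proof (cases "t = t'")
    case False
    then show ?thesis using P_ne finite_P by (simp add: card_gt_0_iff power_0_left)
  next
    case True
    have "(\<Prod>B\<in>P. if t = t' \<and> u (\<pi> B) = v (\<pi> B) \<and> u B = v B then ?c / of_nat (dY t) else 0) =
      (if u = v then (?c / of_nat (dY t)) ^ card P else 0)" if uv: "u \<in> IY t" "v \<in> IY t'" for u v
    proof (cases "u = v")
      case False
      then obtain B where "B \<in> P" "u B \<noteq> v B" using uv True by (metis PiE_ext)
      then have "(\<Prod>B\<in>P. if t = t' \<and> u (\<pi> B) = v (\<pi> B) \<and> u B = v B then ?c / of_nat (dY t) else 0) = 0"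
        using finite_P by (intro prod_zero) auto
      then show ?thesis using False by simp
    qed (simp add: True)
    then have "(\<Sum>u\<in>IY t. \<Sum>v\<in>IY t'. \<Prod>B\<in>P.
        if t = t' \<and> u (\<pi> B) = v (\<pi> B) \<and> u B = v B then ?c / of_nat (dY t) else 0) =
      (\<Sum>u\<in>IY t. \<Sum>v\<in>IY t. if u = v then (?c / of_nat (dY t)) ^ card P else 0)"
      using True by simp
    also have "\<dots> = of_nat (card (IY t)) * (?c / of_nat (dY t)) ^ card P"
      by (simp add: finite_PiE finite_P)
    also have "\<dots> = ?c ^ card P"
      using irr_dim_pos[OF hookY_Irr[OF t(1)]] by (simp add: card_PiE finite_P power_divide)
    finally show ?thesis using True by simp
  qed
  finally show ?thesis .
qed

lemma beta_inv:
  assumes \<pi>: "\<pi> permutes P"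
  shows "beta t s (inv_into UNIV \<pi>) = set_sign rk \<pi> P ^ t * hook P rk s (inv\<^bsub>Sym_on P\<^esub> \<pi>)"
  using set_sign_inv[OF rk \<pi> order_refl permutes_image[OF \<pi>]] by (simp add: beta_def inv_Sym_on[OF \<pi>])

lemma set_sign_power_square: "set_sign r g A ^ t * set_sign r g A ^ t = 1"
  by (simp flip: power_mult_distrib)

lemma cip_psi_sum:
  "cip H f (psi t s) = (\<Sum>h\<in>carrier H. f h * (tr2 t (pi h) (\<lambda>B\<in>P. xi h B) * beta t s (inv_into UNIV (pi h)))) /
    (of_nat (card SP) * of_nat (card SY) ^ card P)"
  by (simp add: cip_def psi_inv card_H cong: sum.cong)

text \<open>Summing over the local permutations first leaves only t = t'. The sign powers then
  square to 1, and what remains is the inner product of two hooks of the group of block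
  permutations.\<close>

lemma cip_psi:
  assumes t: "t < a" "t' < a" and s: "s < card P" "s' < card P"
  shows "cip H (psi t s) (psi t' s') = (if t = t' \<and> s = s' then 1 else 0)"
proof -
  interpret SP: fin_group "Sym_on P" by (rule fin_group_SP)
  let ?c = "of_nat (card SY) :: complex"
  have "(\<Sum>h\<in>carrier H. psi t s h * (tr2 t' (pi h) (\<lambda>B\<in>P. xi h B) * beta t' s' (inv_into UNIV (pi h)))) =
    (\<Sum>h\<in>carrier H. (tr1 t (pi h) (\<lambda>B\<in>P. xi h B) * tr2 t' (pi h) (\<lambda>B\<in>P. xi h B)) *
      (beta t s (pi h) * beta t' s' (inv_into UNIV (pi h))))"
    by (intro sum.cong refl) (simp add: psi_def mult_ac)
  also have "\<dots> = (\<Sum>\<pi>\<in>SP. \<Sum>x\<in>P \<rightarrow>\<^sub>E SY. (tr1 t \<pi> x * tr2 t' \<pi> x) * (beta t s \<pi> * beta t' s' (inv_into UNIV \<pi>)))"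
    by (rule sum_H)
  also have "\<dots> = (\<Sum>\<pi>\<in>SP. (if t = t' then ?c ^ card P else 0) * (beta t s \<pi> * beta t' s' (inv_into UNIV \<pi>)))"
    by (intro sum.cong refl) (simp add: sum_distrib_right[symmetric] sum_tr1_tr2[OF t])
  finally have sum: "(\<Sum>h\<in>carrier H. psi t s h * (tr2 t' (pi h) (\<lambda>B\<in>P. xi h B) * beta t' s' (inv_into UNIV (pi h)))) =
    (\<Sum>\<pi>\<in>SP. (if t = t' then ?c ^ card P else 0) * (beta t s \<pi> * beta t' s' (inv_into UNIV \<pi>)))" .
  show ?thesis
  proof (cases "t = t'")
    case False
    then show ?thesis unfolding cip_psi_sum sum by simp
  next
    case True
    have "beta t s \<pi> * beta t' s' (inv_into UNIV \<pi>) = hook P rk s \<pi> * hook P rk s' (inv\<^bsub>Sym_on P\<^esub> \<pi>)"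
      if "\<pi> \<in> SP" for \<pi>
    proof -
      have "beta t s \<pi> * beta t' s' (inv_into UNIV \<pi>) =
        (set_sign rk \<pi> P ^ t * set_sign rk \<pi> P ^ t) * (hook P rk s \<pi> * hook P rk s' (inv\<^bsub>Sym_on P\<^esub> \<pi>))"
        using that beta_inv[of \<pi> t' s'] True by (simp add: beta_def)
      then show ?thesis by (simp only: set_sign_power_square mult_1_left)
    qed
    then have "cip H (psi t s) (psi t' s') =
      (\<Sum>\<pi>\<in>SP. ?c ^ card P * (hook P rk s \<pi> * hook P rk s' (inv\<^bsub>Sym_on P\<^esub> \<pi>))) / (of_nat (card SP) * ?c ^ card P)"
      unfolding cip_psi_sum sum using True by simp
    also have "\<dots> = cip (Sym_on P) (hook P rk s) (hook P rk s')"
      using card_SY_pos by (simp add: cip_def sum_distrib_left[symmetric])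
    also have "\<dots> = (if s = s' then 1 else 0)"
      using SP.cip_Irr[OF hookP_Irr[OF s(1)] hookP_Irr[OF s(2)]] hookP_eq_iff[OF s] by simp
    finally show ?thesis using True by simp
  qed
qed

section \<open>Restricted exterior powers paired with the characters \<open>psi\<close>\<close>

definition lamH :: "nat \<Rightarrow> (nat set \<Rightarrow> nat set) \<Rightarrow> (nat set \<Rightarrow> nat \<Rightarrow> nat) \<Rightarrow> complex" where
  "lamH j \<pi> x = (\<Sum>A\<in>{A \<in> P \<rightarrow>\<^sub>E Pow Y. (\<Sum>B\<in>P. card (A B)) = j}.
     block_sign \<pi> (\<lambda>B. card (A B)) * (\<Prod>B\<in>P. lam_entry id (x B) (A (\<pi> B)) (A B)))"

text \<open>A j-subset corresponds to a family of subsets of the blocks with sizes adding up to j,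
  and \<open>set_sign_assemble\<close> splits its sign. Families not preserved by h contribute 0
  through one of the entries \<open>lam_entry\<close>.\<close>

lemma lam_on_H:
  assumes h: "h \<in> carrier H"
  shows "lam {1..n} rX j h = lamH j (pi h) (\<lambda>B\<in>P. xi h B)"
proof -
  let ?\<Omega> = "{A \<in> P \<rightarrow>\<^sub>E Pow Y. (\<Sum>B\<in>P. card (A B)) = j}"
  have hp: "h permutes {1..n}" using h by (simp add: H_carrier)
  have "assemble ` ?\<Omega> = jsubsets {1..n} j"
  proof (intro equalityI subsetI)
    fix S assume "S \<in> assemble ` ?\<Omega>"
    then obtain A where A: "A \<in> P \<rightarrow>\<^sub>E Pow Y" "(\<Sum>B\<in>P. card (A B)) = j" "S = assemble A" by blast
    then have "S \<in> Pow {1..n}" using assemble_bij by (auto simp: bij_betw_def)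
    then show "S \<in> jsubsets {1..n} j" using A card_assemble[OF A(1)] by (simp add: jsubsets_def)
  next
    fix S assume S: "S \<in> jsubsets {1..n} j"
    then have "S \<in> Pow {1..n}" by (simp add: jsubsets_def)
    then obtain A where A: "A \<in> P \<rightarrow>\<^sub>E Pow Y" "S = assemble A"
      using assemble_bij by (metis bij_betw_imp_surj_on imageE)
    then show "S \<in> assemble ` ?\<Omega>" using S card_assemble[OF A(1)] by (auto simp: jsubsets_def)
  qed
  then have bij: "bij_betw assemble ?\<Omega> (jsubsets {1..n} j)"
    using assemble_bij by (auto simp: bij_betw_def intro: inj_on_subset)
  have "lam {1..n} rX j h = (\<Sum>A\<in>?\<Omega>. if h ` assemble A = assemble A then set_sign rX h (assemble A) else 0)"
    unfolding lam_eq[OF hp] by (rule sum.reindex_bij_betw[OF bij, symmetric])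
  also have "\<dots> = lamH j (pi h) (\<lambda>B\<in>P. xi h B)"
    unfolding lamH_def
  proof (rule sum.cong)
    fix A assume "A \<in> ?\<Omega>"
    then have A: "A \<in> P \<rightarrow>\<^sub>E Pow Y" by simp
    show "(if h ` assemble A = assemble A then set_sign rX h (assemble A) else 0) =
      block_sign (pi h) (\<lambda>B. card (A B)) * (\<Prod>B\<in>P. lam_entry id ((\<lambda>B\<in>P. xi h B) B) (A (pi h B)) (A B))"
    proof (cases "\<forall>B\<in>P. xi h B ` A B = A (pi h B)")
      case True
      then show ?thesis
        using H_image_assemble[OF h A] set_sign_assemble[OF h A] by (simp add: lam_entry_def mult.commute)
    next
      case False
      then obtain B where "B \<in> P" "xi h B ` A B \<noteq> A (pi h B)" by blast
      then have "(\<Prod>B\<in>P. lam_entry id ((\<lambda>B\<in>P. xi h B) B) (A (pi h B)) (A B)) = 0"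
        using finite_P by (intro prod_zero) (auto simp: lam_entry_def)
      moreover have "h ` assemble A \<noteq> assemble A" using False H_image_assemble[OF h A] by blast
      ultimately show ?thesis by simp
    qed
  qed simp
  finally show ?thesis .
qed

text \<open>Averaging the i-th exterior power of one block against hook t gives as many rank-one
  terms as hook t has multiplicity there: one for i = t and i = t + 1, none otherwise. Sets of
  different sizes give 0 because permutations preserve cardinality.\<close>

lemma block_kernel:
  assumes t: "t < a"
  obtains PP :: "nat set \<Rightarrow> nat \<Rightarrow> complex" and QQ :: "nat \<Rightarrow> nat set \<Rightarrow> complex" where
    "\<And>A' A v v'. A' \<subseteq> Y \<Longrightarrow> A \<subseteq> Y \<Longrightarrow> v < dY t \<Longrightarrow> v' < dY t \<Longrightarrow>
      (\<Sum>y\<in>SY. lam_entry id y A' A * rhoY t (inv_into UNIV y) v v') =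
      (if card A = card A' \<and> (card A = t \<or> card A = Suc t)
       then of_nat (card SY) / of_nat (dY t) * (PP A' v' * QQ v A) else 0)"
    "\<And>i. i = t \<or> i = Suc t \<Longrightarrow> (\<Sum>A\<in>jsubsets Y i. \<Sum>v<dY t. PP A v * QQ v A) = of_nat (dY t)"
proof -
  interpret Y: fin_group "Sym_on Y" by (rule fin_group_SY)
  let ?c = "of_nat (card SY) / of_nat (dY t) :: complex"
  note irr = hookY_Irr[OF t]
  \<comment> \<open>The claim for one fixed degree i, since \<open>isotypic_factorization\<close> is
    applied to each exterior power separately.\<close>
  define R where "R i PP QQ \<longleftrightarrow> (\<forall>A'\<in>jsubsets Y i. \<forall>A\<in>jsubsets Y i. \<forall>v<dY t. \<forall>v'<dY t.
      (\<Sum>y\<in>SY. lam_entry id y A' A * rhoY t (inv_into UNIV y) v v') =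
      (if i = t \<or> i = Suc t then ?c * (PP A' v' * QQ v A) else 0)) \<and>
      (i = t \<or> i = Suc t \<longrightarrow> (\<Sum>A\<in>jsubsets Y i. \<Sum>v<dY t. PP A v * QQ v A) = of_nat (dY t))"
    for i and PP :: "nat set \<Rightarrow> nat \<Rightarrow> complex" and QQ :: "nat \<Rightarrow> nat set \<Rightarrow> complex"
  have "\<exists>PP QQ. R i PP QQ" if i: "i \<le> a" for i
  proof -
    obtain r and PP :: "nat \<Rightarrow> nat set \<Rightarrow> nat \<Rightarrow> complex" and QQ where
      mult: "cip (Sym_on Y) (fun_char (Sym_on Y) (jsubsets Y i) (lam_entry id)) (hook Y id t) = of_nat r" and
      PQ: "\<And>A' A u v. A' \<in> jsubsets Y i \<Longrightarrow> A \<in> jsubsets Y i \<Longrightarrow> u < dY t \<Longrightarrow> v < dY t \<Longrightarrow>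
        (\<Sum>x\<in>carrier (Sym_on Y). lam_entry id x A' A * rhoY t (inv\<^bsub>Sym_on Y\<^esub> x) u v) =
        of_nat (card (carrier (Sym_on Y))) / of_nat (dY t) * (\<Sum>w<r. PP w A' v * QQ w u A)" and
      QP: "\<And>w w' u v. w < r \<Longrightarrow> w' < r \<Longrightarrow> u < dY t \<Longrightarrow> v < dY t \<Longrightarrow>
        (\<Sum>A\<in>jsubsets Y i. QQ w u A * PP w' A v) = (if u = v \<and> w = w' then 1 else 0)"
      by (rule Y.isotypic_factorization[OF fun_rep_lam[of Y id i] irr]) (simp_all, blast)
    have "of_nat r = cip (Sym_on Y) (lam Y id i) (hook Y id t)" using mult by (simp add: lam_def)
    also have "\<dots> = (if i = t \<or> i = Suc t then of_nat 1 else of_nat 0)"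
      using t i by (subst cip_lam_hook) auto
    finally have r: "r = (if i = t \<or> i = Suc t then 1 else 0)" by (simp split: if_splits)
    have eq: "(\<Sum>y\<in>SY. lam_entry id y A' A * rhoY t (inv_into UNIV y) v v') = ?c * (\<Sum>w<r. PP w A' v' * QQ w v A)"
      if "A' \<in> jsubsets Y i" "A \<in> jsubsets Y i" "v < dY t" "v' < dY t" for A' A v v'
    proof -
      have "(\<Sum>y\<in>SY. lam_entry id y A' A * rhoY t (inv_into UNIV y) v v') =
        (\<Sum>x\<in>carrier (Sym_on Y). lam_entry id x A' A * rhoY t (inv\<^bsub>Sym_on Y\<^esub> x) v v')"
        by (intro sum.cong) (auto simp: inv_Sym_on)
      then show ?thesis using PQ[OF that] by simp
    qed
    have eq': "(\<Sum>y\<in>SY. lam_entry id y A' A * rhoY t (inv_into UNIV y) v v') =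
        (if i = t \<or> i = Suc t then ?c * (PP 0 A' v' * QQ 0 v A) else 0)"
      if "A' \<in> jsubsets Y i" "A \<in> jsubsets Y i" "v < dY t" "v' < dY t" for A' A v v'
    proof -
      have "(\<Sum>w<r. PP w A' v' * QQ w v A) = (if i = t \<or> i = Suc t then PP 0 A' v' * QQ 0 v A else 0)"
        using r by simp
      then show ?thesis unfolding eq[OF that] by simp
    qed
    have tr: "(\<Sum>A\<in>jsubsets Y i. \<Sum>v<dY t. PP 0 A v * QQ 0 v A) = of_nat (dY t)" if "i = t \<or> i = Suc t"
    proof -
      have "(\<Sum>A\<in>jsubsets Y i. \<Sum>v<dY t. PP 0 A v * QQ 0 v A) = (\<Sum>v<dY t. \<Sum>A\<in>jsubsets Y i. QQ 0 v A * PP 0 A v)"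
        by (subst sum.swap) (simp add: mult.commute)
      also have "\<dots> = (\<Sum>v<dY t. 1)" using QP[of 0 0] r that by (intro sum.cong) auto
      finally show ?thesis by simp
    qed
    show ?thesis unfolding R_def
      by (intro exI[of _ "PP 0"] exI[of _ "QQ 0"] conjI ballI allI impI) (fact eq' tr)+
  qed
  then have "\<forall>i. \<exists>PP QQ. i \<le> a \<longrightarrow> R i PP QQ" by blast
  then obtain PP QQ where "\<And>i. i \<le> a \<Longrightarrow> R i (PP i) (QQ i)" by metis
  note PPQQ = this[unfolded R_def]
  show thesis
  \<comment> \<open>The rank-one data depend on the degree; the cardinality of the set selects them,
    so one pair of functions serves all subsets.\<close>
  proof (rule that[of "\<lambda>A v. PP (card A) A v" "\<lambda>v A. QQ (card A) v A"])
    fix A' A v v' assume A: "A' \<subseteq> Y" "A \<subseteq> Y" and v: "v < dY t" "v' < dY t"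
    show "(\<Sum>y\<in>SY. lam_entry id y A' A * rhoY t (inv_into UNIV y) v v') =
      (if card A = card A' \<and> (card A = t \<or> card A = Suc t)
       then ?c * (PP (card A') A' v' * QQ (card A) v A) else 0)"
    proof (cases "card A = card A'")
      case True
      have "card A \<le> a" using card_mono[OF _ A(2)] by simp
      then show ?thesis using PPQQ[of "card A"] A v True by (simp add: jsubsets_def)
    next
      case False
      have "lam_entry id y A' A = 0" if "y \<in> SY" for y
        using False card_image[OF inj_on_subset[OF permutes_inj[of y Y] subset_UNIV], of A] that
        by (auto simp: lam_entry_def)
      then show ?thesis using False by simp
    qed
  next
    fix i assume i: "i = t \<or> i = Suc t"
    have "(\<Sum>A\<in>jsubsets Y i. \<Sum>v<dY t. PP (card A) A v * QQ (card A) v A) =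
      (\<Sum>A\<in>jsubsets Y i. \<Sum>v<dY t. PP i A v * QQ i v A)"
      by (intro sum.cong refl) (auto simp: jsubsets_def)
    then show "(\<Sum>A\<in>jsubsets Y i. \<Sum>v<dY t. PP (card A) A v * QQ (card A) v A) = of_nat (dY t)"
      using PPQQ[of i] i t by auto
  qed
qed

lemma sum_P_indicator: "(\<Sum>B\<in>P. t + (if Q B then 1 else 0)) = card P * t + card {B \<in> P. Q B}"
proof -
  have "(\<Sum>B\<in>P. if Q B then 1 else 0) = (\<Sum>B\<in>{B \<in> P. Q B}. 1::nat)"
    by (rule sum.inter_filter[OF finite_P, symmetric])
  then show ?thesis by (simp add: sum.distrib)
qed

text \<open>By \<open>block_kernel\<close> a family survives only if all its members have t or t + 1
  elements and the size is constant along \<pi>. It is governed by the \<pi>-stable set S of blocks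
  with t + 1 elements, where card P * t + card S = j. Its sign is given by
  \<open>block_sign_shift\<close>, the kernels contribute their traces, and the sum over S is an
  exterior power character on the set of blocks.\<close>

lemma sum_lamH_tr2:
  assumes t: "t < a" and \<pi>: "\<pi> permutes P"
  shows "(\<Sum>x\<in>P \<rightarrow>\<^sub>E SY. lamH j \<pi> x * tr2 t \<pi> x) =
    of_nat (card SY) ^ card P *
      (if card P * t \<le> j then set_sign rk \<pi> P ^ t * lam P rk (j - card P * t) \<pi> else 0)"
proof -
  let ?c = "of_nat (card SY) :: complex" and ?d = "of_nat (dY t) :: complex"
  let ?\<Omega> = "{A \<in> P \<rightarrow>\<^sub>E Pow Y. (\<Sum>B\<in>P. card (A B)) = j}"
  have d0: "?d \<noteq> 0" using irr_dim_pos[OF hookY_Irr[OF t]] by simp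
  have \<pi>P: "\<pi> B \<in> P" if "B \<in> P" for B using that permutes_in_image[OF \<pi>] by simp
  have fin\<Omega>: "finite ?\<Omega>" by (rule finite_subset[of _ "P \<rightarrow>\<^sub>E Pow Y"]) (auto intro!: finite_PiE finite_P)
  obtain PP QQ where K: "\<And>A' A v v'. A' \<subseteq> Y \<Longrightarrow> A \<subseteq> Y \<Longrightarrow> v < dY t \<Longrightarrow> v' < dY t \<Longrightarrow>
      (\<Sum>y\<in>SY. lam_entry id y A' A * rhoY t (inv_into UNIV y) v v') =
      (if card A = card A' \<and> (card A = t \<or> card A = Suc t) then ?c / ?d * (PP A' v' * QQ v A) else 0)"
    and trPQ: "\<And>i. i = t \<or> i = Suc t \<Longrightarrow> (\<Sum>A\<in>jsubsets Y i. \<Sum>v<dY t. PP A v * QQ v A) = ?d"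
    by (rule block_kernel[OF t]) blast
  define bs where "bs A = block_sign \<pi> (\<lambda>B. card (A B))" for A :: "nat set \<Rightarrow> nat set"
  define good where "good A \<longleftrightarrow> (\<forall>B\<in>P. card (A B) = card (A (\<pi> B)) \<and> (card (A B) = t \<or> card (A B) = Suc t))"
    for A :: "nat set \<Rightarrow> nat set"
  \<comment> \<open>The possible sets of blocks that carry one factor more than the others;
    \<open>\<Omega>S S\<close> collects the families belonging to S.\<close>
  define T where "T = {S \<in> Pow P. \<pi> ` S = S \<and> card P * t + card S = j}"
  define \<Omega>S where "\<Omega>S S = (\<Pi>\<^sub>E B\<in>P. jsubsets Y (if B \<in> S then Suc t else t))" for S
  have "(\<Sum>x\<in>P \<rightarrow>\<^sub>E SY. lamH j \<pi> x * tr2 t \<pi> x) = (\<Sum>x\<in>P \<rightarrow>\<^sub>E SY. \<Sum>A\<in>?\<Omega>. \<Sum>v\<in>IY t.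
      bs A * (\<Prod>B\<in>P. lam_entry id (x B) (A (\<pi> B)) (A B) * rhoY t (inv_into UNIV (x B)) (v B) (v (\<pi> B))))"
    unfolding lamH_def tr2_def sum_product prod.distrib bs_def by (simp only: mult.assoc)
  also have "\<dots> = (\<Sum>A\<in>?\<Omega>. \<Sum>v\<in>IY t. \<Sum>x\<in>P \<rightarrow>\<^sub>E SY.
      bs A * (\<Prod>B\<in>P. lam_entry id (x B) (A (\<pi> B)) (A B) * rhoY t (inv_into UNIV (x B)) (v B) (v (\<pi> B))))"
    by (rule sum_rotate)
  also have "\<dots> = (\<Sum>A\<in>?\<Omega>. \<Sum>v\<in>IY t. bs A *
      (\<Prod>B\<in>P. \<Sum>y\<in>SY. lam_entry id y (A (\<pi> B)) (A B) * rhoY t (inv_into UNIV y) (v B) (v (\<pi> B))))"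
    by (intro sum.cong refl) (simp only: sum_distrib_left[symmetric] prod_sum_P[OF finite_SY])
  also have "\<dots> = (\<Sum>A\<in>?\<Omega>. if good A then bs A * (\<Sum>v\<in>IY t. (?c / ?d) ^ card P * (\<Prod>B\<in>P. PP (A B) (v B) * QQ (v B) (A B))) else 0)"
  proof (rule sum.cong)
    fix A assume "A \<in> ?\<Omega>"
    then have A: "A \<in> P \<rightarrow>\<^sub>E Pow Y" by simp
    have ker: "(\<Prod>B\<in>P. \<Sum>y\<in>SY. lam_entry id y (A (\<pi> B)) (A B) * rhoY t (inv_into UNIV y) (v B) (v (\<pi> B))) =
      (\<Prod>B\<in>P. if card (A B) = card (A (\<pi> B)) \<and> (card (A B) = t \<or> card (A B) = Suc t)
        then ?c / ?d * (PP (A (\<pi> B)) (v (\<pi> B)) * QQ (v B) (A B)) else 0)" if v: "v \<in> IY t" for v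
    proof (intro prod.cong refl K)
      fix B assume B: "B \<in> P"
      show "A (\<pi> B) \<subseteq> Y" "A B \<subseteq> Y" using A \<pi>P[OF B] B by auto
      show "v B < dY t" "v (\<pi> B) < dY t" using v \<pi>P[OF B] B by auto
    qed
    show "(\<Sum>v\<in>IY t. bs A * (\<Prod>B\<in>P. \<Sum>y\<in>SY. lam_entry id y (A (\<pi> B)) (A B) * rhoY t (inv_into UNIV y) (v B) (v (\<pi> B)))) =
      (if good A then bs A * (\<Sum>v\<in>IY t. (?c / ?d) ^ card P * (\<Prod>B\<in>P. PP (A B) (v B) * QQ (v B) (A B))) else 0)"
    proof (cases "good A")
      case True
      have "(\<Prod>B\<in>P. if card (A B) = card (A (\<pi> B)) \<and> (card (A B) = t \<or> card (A B) = Suc t)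
        then ?c / ?d * (PP (A (\<pi> B)) (v (\<pi> B)) * QQ (v B) (A B)) else 0) =
        (?c / ?d) ^ card P * (\<Prod>B\<in>P. PP (A B) (v B) * QQ (v B) (A B))" for v
      proof -
        have "(\<Prod>B\<in>P. if card (A B) = card (A (\<pi> B)) \<and> (card (A B) = t \<or> card (A B) = Suc t)
          then ?c / ?d * (PP (A (\<pi> B)) (v (\<pi> B)) * QQ (v B) (A B)) else 0) =
          (\<Prod>B\<in>P. ?c / ?d * (PP (A (\<pi> B)) (v (\<pi> B)) * QQ (v B) (A B)))"
        proof (rule prod.cong)
          fix B assume "B \<in> P"
          then have c: "card (A B) = card (A (\<pi> B)) \<and> (card (A B) = t \<or> card (A B) = Suc t)"
            using True unfolding good_def by blast
          show "(if card (A B) = card (A (\<pi> B)) \<and> (card (A B) = t \<or> card (A B) = Suc t)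
            then ?c / ?d * (PP (A (\<pi> B)) (v (\<pi> B)) * QQ (v B) (A B)) else 0) =
            ?c / ?d * (PP (A (\<pi> B)) (v (\<pi> B)) * QQ (v B) (A B))" by (rule if_P[OF c])
        qed simp
        also have "\<dots> = (?c / ?d) ^ card P * ((\<Prod>B\<in>P. PP (A (\<pi> B)) (v (\<pi> B))) * (\<Prod>B\<in>P. QQ (v B) (A B)))"
          by (simp only: prod.distrib prod_constant)
        \<comment> \<open>The kernel at B involves \<open>PP\<close> at \<open>\<pi> B\<close>.
          Reindexing the product brings \<open>PP\<close> and \<open>QQ\<close> to the same block,
          where \<open>trPQ\<close> evaluates the sum.\<close>
        also have "(\<Prod>B\<in>P. PP (A (\<pi> B)) (v (\<pi> B))) = (\<Prod>B\<in>P. PP (A B) (v B))"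
          by (rule prod_P_permute[OF \<pi>, of "\<lambda>B. PP (A B) (v B)"])
        finally show ?thesis by (simp only: prod.distrib)
      qed
      then show ?thesis using True ker by (simp add: sum_distrib_left)
    next
      case False
      then obtain B where B: "B \<in> P" "\<not> (card (A B) = card (A (\<pi> B)) \<and> (card (A B) = t \<or> card (A B) = Suc t))"
        unfolding good_def by blast
      have "(\<Prod>B\<in>P. if card (A B) = card (A (\<pi> B)) \<and> (card (A B) = t \<or> card (A B) = Suc t)
        then ?c / ?d * (PP (A (\<pi> B)) (v (\<pi> B)) * QQ (v B) (A B)) else 0) = 0" for v
        by (rule prod_zero[OF finite_P], rule bexI[OF _ B(1)]) (simp only: B(2) if_False)
      then show ?thesis using False ker by simp
    qed
  qed simp
  also have "\<dots> = (\<Sum>A\<in>{A \<in> ?\<Omega>. good A}. bs A * (\<Sum>v\<in>IY t. (?c / ?d) ^ card P * (\<Prod>B\<in>P. PP (A B) (v B) * QQ (v B) (A B))))"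
    by (rule sum.inter_filter[OF fin\<Omega>, symmetric])
  also have "{A \<in> ?\<Omega>. good A} = (\<Union>S\<in>T. \<Omega>S S)"
  proof (intro equalityI subsetI)
    fix A assume "A \<in> {A \<in> ?\<Omega>. good A}"
    then have A: "A \<in> P \<rightarrow>\<^sub>E Pow Y" "(\<Sum>B\<in>P. card (A B)) = j" "good A" by auto
    let ?S = "{B \<in> P. card (A B) = Suc t}"
    have cA: "card (A B) = (if B \<in> ?S then Suc t else t)" if "B \<in> P" for B using A(3) that by (auto simp: good_def)
    have "\<pi> ` ?S \<subseteq> ?S" using A(3) \<pi>P by (auto simp: good_def)
    then have "\<pi> ` ?S = ?S"
      by (intro card_subset_eq) (auto simp: finite_P card_image inj_on_subset[OF permutes_inj[OF \<pi>]])
    moreover have "card P * t + card ?S = j"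
    proof -
      have "j = (\<Sum>B\<in>P. t + (if card (A B) = Suc t then 1 else 0))"
        unfolding A(2)[symmetric] using A(3) by (intro sum.cong refl) (auto simp: good_def)
      also have "\<dots> = card P * t + card ?S"
        by (rule sum_P_indicator)
      finally show ?thesis by simp
    qed
    ultimately have "?S \<in> T" by (simp add: T_def)
    moreover have "A \<in> \<Omega>S ?S"
      unfolding \<Omega>S_def using A(1) cA by (intro PiE_I) (auto simp: jsubsets_def PiE_def extensional_def)
    ultimately show "A \<in> (\<Union>S\<in>T. \<Omega>S S)" by blast
  next
    fix A assume "A \<in> (\<Union>S\<in>T. \<Omega>S S)"
    then obtain S where S: "S \<subseteq> P" "\<pi> ` S = S" "card P * t + card S = j" and A: "A \<in> \<Omega>S S" by (auto simp: T_def)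
    have cA: "card (A B) = (if B \<in> S then Suc t else t)" "A B \<subseteq> Y" if "B \<in> P" for B
      using PiE_mem[OF A[unfolded \<Omega>S_def] that] by (auto simp: jsubsets_def split: if_splits)
    have \<pi>S: "\<pi> B \<in> S \<longleftrightarrow> B \<in> S" for B
      using S(2) permutes_inj[OF \<pi>] by (metis inj_image_mem_iff)
    have "A \<in> P \<rightarrow>\<^sub>E Pow Y" using A cA by (auto simp: \<Omega>S_def PiE_def)
    moreover have "good A" using cA \<pi>P \<pi>S by (auto simp: good_def)
    moreover have "(\<Sum>B\<in>P. card (A B)) = j"
    proof -
      have "(\<Sum>B\<in>P. card (A B)) = (\<Sum>B\<in>P. t + (if B \<in> S then 1 else 0))"
        using cA by (intro sum.cong refl) auto
      also have "\<dots> = card P * t + card {B \<in> P. B \<in> S}"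
        by (rule sum_P_indicator)
      also have "{B \<in> P. B \<in> S} = S" using S(1) by auto
      finally show ?thesis using S(3) by simp
    qed
    ultimately show "A \<in> {A \<in> ?\<Omega>. good A}" by simp
  qed
  also have "(\<Sum>A\<in>(\<Union>S\<in>T. \<Omega>S S). bs A * (\<Sum>v\<in>IY t. (?c / ?d) ^ card P * (\<Prod>B\<in>P. PP (A B) (v B) * QQ (v B) (A B)))) =
     (\<Sum>S\<in>T. \<Sum>A\<in>\<Omega>S S. bs A * (\<Sum>v\<in>IY t. (?c / ?d) ^ card P * (\<Prod>B\<in>P. PP (A B) (v B) * QQ (v B) (A B))))"
  proof (rule sum.UNION_disjoint)
    show "finite T" unfolding T_def using finite_P by simp
    show "\<forall>S\<in>T. finite (\<Omega>S S)" unfolding \<Omega>S_def by (auto intro!: finite_PiE finite_P finite_jsubsets)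
    show "\<forall>S\<in>T. \<forall>S'\<in>T. S \<noteq> S' \<longrightarrow> \<Omega>S S \<inter> \<Omega>S S' = {}"
    proof (intro ballI impI)
      fix S S' assume S: "S \<in> T" "S' \<in> T" "S \<noteq> S'"
      have "S = S'" if A: "A \<in> \<Omega>S S" "A \<in> \<Omega>S S'" for A
      proof -
        have "B \<in> S \<longleftrightarrow> B \<in> S'" if "B \<in> P" for B
          using PiE_mem[OF A(1)[unfolded \<Omega>S_def] that] PiE_mem[OF A(2)[unfolded \<Omega>S_def] that]
          by (auto simp: jsubsets_def split: if_splits)
        then show ?thesis using S by (auto simp: T_def)
      qed
      then show "\<Omega>S S \<inter> \<Omega>S S' = {}" using S(3) by blast
    qed
  qed
  also have "\<dots> = (\<Sum>S\<in>T. set_sign rk \<pi> P ^ t * set_sign rk \<pi> S * ?c ^ card P)"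
  proof (rule sum.cong)
    fix S assume "S \<in> T"
    then have S: "S \<subseteq> P" "\<pi> ` S = S" by (auto simp: T_def)
    have bsA: "bs A = set_sign rk \<pi> P ^ t * set_sign rk \<pi> S" if A: "A \<in> \<Omega>S S" for A
    proof -
      have cA: "card (A B) = (if B \<in> S then Suc t else t)" if "B \<in> P" for B
        using PiE_mem[OF A[unfolded \<Omega>S_def] that] by (auto simp: jsubsets_def split: if_splits)
      have "bs A = block_sign \<pi> (\<lambda>B. if B \<in> S then Suc t else t)"
        unfolding bs_def block_sign_def
        by (intro prod.cong refl arg_cong2[of _ _ _ _ "(^)"]) (use cA in \<open>auto simp: pairs_def\<close>)
      then show ?thesis using block_sign_shift[OF \<pi> S] by simp
    qed
    have "(\<Sum>A\<in>\<Omega>S S. \<Sum>v\<in>IY t. \<Prod>B\<in>P. PP (A B) (v B) * QQ (v B) (A B)) =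
      (\<Sum>A\<in>\<Omega>S S. \<Prod>B\<in>P. \<Sum>v<dY t. PP (A B) v * QQ v (A B))"
      by (intro sum.cong refl prod_sum_P[symmetric]) simp
    also have "\<dots> = (\<Prod>B\<in>P. \<Sum>A\<in>jsubsets Y (if B \<in> S then Suc t else t). \<Sum>v<dY t. PP A v * QQ v A)"
      unfolding \<Omega>S_def by (intro prod_sum_P[symmetric] finite_jsubsets) simp
    also have "\<dots> = ?d ^ card P" using trPQ by simp
    finally have tr: "(\<Sum>A\<in>\<Omega>S S. \<Sum>v\<in>IY t. \<Prod>B\<in>P. PP (A B) (v B) * QQ (v B) (A B)) = ?d ^ card P" .
    have "(\<Sum>A\<in>\<Omega>S S. bs A * (\<Sum>v\<in>IY t. (?c / ?d) ^ card P * (\<Prod>B\<in>P. PP (A B) (v B) * QQ (v B) (A B)))) =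
      (\<Sum>A\<in>\<Omega>S S. set_sign rk \<pi> P ^ t * set_sign rk \<pi> S * (?c / ?d) ^ card P * (\<Sum>v\<in>IY t. \<Prod>B\<in>P. PP (A B) (v B) * QQ (v B) (A B)))"
      by (intro sum.cong refl) (simp add: bsA sum_distrib_left mult.assoc)
    also have "\<dots> = set_sign rk \<pi> P ^ t * set_sign rk \<pi> S * (?c / ?d) ^ card P * ?d ^ card P"
      by (simp only: sum_distrib_left[symmetric] tr)
    also have "\<dots> = set_sign rk \<pi> P ^ t * set_sign rk \<pi> S * ?c ^ card P"
      using d0 by (simp add: power_divide)
    finally show "(\<Sum>A\<in>\<Omega>S S. bs A * (\<Sum>v\<in>IY t. (?c / ?d) ^ card P * (\<Prod>B\<in>P. PP (A B) (v B) * QQ (v B) (A B)))) =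
      set_sign rk \<pi> P ^ t * set_sign rk \<pi> S * ?c ^ card P" .
  qed simp
  also have "\<dots> = ?c ^ card P * (if card P * t \<le> j then set_sign rk \<pi> P ^ t * lam P rk (j - card P * t) \<pi> else 0)"
  proof (cases "card P * t \<le> j")
    case True
    have "T = {S \<in> jsubsets P (j - card P * t). \<pi> ` S = S}"
      using True by (auto simp: T_def jsubsets_def)
    then have "(\<Sum>S\<in>T. set_sign rk \<pi> S) = lam P rk (j - card P * t) \<pi>"
      unfolding lam_eq[OF \<pi>] by (simp add: sum.inter_filter finite_jsubsets[OF finite_P])
    then show ?thesis
      using True by (simp add: sum_distrib_left[symmetric] sum_distrib_right[symmetric] mult_ac)
  next
    case False
    then have "T = {}" by (auto simp: T_def)
    then show ?thesis using False by simp
  qed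
  finally show ?thesis .
qed

text \<open>The sign power from \<open>sum_lamH_tr2\<close> meets the same power inside
  \<open>beta\<close> and squares to 1. The rest is \<open>cip_lam_hook\<close> for the set of
  blocks.\<close>

lemma cip_lam_psi:
  assumes t: "t < a" and s: "s < card P" and j: "j \<le> n"
  shows "cip H (lam {1..n} rX j) (psi t s) =
    (if j = card P * t + s then 1 else 0) + (if j = Suc (card P * t + s) then 1 else 0)"
proof -
  let ?c = "of_nat (card SY) :: complex" and ?i = "j - card P * t"
  have "(\<Sum>h\<in>carrier H. lam {1..n} rX j h * (tr2 t (pi h) (\<lambda>B\<in>P. xi h B) * beta t s (inv_into UNIV (pi h)))) =
    (\<Sum>h\<in>carrier H. (lamH j (pi h) (\<lambda>B\<in>P. xi h B) * tr2 t (pi h) (\<lambda>B\<in>P. xi h B)) * beta t s (inv_into UNIV (pi h)))"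
    by (intro sum.cong refl) (simp only: lam_on_H mult.assoc)
  also have "\<dots> = (\<Sum>\<pi>\<in>SP. \<Sum>x\<in>P \<rightarrow>\<^sub>E SY. (lamH j \<pi> x * tr2 t \<pi> x) * beta t s (inv_into UNIV \<pi>))"
    by (rule sum_H)
  also have "\<dots> = (\<Sum>\<pi>\<in>SP. ?c ^ card P *
      (if card P * t \<le> j then lam P rk ?i \<pi> * hook P rk s (inv\<^bsub>Sym_on P\<^esub> \<pi>) else 0))"
  proof (rule sum.cong)
    fix \<pi> assume "\<pi> \<in> SP"
    then have \<pi>: "\<pi> permutes P" by simp
    have "(\<Sum>x\<in>P \<rightarrow>\<^sub>E SY. (lamH j \<pi> x * tr2 t \<pi> x) * beta t s (inv_into UNIV \<pi>)) =
      ?c ^ card P * (if card P * t \<le> j then (set_sign rk \<pi> P ^ t * set_sign rk \<pi> P ^ t) *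
        (lam P rk ?i \<pi> * hook P rk s (inv\<^bsub>Sym_on P\<^esub> \<pi>)) else 0)"
      unfolding sum_distrib_right[symmetric] sum_lamH_tr2[OF t \<pi>] beta_inv[OF \<pi>]
      by (cases "card P * t \<le> j") (simp_all only: if_True if_False mult_zero_left mult_zero_right mult_ac)
    then show "(\<Sum>x\<in>P \<rightarrow>\<^sub>E SY. (lamH j \<pi> x * tr2 t \<pi> x) * beta t s (inv_into UNIV \<pi>)) =
      ?c ^ card P * (if card P * t \<le> j then lam P rk ?i \<pi> * hook P rk s (inv\<^bsub>Sym_on P\<^esub> \<pi>) else 0)"
      by (simp only: set_sign_power_square mult_1_left)
  qed simp
  finally have "cip H (lam {1..n} rX j) (psi t s) =
      (if card P * t \<le> j then cip (Sym_on P) (lam P rk ?i) (hook P rk s) else 0)"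
    unfolding cip_psi_sum using card_SY_pos by (simp add: cip_def sum_distrib_left[symmetric])
  moreover have "cip (Sym_on P) (lam P rk ?i) (hook P rk s) = (if ?i = s then 1 else 0) + (if ?i = Suc s then 1 else 0)"
  proof (cases "?i \<le> card P")
    case True
    show ?thesis by (rule cip_lam_hook[OF finite_P rk s True])
  next
    \<comment> \<open>There are fewer than ?i blocks, so the exterior power is 0; since s + 1 \<le>
      card P < ?i, the right-hand side is 0 too.\<close>
    case False
    then have "jsubsets P ?i = {}" by (auto simp: jsubsets_def dest: card_mono[OF finite_P])
    then have "cip (Sym_on P) (lam P rk ?i) (hook P rk s) = 0" by (simp add: cip_def lam_eq)
    then show ?thesis using s False by simp
  qed
  ultimately show ?thesis by auto
qed

text \<open>\<open>psi t s\<close> lies in two consecutive exterior powers. The first occurrence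
  enters the hook of that index, the second is cancelled by subtracting it.\<close>

lemma cip_hook_psi:
  assumes t: "t < a" and s: "s < card P" and i: "i < n"
  shows "cip H (hook {1..n} rX i) (psi t s) = (if i = card P * t + s then 1 else 0)"
  using i
proof (induction i)
  case 0
  then show ?case using cip_lam_psi[OF t s, of 0] by simp
next
  case (Suc i)
  have "cip H (hook {1..n} rX (Suc i)) (psi t s) =
    cip H (\<lambda>h. lam {1..n} rX (Suc i) h - hook {1..n} rX i h) (psi t s)"
    by (rule H.cip_cong) (auto simp: H_carrier)
  also have "\<dots> = cip H (lam {1..n} rX (Suc i)) (psi t s) - cip H (hook {1..n} rX i) (psi t s)"
    by (simp add: cip_def left_diff_distrib sum_subtractf diff_divide_distrib)
  also have "\<dots> = (if Suc i = card P * t + s then 1 else 0)"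
    using Suc cip_lam_psi[OF t s, of "Suc i"] by auto
  finally show ?case .
qed

lemma psi_Irr: "t < a \<Longrightarrow> s < card P \<Longrightarrow> psi t s \<in> Irr H"
proof -
  assume ts: "t < a" "s < card P"
  obtain \<chi> where \<chi>: "\<chi> \<in> Irr H" "\<forall>g\<in>carrier H. psi t s g = \<chi> g"
    using H.norm_one_imp_Irr[OF genuine_psi[OF ts]] cip_psi[OF ts(1,1) ts(2,2)] by auto
  then have "psi t s = \<chi>"
    by (intro extensionalityI[of _ "carrier H"]) (auto simp: psi_def Irr_def character_of_def)
  then show ?thesis using \<chi> by simp
qed

end

section \<open>Full cycles\<close>

definition full_cycle :: "'x set \<Rightarrow> ('x \<Rightarrow> 'x) \<Rightarrow> bool" where
  "full_cycle X \<sigma> \<longleftrightarrow> \<sigma> permutes X \<and> (\<forall>x\<in>X. \<forall>y\<in>X. \<exists>m. (\<sigma> ^^ m) x = y)"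

lemma full_cycleD: "full_cycle X \<sigma> \<Longrightarrow> \<sigma> permutes X"
  by (simp add: full_cycle_def)

lemma funpow_in: "\<sigma> permutes X \<Longrightarrow> x \<in> X \<Longrightarrow> (\<sigma> ^^ m) x \<in> X"
  by (induction m) (auto simp: permutes_in_image)

lemma full_cycle_bij:
  assumes \<sigma>: "full_cycle X \<sigma>" and fin: "finite X" and x: "x \<in> X"
  shows "(\<sigma> ^^ card X) x = x" and "bij_betw (\<lambda>m. (\<sigma> ^^ m) x) {..<card X} X"
proof -
  have per: "\<sigma> permutes X" using \<sigma> by (rule full_cycleD)
  have "\<exists>m. (\<sigma> ^^ m) (\<sigma> x) = x"
    using \<sigma> x permutes_in_image[OF per] unfolding full_cycle_def by blast
  then have ex: "\<exists>m. 0 < m \<and> (\<sigma> ^^ m) x = x" by (metis funpow_Suc_right o_apply zero_less_Suc)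
  \<comment> \<open>The first return time of x; the orbit of x then has exactly \<open>N\<close>
    points, and it is all of \<open>X\<close>.\<close>
  define N where "N = (LEAST m. 0 < m \<and> (\<sigma> ^^ m) x = x)"
  have N: "0 < N" "(\<sigma> ^^ N) x = x" using LeastI_ex[OF ex] by (auto simp: N_def)
  have min: "(\<sigma> ^^ m) x \<noteq> x" if "0 < m" "m < N" for m
    using that not_less_Least[of m "\<lambda>m. 0 < m \<and> (\<sigma> ^^ m) x = x"] by (auto simp: N_def)
  have modN: "(\<sigma> ^^ m) x = (\<sigma> ^^ (m mod N)) x" for m
    using funpow_mod_eq[OF N(2), of m] by simp
  have ne: "(\<sigma> ^^ i) x \<noteq> (\<sigma> ^^ j) x" if "i < j" "j < N" for i j
  proof
    assume eq: "(\<sigma> ^^ i) x = (\<sigma> ^^ j) x"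
    have "(\<sigma> ^^ (j - i)) ((\<sigma> ^^ i) x) = (\<sigma> ^^ j) x"
      using that by (simp flip: funpow_add[THEN fun_cong, simplified o_apply])
    then have "(\<sigma> ^^ i) ((\<sigma> ^^ (j - i)) x) = (\<sigma> ^^ i) x"
      using eq by (metis add.commute funpow_add o_apply)
    moreover have "inj (\<sigma> ^^ i)" using permutes_inj[OF per] by (induction i) (auto intro: inj_compose)
    ultimately have "(\<sigma> ^^ (j - i)) x = x" by (simp add: inj_eq)
    then show False using min[of "j - i"] that by simp
  qed
  have "inj_on (\<lambda>m. (\<sigma> ^^ m) x) {..<N}"
    by (rule linorder_inj_onI') (use ne in auto)
  moreover have "(\<lambda>m. (\<sigma> ^^ m) x) ` {..<N} = X"
  proof (intro equalityI subsetI)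
    fix y assume "y \<in> X"
    then obtain m where "(\<sigma> ^^ m) x = y" using \<sigma> x by (auto simp: full_cycle_def)
    then show "y \<in> (\<lambda>m. (\<sigma> ^^ m) x) ` {..<N}" using modN[of m] N(1) by (intro image_eqI[of _ _ "m mod N"]) auto
  qed (use funpow_in[OF per x] in auto)
  ultimately have bij: "bij_betw (\<lambda>m. (\<sigma> ^^ m) x) {..<N} X" by (simp add: bij_betw_def)
  then have "card X = N" using bij_betw_same_card by force
  then show "(\<sigma> ^^ card X) x = x" "bij_betw (\<lambda>m. (\<sigma> ^^ m) x) {..<card X} X" using N bij by simp_all
qed

lemma full_cycle_eq_iff:
  assumes "full_cycle X \<sigma>" "finite X" "x \<in> X"
  shows "(\<sigma> ^^ i) x = (\<sigma> ^^ j) x \<longleftrightarrow> i mod card X = j mod card X"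
proof -
  have m: "(\<sigma> ^^ m) x = (\<sigma> ^^ (m mod card X)) x" for m
    using funpow_mod_eq[OF full_cycle_bij(1)[OF assms], of m] by simp
  have "card X > 0" using assms by (auto simp: card_gt_0_iff)
  then show ?thesis
    using full_cycle_bij(2)[OF assms] m[of i] m[of j] by (auto simp: bij_betw_def dest: inj_onD)
qed

lemma full_cycle_pow_card:
  assumes "full_cycle X \<sigma>" "finite X"
  shows "\<sigma> ^^ card X = id"
proof
  fix x show "(\<sigma> ^^ card X) x = id x"
  proof (cases "x \<in> X")
    case True
    then show ?thesis using full_cycle_bij(1)[OF assms] by simp
  next
    case False
    then have "\<sigma> x = x" using full_cycleD[OF assms(1)] by (simp add: permutes_not_in)
    then have "(\<sigma> ^^ m) x = x" for m by (induction m) simp_all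
    then show ?thesis by simp
  qed
qed

lemma full_cycle_invariant:
  assumes "full_cycle X \<sigma>" "A \<subseteq> X" "\<sigma> ` A = A"
  shows "A = {} \<or> A = X"
proof (rule disjCI)
  assume "A \<noteq> X"
  show "A = {}"
  proof (rule ccontr)
    assume "A \<noteq> {}"
    then obtain x where x: "x \<in> A" by blast
    have "(\<sigma> ^^ m) x \<in> A" for m using x assms(3) by (induction m) auto
    then have "X \<subseteq> A" using assms(1,2) x unfolding full_cycle_def by (metis subset_iff)
    then show False using assms(2) \<open>A \<noteq> X\<close> by blast
  qed
qed

text \<open>u is invertible modulo card X, so every power of \<sigma> is a power of \<sigma>^u. This
  keeps the generators of the cyclic group spanned by \<sigma> inside the set of full
  cycles.\<close>

lemma full_cycle_power:
  assumes \<sigma>: "full_cycle X \<sigma>" and fin: "finite X" and cop: "coprime u (card X)"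
  shows "full_cycle X (\<sigma> ^^ u)"
  unfolding full_cycle_def
proof (intro conjI ballI)
  have per: "\<sigma> permutes X" using \<sigma> by (rule full_cycleD)
  show "\<sigma> ^^ u permutes X"
  proof (induction u)
    case 0
    show ?case by (simp only: funpow.simps permutes_id)
  next
    case (Suc u)
    show ?case unfolding funpow.simps by (rule permutes_compose[OF Suc per])
  qed
  fix x y assume x: "x \<in> X" and "y \<in> X"
  then obtain j where j: "(\<sigma> ^^ j) x = y" using \<sigma> by (auto simp: full_cycle_def)
  obtain v where "[u * v = 1] (mod card X)" using cong_solve_coprime_nat[OF cop] by auto
  then have "[u * v * j = 1 * j] (mod card X)" by (rule cong_scalar_right)
  then have "(\<sigma> ^^ (u * (v * j))) x = (\<sigma> ^^ j) x"
    unfolding full_cycle_eq_iff[OF \<sigma> fin x] by (simp add: cong_def mult.assoc)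
  then show "\<exists>m. ((\<sigma> ^^ u) ^^ m) x = y" using j by (metis funpow_mult mult.commute)
qed

lemma funpow_conj: "g \<circ> \<sigma> = \<tau> \<circ> g \<Longrightarrow> g ((\<sigma> ^^ m) x) = (\<tau> ^^ m) (g x)"
  by (induction m) (auto simp: fun_eq_iff)

lemma full_cycle_conj:
  assumes \<sigma>: "full_cycle X \<sigma>" and g: "g permutes X"
  shows "full_cycle X (g \<circ> \<sigma> \<circ> inv_into UNIV g)"
  unfolding full_cycle_def
proof (intro conjI ballI)
  let ?\<tau> = "g \<circ> \<sigma> \<circ> inv_into UNIV g"
  show "?\<tau> permutes X" using g full_cycleD[OF \<sigma>] by (intro permutes_compose permutes_inv)
  have eq: "g \<circ> \<sigma> = ?\<tau> \<circ> g" using permutes_inverses(2)[OF g] by (simp add: fun_eq_iff)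
  fix x y assume xy: "x \<in> X" "y \<in> X"
  then have "inv_into UNIV g x \<in> X" "inv_into UNIV g y \<in> X"
    using permutes_in_image[OF permutes_inv[OF g]] by auto
  then obtain m where "(\<sigma> ^^ m) (inv_into UNIV g x) = inv_into UNIV g y"
    using \<sigma> unfolding full_cycle_def by blast
  then have "(?\<tau> ^^ m) (g (inv_into UNIV g x)) = g (inv_into UNIV g y)"
    using funpow_conj[OF eq, of m "inv_into UNIV g x"] by simp
  then show "\<exists>m. (?\<tau> ^^ m) x = y" using permutes_inverses(1)[OF g] by auto
qed

text \<open>Send \<sigma>^m x to \<tau>^m x. That the conjugator fixes x is what later shows that it
  respects blocks.\<close>

lemma full_cycle_conjugator:
  assumes \<sigma>: "full_cycle X \<sigma>" and \<tau>: "full_cycle X \<tau>" and fin: "finite X" and x: "x \<in> X"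
  obtains g where "g permutes X" "g \<circ> \<sigma> = \<tau> \<circ> g" "g x = x"
proof -
  \<comment> \<open>Any exponent m may be chosen: it is determined modulo card X, and \<tau> has the
    same period.\<close>
  define g where "g y = (if y \<in> X then (\<tau> ^^ (SOME m. (\<sigma> ^^ m) x = y)) x else y)" for y
  have g: "g ((\<sigma> ^^ m) x) = (\<tau> ^^ m) x" for m
  proof -
    have "(\<sigma> ^^ (SOME m'. (\<sigma> ^^ m') x = (\<sigma> ^^ m) x)) x = (\<sigma> ^^ m) x" by (rule someI_ex) blast
    then have "(\<tau> ^^ (SOME m'. (\<sigma> ^^ m') x = (\<sigma> ^^ m) x)) x = (\<tau> ^^ m) x"
      unfolding full_cycle_eq_iff[OF \<sigma> fin x] full_cycle_eq_iff[OF \<tau> fin x] .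
    then show ?thesis using funpow_in[OF full_cycleD[OF \<sigma>] x] by (simp add: g_def)
  qed
  have orb: "\<exists>m. y = (\<sigma> ^^ m) x" "\<exists>m. y = (\<tau> ^^ m) x" if "y \<in> X" for y
    using \<sigma> \<tau> x that unfolding full_cycle_def by metis+
  have "g ` X = X"
  proof (intro equalityI subsetI)
    fix y assume "y \<in> g ` X"
    then obtain m where "y = (\<tau> ^^ m) x" using orb(1) g by blast
    then show "y \<in> X" using funpow_in[OF full_cycleD[OF \<tau>] x] by simp
  next
    fix y assume "y \<in> X"
    then obtain m where "y = g ((\<sigma> ^^ m) x)" using orb(2) g by metis
    then show "y \<in> g ` X" using funpow_in[OF full_cycleD[OF \<sigma>] x] by blast
  qed
  then have "bij_betw g X X" using fin by (simp add: bij_betw_def eq_card_imp_inj_on)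
  then have gp: "g permutes X" by (rule bij_imp_permutes) (simp only: g_def if_False simp_thms)
  moreover have "g \<circ> \<sigma> = \<tau> \<circ> g"
  proof
    fix y show "(g \<circ> \<sigma>) y = (\<tau> \<circ> g) y"
    proof (cases "y \<in> X")
      case True
      then obtain m where m: "y = (\<sigma> ^^ m) x" using orb(1) by blast
      then show ?thesis using g[of "Suc m"] g[of m] by simp
    next
      case False
      then show ?thesis
        using full_cycleD[OF \<sigma>] full_cycleD[OF \<tau>] gp by (simp add: permutes_not_in)
    qed
  qed
  moreover have "g x = x" using g[of 0] by simp
  ultimately show thesis by (rule that)
qed

text \<open>An intertwiner is determined by the image of one point, as the powers of \<sigma> reach
  all others.\<close>

lemma card_intertwiners_le:
  assumes \<sigma>: "full_cycle X \<sigma>" and fin: "finite X" and ne: "X \<noteq> {}"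
  shows "card {g. g permutes X \<and> g \<circ> \<sigma> = \<tau> \<circ> g} \<le> card X"
proof -
  obtain x where x: "x \<in> X" using ne by blast
  have "inj_on (\<lambda>g. g x) {g. g permutes X \<and> g \<circ> \<sigma> = \<tau> \<circ> g}"
  proof (rule inj_onI)
    fix g h assume gh: "g \<in> {g. g permutes X \<and> g \<circ> \<sigma> = \<tau> \<circ> g}" "h \<in> {g. g permutes X \<and> g \<circ> \<sigma> = \<tau> \<circ> g}"
      and eq: "g x = h x"
    show "g = h"
    proof
      fix y show "g y = h y"
      proof (cases "y \<in> X")
        case True
        then obtain m where "y = (\<sigma> ^^ m) x" using \<sigma> x unfolding full_cycle_def by metis
        then show ?thesis using funpow_conj[of g \<sigma> \<tau> m x] funpow_conj[of h \<sigma> \<tau> m x] gh eq by simp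
      next
        case False
        then show ?thesis using gh by (metis (no_types) mem_Collect_eq permutes_not_in)
      qed
    qed
  qed
  moreover have "(\<lambda>g. g x) ` {g. g permutes X \<and> g \<circ> \<sigma> = \<tau> \<circ> g} \<subseteq> X"
    using x by (auto simp: permutes_in_image)
  ultimately show ?thesis using fin by (intro card_inj_on_le)
qed

text \<open>Conjugating \<sigma> maps the group to the full cycles with fibres of at most card X
  elements. This bounds the number of full cycles from below, so that they can absorb the whole norm
  in \<open>alt_sum_hook\<close>.\<close>

lemma card_Sym_le_full_cycles:
  assumes \<sigma>: "full_cycle X \<sigma>" and fin: "finite X" and ne: "X \<noteq> {}"
  shows "card {g. g permutes X} \<le> card X * card {\<tau>. full_cycle X \<tau>}"
proof -
  let ?Z = "{\<tau>. full_cycle X \<tau>}"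
  have finG: "finite {g. g permutes X}" by (rule finite_permutations[OF fin])
  have finZ: "finite ?Z" by (rule finite_subset[OF _ finG]) (auto dest: full_cycleD)
  have "{g. g permutes X} \<subseteq> (\<Union>\<tau>\<in>?Z. {g. g permutes X \<and> g \<circ> \<sigma> = \<tau> \<circ> g})"
  proof
    fix g assume "g \<in> {g. g permutes X}"
    then have g: "g permutes X" by simp
    have "g \<circ> \<sigma> = (g \<circ> \<sigma> \<circ> inv_into UNIV g) \<circ> g" using permutes_inverses(2)[OF g] by (simp add: fun_eq_iff)
    then show "g \<in> (\<Union>\<tau>\<in>?Z. {g. g permutes X \<and> g \<circ> \<sigma> = \<tau> \<circ> g})"
      using full_cycle_conj[OF \<sigma> g] g by blast
  qed
  then have "card {g. g permutes X} \<le> card (\<Union>\<tau>\<in>?Z. {g. g permutes X \<and> g \<circ> \<sigma> = \<tau> \<circ> g})"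
    by (rule card_mono[rotated]) (rule finite_subset[OF _ finG], auto)
  also have "\<dots> \<le> (\<Sum>\<tau>\<in>?Z. card {g. g permutes X \<and> g \<circ> \<sigma> = \<tau> \<circ> g})"
    by (rule card_UN_le[OF finZ])
  also have "\<dots> \<le> (\<Sum>\<tau>\<in>?Z. card X)"
    by (intro sum_mono card_intertwiners_le[OF \<sigma> fin ne])
  finally show ?thesis by (simp add: mult.commute)
qed

section \<open>Alternating sums and characters of degree prime to p\<close>

definition alt_sum :: "nat \<Rightarrow> (nat \<Rightarrow> 'a \<Rightarrow> complex) \<Rightarrow> 'a \<Rightarrow> complex" where
  "alt_sum N \<chi> g = (\<Sum>i<N. (- 1) ^ i * \<chi> i g)"

context fin_group
begin

lemma genuine_char_conj:
  assumes "genuine_char G f" "g \<in> carrier G" "x \<in> carrier G"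
  shows "f (g \<otimes> x \<otimes> inv g) = f x"
proof -
  obtain n \<rho> where rep: "fun_rep G {..<n::nat} \<rho>" and fc: "f = fun_char G {..<n} \<rho>"
    using genuine_charE[OF is_group assms(1)] .
  have tr: "(\<Sum>i<n. \<rho> (a \<otimes> b) i i) = (\<Sum>i<n. \<rho> (b \<otimes> a) i i)" if "a \<in> carrier G" "b \<in> carrier G" for a b
    using trace_mm[where I = "{..<n}" and J = "{..<n}" and A = "\<rho> a" and B = "\<rho> b"] that by (simp add: fun_rep_mm[OF rep])
  have "(\<Sum>i<n. \<rho> ((g \<otimes> x) \<otimes> inv g) i i) = (\<Sum>i<n. \<rho> (inv g \<otimes> (g \<otimes> x)) i i)"
    using assms by (intro tr) auto
  also have "inv g \<otimes> (g \<otimes> x) = x" using assms by (simp add: m_assoc[symmetric])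
  finally show ?thesis using assms by (simp add: fc fun_char_def)
qed

lemma cip_self_cmod:
  assumes "\<And>g. g \<in> carrier G \<Longrightarrow> f (inv g) = cnj (f g)"
  shows "cip G f f = of_real ((\<Sum>g\<in>carrier G. (cmod (f g))\<^sup>2) / real (card (carrier G)))"
proof -
  have "(\<Sum>g\<in>carrier G. f g * f (inv g)) = (\<Sum>g\<in>carrier G. of_real ((cmod (f g))\<^sup>2))"
    by (intro sum.cong refl) (simp only: complex_norm_square assms)
  then show ?thesis by (simp add: cip_def)
qed

lemma alt_sum_inv:
  assumes "\<And>i. i < N \<Longrightarrow> genuine_char G (\<chi> i)" "g \<in> carrier G"
  shows "alt_sum N \<chi> (inv g) = cnj (alt_sum N \<chi> g)"
  unfolding alt_sum_def cnj_sum
  by (intro sum.cong refl) (simp add: genuine_char_inv[OF assms(1) assms(2)])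

lemma cip_alt_sum_left: "cip G (alt_sum N \<chi>) f = (\<Sum>i<N. (- 1) ^ i * cip G (\<chi> i) f)"
  unfolding alt_sum_def[abs_def] by (rule cip_sum_left)

lemma cip_alt_sum_right: "cip G f (alt_sum N \<chi>) = (\<Sum>i<N. (- 1) ^ i * cip G f (\<chi> i))"
  unfolding cip_commute[of f] by (rule cip_alt_sum_left)

text \<open>The signs meet in equal pairs and cancel. Two different families are allowed, so that
  the restricted hooks can be paired with the \<open>psi\<close>.\<close>

lemma cip_alt_sums:
  assumes "\<And>i j. i < N \<Longrightarrow> j < N \<Longrightarrow> cip G (\<chi> i) (\<psi> j) = (if i = j then 1 else 0)"
  shows "cip G (alt_sum N \<chi>) (alt_sum N \<psi>) = of_nat N"
proof -
  have "cip G (alt_sum N \<chi>) (alt_sum N \<psi>) = (\<Sum>i<N. (- 1) ^ i * (\<Sum>j<N. (- 1) ^ j * (if i = j then 1 else 0)))"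
    unfolding cip_alt_sum_left cip_alt_sum_right using assms by (intro sum.cong refl arg_cong2[of _ _ _ _ "(*)"]) auto
  also have "\<dots> = (\<Sum>i<N. 1)"
    by (intro sum.cong refl) (simp add: sum_mult_delta flip: power_add mult_2)
  finally show ?thesis by simp
qed

lemma cip_inj_Irr:
  assumes "\<chi> ` {..<N} \<subseteq> Irr G" "inj_on \<chi> {..<N}" "i < N" "j < N"
  shows "cip G (\<chi> i) (\<chi> j) = (if i = j then 1 else 0)"
proof -
  have "\<chi> i \<in> Irr G" "\<chi> j \<in> Irr G" using assms by auto
  then show ?thesis using cip_Irr inj_on_eq_iff[OF assms(2), of i j] assms(3,4) by simp
qed

text \<open>The alternating sum is a multiple of the indicator of the class, so pairing with it
  evaluates \<psi> at \<sigma> up to a factor. Expanding the same pairing by orthonormality gives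
  the signed test of membership in the list.\<close>

lemma values_on_class:
  fixes \<chi> :: "nat \<Rightarrow> 'a \<Rightarrow> complex"
  assumes Irr: "\<chi> ` {..<N} \<subseteq> Irr G" and inj: "inj_on \<chi> {..<N}" and N: "N > 0"
    and f: "\<And>g. g \<in> carrier G \<Longrightarrow> alt_sum N \<chi> g = (if g \<in> Z then of_nat N else 0)"
    and Z: "Z \<subseteq> carrier G" and \<sigma>: "\<sigma> \<in> Z"
    and conj: "\<And>\<tau>. \<tau> \<in> Z \<Longrightarrow> \<exists>g\<in>carrier G. \<tau> = g \<otimes> \<sigma> \<otimes> inv g"
    and \<psi>: "\<psi> \<in> Irr G"
  shows "\<psi> \<sigma> = (\<Sum>i<N. if \<psi> = \<chi> i then (- 1) ^ i else 0)"
proof -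
  let ?c = "of_nat (card (carrier G)) :: complex"
  have c0: "?c \<noteq> 0" using card_carrier_pos by simp
  have gen: "genuine_char G (\<chi> i)" if "i < N" for i using Irr that Irr_genuine by blast
  have finv: "alt_sum N \<chi> (inv g) = (if g \<in> Z then of_nat N else 0)" if "g \<in> carrier G" for g
    using alt_sum_inv[OF gen that] f[OF that] by simp
  have const: "h \<tau> = h \<sigma>" if "genuine_char G h" "\<tau> \<in> Z" for h \<tau>
    using conj[OF that(2)] genuine_char_conj[OF that(1)] Z \<sigma> by auto
  have cip: "cip G h (alt_sum N \<chi>) = of_nat (card Z) * of_nat N / ?c * v"
    if "\<And>\<tau>. \<tau> \<in> Z \<Longrightarrow> h \<tau> = v" for h v
  proof -
    have "(\<Sum>g\<in>carrier G. h g * alt_sum N \<chi> (inv g)) = (\<Sum>g\<in>carrier G. if g \<in> Z then v * of_nat N else 0)"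
      using that by (intro sum.cong refl) (simp add: finv)
    also have "\<dots> = of_nat (card Z) * (v * of_nat N)"
      using fin_carrier Z by (simp add: sum.If_cases Int_absorb1)
    finally show ?thesis by (simp add: cip_def mult_ac)
  qed
  have "cip G (alt_sum N \<chi>) (alt_sum N \<chi>) = of_nat (card Z) * of_nat N / ?c * of_nat N"
    using Z by (intro cip) (auto simp: f)
  then have "of_nat (card Z) * of_nat N / ?c * of_nat N = 1 * (of_nat N :: complex)"
    using cip_alt_sums[OF cip_inj_Irr[OF Irr inj]] by (simp only: mult_1_left)
  moreover have "of_nat N \<noteq> (0 :: complex)" using N by simp
  \<comment> \<open>The factor is found by pairing the alternating sum with itself: its norm and its
    value on the class are both N.\<close>
  ultimately have one: "of_nat (card Z) * of_nat N / ?c = (1 :: complex)"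
    using mult_right_cancel by blast
  have "\<psi> \<sigma> = cip G \<psi> (alt_sum N \<chi>)"
    using cip[of \<psi> "\<psi> \<sigma>"] const[OF Irr_genuine[OF \<psi>]] one by simp
  also have "\<dots> = (\<Sum>i<N. (- 1) ^ i * cip G \<psi> (\<chi> i))" by (rule cip_alt_sum_right)
  also have "\<dots> = (\<Sum>i<N. if \<psi> = \<chi> i then (- 1) ^ i else 0)"
    using Irr \<psi> by (intro sum.cong refl) (subst cip_Irr, auto)
  finally show ?thesis .
qed

text \<open>The powers of \<sigma> with exponent prime to p stay in Z, so \<psi> takes one common
  integer value on them. \<open>degree_cong_value\<close> carries it to the degree modulo p: 0 off
  the list, 1 or -1 on the list.\<close>

lemma Irr_p'_eq:
  fixes \<chi> :: "nat \<Rightarrow> 'a \<Rightarrow> complex"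
  assumes Irr: "\<chi> ` {..<N} \<subseteq> Irr G" and inj: "inj_on \<chi> {..<N}"
    and f: "\<And>g. g \<in> carrier G \<Longrightarrow> alt_sum N \<chi> g = (if g \<in> Z then of_nat N else 0)"
    and Z: "Z \<subseteq> carrier G" and \<sigma>: "\<sigma> \<in> Z"
    and conj: "\<And>\<sigma> \<tau>. \<sigma> \<in> Z \<Longrightarrow> \<tau> \<in> Z \<Longrightarrow> \<exists>g\<in>carrier G. \<tau> = g \<otimes> \<sigma> \<otimes> inv g"
    and p: "prime p" and N: "N = p ^ k" and k: "k \<ge> 1"
    and ord: "\<sigma> [^] N = \<one>" and pow: "\<And>u :: nat. coprime u p \<Longrightarrow> \<sigma> [^] u \<in> Z"
  shows "Irr_p' p G = \<chi> ` {..<N}"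
proof -
  have N0: "N > 0" using p N by (simp add: prime_gt_0_nat)
  have val: "\<psi> (\<sigma> [^] u) = (\<Sum>i<N. if \<psi> = \<chi> i then (- 1) ^ i else 0)"
    if "\<psi> \<in> Irr G" "coprime u p" for \<psi> and u :: nat
    by (rule values_on_class[OF Irr inj N0 f Z pow[OF that(2)] conj[OF pow[OF that(2)]] that(1)])
  have eps: "int p dvd int (char_degree G \<psi>) - \<epsilon>"
    if "\<psi> \<in> Irr G" "(\<Sum>i<N. if \<psi> = \<chi> i then (- 1) ^ i else 0) = (of_int \<epsilon> :: complex)" for \<psi> \<epsilon>
    using Z \<sigma> val[OF that(1)] that(2)
    by (intro degree_cong_value[OF Irr_genuine[OF that(1)] _ ord N p k]) auto
  have "coprime (char_degree G \<psi>) p \<longleftrightarrow> \<psi> \<in> \<chi> ` {..<N}" if \<psi>: "\<psi> \<in> Irr G" for \<psi>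
  proof
    assume cop: "coprime (char_degree G \<psi>) p"
    show "\<psi> \<in> \<chi> ` {..<N}"
    proof (rule ccontr)
      assume "\<psi> \<notin> \<chi> ` {..<N}"
      then have "(\<Sum>i<N. if \<psi> = \<chi> i then (- 1) ^ i else 0) = (of_int 0 :: complex)"
        by (simp add: image_iff)
      then have "int p dvd int (char_degree G \<psi>) - 0" by (rule eps[OF \<psi>])
      then have "p dvd char_degree G \<psi>" by simp
      then show False using cop p by (metis coprime_absorb_right not_prime_unit)
    qed
  next
    assume "\<psi> \<in> \<chi> ` {..<N}"
    then obtain j where j: "j < N" "\<psi> = \<chi> j" by blast
    have "(\<Sum>i<N. if \<psi> = \<chi> i then (- 1) ^ i else 0) = (\<Sum>i<N. if i = j then (- 1) ^ j else (0 :: complex))"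
      using j inj by (intro sum.cong refl) (auto dest: inj_onD)
    then have "(\<Sum>i<N. if \<psi> = \<chi> i then (- 1) ^ i else 0) = (of_int ((- 1) ^ j) :: complex)"
      using j by simp
    then have d: "int p dvd int (char_degree G \<psi>) - (- 1) ^ j" by (rule eps[OF \<psi>])
    have "\<not> p dvd char_degree G \<psi>"
    proof
      assume "p dvd char_degree G \<psi>"
      then have "int p dvd int (char_degree G \<psi>)" by simp
      then have "int p dvd (- 1) ^ j" using d by (metis dvd_diff_right_iff)
      then have "int p dvd 1" by (metis minus_one_power_iff dvd_minus_iff)
      then show False using p by simp
    qed
    then show "coprime (char_degree G \<psi>) p" using p by (simp add: coprime_commute prime_imp_coprime)
  qed
  then show ?thesis using Irr by (auto simp: Irr_p'_def)
qed

text \<open>The values on Z already exhaust the bound, so the squares elsewhere add up to 0.\<close>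

lemma sum_cmod_off_class:
  fixes f :: "'a \<Rightarrow> complex"
  assumes sum: "(\<Sum>g\<in>carrier G. (cmod (f g))\<^sup>2) \<le> real (card Z) * real N ^ 2"
    and Z: "Z \<subseteq> carrier G" and f: "\<And>g. g \<in> Z \<Longrightarrow> f g = of_nat N"
    and g: "g \<in> carrier G"
  shows "f g = (if g \<in> Z then of_nat N else 0)"
proof (cases "g \<in> Z")
  case False
  have "(\<Sum>g\<in>carrier G. (cmod (f g))\<^sup>2) = (\<Sum>g\<in>Z. (cmod (f g))\<^sup>2) + (\<Sum>g\<in>carrier G - Z. (cmod (f g))\<^sup>2)"
    using fin_carrier Z by (metis add.commute sum.subset_diff)
  also have "(\<Sum>g\<in>Z. (cmod (f g))\<^sup>2) = real (card Z) * real N ^ 2" using f by simp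
  finally have "(\<Sum>g\<in>carrier G - Z. (cmod (f g))\<^sup>2) \<le> 0" using sum by simp
  moreover have "(cmod (f g))\<^sup>2 \<le> (\<Sum>g\<in>carrier G - Z. (cmod (f g))\<^sup>2)"
    using fin_carrier g False by (intro member_le_sum) auto
  ultimately have "(cmod (f g))\<^sup>2 \<le> 0" by linarith
  then show ?thesis using False by simp
qed (use f in simp)

end

lemma Sym_on_pow: "g [^]\<^bsub>Sym_on X\<^esub> (m::nat) = g ^^ m"
  by (induction m) (simp_all add: nat_pow_def funpow_Suc_right del: funpow.simps(2))

text \<open>Hook i is (-1)^i on full cycles, so the sum equals card X there, while its squared norm
  is card X by orthonormality. The full cycles are numerous enough to account for all of that
  norm.\<close>

lemma alt_sum_hook:
  assumes fin: "finite X" and r: "inj_on r X" and \<sigma>: "full_cycle X \<sigma>" and ne: "X \<noteq> {}" and g: "g permutes X"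
  shows "alt_sum (card X) (hook X r) g = (if full_cycle X g then of_nat (card X) else 0)"
proof -
  interpret fin_group "Sym_on X" by (rule fin_group_Sym_on[OF fin])
  let ?N = "card X" and ?f = "alt_sum (card X) (hook X r)" and ?Z = "{\<tau>. full_cycle X \<tau>}"
  have Irr: "hook X r ` {..<?N} \<subseteq> Irr (Sym_on X)" using hook_Irr[OF fin r] by auto
  have gen: "genuine_char (Sym_on X) (hook X r i)" if "i < ?N" for i using Irr_genuine[OF hook_Irr[OF fin r that]] .
  have val: "?f \<tau> = of_nat ?N" if "\<tau> \<in> ?Z" for \<tau>
  proof -
    have \<tau>: "full_cycle X \<tau>" using that by simp
    have "?f \<tau> = (\<Sum>i<?N. (- 1) ^ i * (- 1) ^ i)"
      unfolding alt_sum_def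
      by (intro sum.cong refl arg_cong2[of _ _ _ _ "(*)"] hook_on_full_cycle[OF full_cycleD[OF \<tau>] full_cycle_invariant[OF \<tau>] fin]) auto
    also have "\<dots> = (\<Sum>i<?N. 1)" by (intro sum.cong refl) (simp flip: power_add mult_2)
    finally show ?thesis by simp
  qed
  have "cip (Sym_on X) ?f ?f = of_nat ?N"
    by (rule cip_alt_sums[OF cip_inj_Irr[OF Irr hook_inj[OF fin r]]])
  moreover have "cip (Sym_on X) ?f ?f =
      of_real ((\<Sum>g\<in>carrier (Sym_on X). (cmod (?f g))\<^sup>2) / real (card (carrier (Sym_on X))))"
    by (rule cip_self_cmod) (rule alt_sum_inv[OF gen])
  ultimately have "of_real ((\<Sum>g\<in>carrier (Sym_on X). (cmod (?f g))\<^sup>2) / real (card (carrier (Sym_on X)))) =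
      (of_real (real ?N) :: complex)" by simp
  then have "(\<Sum>g\<in>carrier (Sym_on X). (cmod (?f g))\<^sup>2) / real (card (carrier (Sym_on X))) = real ?N"
    by (simp only: of_real_eq_iff)
  then have "(\<Sum>g\<in>carrier (Sym_on X). (cmod (?f g))\<^sup>2) = real ?N * real (card (carrier (Sym_on X)))"
    using card_carrier_pos by (simp add: field_simps)
  also have "\<dots> \<le> real ?N * real (card X * card ?Z)"
    using card_Sym_le_full_cycles[OF \<sigma> fin ne] by (intro mult_left_mono) (simp_all del: of_nat_mult)
  finally have "(\<Sum>g\<in>carrier (Sym_on X). (cmod (?f g))\<^sup>2) \<le> real (card ?Z) * real ?N ^ 2"
    by (simp add: power2_eq_square mult_ac)
  then have "?f g = (if g \<in> ?Z then of_nat ?N else 0)"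
    by (rule sum_cmod_off_class) (use val g in \<open>auto dest: full_cycleD\<close>)
  then show ?thesis by simp
qed

section \<open>Full cycles inside the stabilizer\<close>

context blocks
begin

text \<open>Powers of \<sigma> move the block of a point as the powers of \<open>pi \<sigma>\<close>
  do, so transitivity on points passes to blocks.\<close>

lemma full_cycle_pi:
  assumes \<sigma>: "\<sigma> \<in> carrier H" and c: "full_cycle {1..n} \<sigma>"
  shows "full_cycle P (pi \<sigma>)"
    and "\<And>m x B. B \<in> P \<Longrightarrow> x \<in> B \<Longrightarrow> (\<sigma> ^^ m) x \<in> (pi \<sigma> ^^ m) B"
proof -
  have inP: "(pi \<sigma> ^^ m) B \<in> P" if "B \<in> P" for m B
    using funpow_in[OF pi_permutes[OF \<sigma>] that] .
  show orb: "(\<sigma> ^^ m) x \<in> (pi \<sigma> ^^ m) B" if "B \<in> P" "x \<in> B" for m x B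
  proof (induction m)
    case (Suc m)
    have "pi \<sigma> C = \<sigma> ` C" if "C \<in> P" for C using that by (simp add: pi_def)
    then have "pi \<sigma> ((pi \<sigma> ^^ m) B) = \<sigma> ` (pi \<sigma> ^^ m) B" using inP[OF that(1), of m] by blast
    then show ?case using Suc by simp
  qed (use that in simp)
  show "full_cycle P (pi \<sigma>)"
    unfolding full_cycle_def
  proof (intro conjI ballI)
    show "pi \<sigma> permutes P" by (rule pi_permutes[OF \<sigma>])
    fix B B' assume B: "B \<in> P" "B' \<in> P"
    then have x: "e B 0 \<in> B" "e B' 0 \<in> B'" "e B 0 \<in> {1..n}" "e B' 0 \<in> {1..n}"
      using e_in e_range a by auto
    then obtain m where "(\<sigma> ^^ m) (e B 0) = e B' 0" using c unfolding full_cycle_def by blast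
    then have "(pi \<sigma> ^^ m) B = B'" using orb[OF B(1) x(1), of m] block_eq[OF inP[OF B(1)] B(2)] x(2) by metis
    then show "\<exists>m. (pi \<sigma> ^^ m) B = B'" ..
  qed
qed

lemma card_block: "B \<in> P \<Longrightarrow> card B = a"
  using e bij_betw_same_card by fastforce

text \<open>Blocks have equal size, so an image contained in a block is that block.\<close>

lemma image_blocks_eq:
  assumes g: "g permutes {1..n}" and sub: "\<And>B. B \<in> P \<Longrightarrow> \<exists>B'\<in>P. g ` B \<subseteq> B'"
  shows "g \<in> carrier H"
proof -
  have inj: "inj g" using g by (rule permutes_inj)
  have "g ` B \<in> P" if B: "B \<in> P" for B
  proof -
    obtain B' where B': "B' \<in> P" "g ` B \<subseteq> B'" using sub[OF B] by blast
    have "g ` B = B'"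
      using B' card_block[OF B] card_block[OF B'(1)] block_sub[OF B'(1)]
      by (intro card_subset_eq) (auto simp: card_image inj_on_subset[OF inj] intro: finite_subset)
    then show ?thesis using B' by simp
  qed
  then have "(`) g ` P \<subseteq> P" by blast
  moreover have "inj_on ((`) g) P" using inj by (auto simp: inj_on_def inj_image_eq_iff)
  ultimately have "(`) g ` P = P" using finite_P by (intro endo_inj_surj) auto
  then show ?thesis using g by (simp add: H_carrier)
qed

text \<open>The conjugator fixing x sends \<sigma>^m x to \<tau>^m x. The block of either point
  depends only on m modulo the number of blocks, so blocks are carried into blocks.\<close>

lemma full_cycle_conj_in_H:
  assumes \<sigma>: "\<sigma> \<in> carrier H" "full_cycle {1..n} \<sigma>" and \<tau>: "\<tau> \<in> carrier H" "full_cycle {1..n} \<tau>"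
  obtains g where "g \<in> carrier H" "g \<circ> \<sigma> = \<tau> \<circ> g"
proof -
  obtain B0 where B0: "B0 \<in> P" using P_ne by blast
  define x where "x = e B0 0"
  have x: "x \<in> B0" "x \<in> {1..n}" using e_in[OF B0 a] e_range[OF B0 a] by (simp_all add: x_def)
  obtain g where g: "g permutes {1..n}" "g \<circ> \<sigma> = \<tau> \<circ> g" "g x = x"
    using full_cycle_conjugator[OF \<sigma>(2) \<tau>(2) finite_atLeastAtMost x(2)] by blast
  note ps = full_cycle_pi[OF \<sigma>] and pt = full_cycle_pi[OF \<tau>]
  have "\<exists>B'\<in>P. g ` B \<subseteq> B'" if B: "B \<in> P" for B
  proof -
    obtain i where i: "(pi \<sigma> ^^ i) B0 = B" using ps(1) B0 B unfolding full_cycle_def by blast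
    have "g ` B \<subseteq> (pi \<tau> ^^ i) B0"
    proof
      fix z assume "z \<in> g ` B"
      then obtain y where y: "y \<in> B" "z = g y" by blast
      then have "y \<in> {1..n}" using block_sub[OF B] by blast
      then obtain m where m: "(\<sigma> ^^ m) x = y" using \<sigma>(2) x(2) unfolding full_cycle_def by blast
      have "y \<in> (pi \<sigma> ^^ m) B0" using ps(2)[OF B0 x(1), of m] m by simp
      then have "(pi \<sigma> ^^ m) B0 = (pi \<sigma> ^^ i) B0"
        using block_eq[OF funpow_in[OF pi_permutes[OF \<sigma>(1)] B0] B] y(1) i by simp
      then have "(pi \<tau> ^^ m) B0 = (pi \<tau> ^^ i) B0"
        unfolding full_cycle_eq_iff[OF ps(1) finite_P B0] full_cycle_eq_iff[OF pt(1) finite_P B0] .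
      moreover have "z \<in> (pi \<tau> ^^ m) B0"
        using pt(2)[OF B0 x(1), of m] funpow_conj[OF g(2), of m x] m y(2) g(3) by simp
      ultimately show "z \<in> (pi \<tau> ^^ i) B0" by simp
    qed
    then show ?thesis using funpow_in[OF pi_permutes[OF \<tau>(1)] B0] by blast
  qed
  then have "g \<in> carrier H" by (rule image_blocks_eq[OF g(1)])
  then show thesis using g(2) by (rule that)
qed

lemma H_pow: "g [^]\<^bsub>H\<^esub> (m::nat) = g ^^ m"
  by (induction m) (simp_all add: nat_pow_def funpow_Suc_right del: funpow.simps(2))

lemma n_pos: "n > 0"
  using n_eq a P_ne finite_P by (simp add: card_gt_0_iff)

text \<open>The conjugators from \<sigma> to \<tau> include g \<circ> \<sigma>^m for all m < n, and
  for different \<tau> they are disjoint. The inequality is opposite to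
  \<open>card_Sym_le_full_cycles\<close>: here it bounds the norm of the restricted alternating sum
  from above.\<close>

lemma full_cycles_in_H_le:
  "n * card {\<tau> \<in> carrier H. full_cycle {1..n} \<tau>} \<le> card (carrier H)"
proof (cases "{\<tau> \<in> carrier H. full_cycle {1..n} \<tau>} = {}")
  case False
  let ?Z = "{\<tau> \<in> carrier H. full_cycle {1..n} \<tau>}"
  obtain \<sigma> where \<sigma>: "\<sigma> \<in> carrier H" "full_cycle {1..n} \<sigma>" using False by blast
  define F where "F \<tau> = {g \<in> carrier H. g \<circ> \<sigma> = \<tau> \<circ> g}" for \<tau>
  have finF: "finite (F \<tau>)" for \<tau> using H.fin_carrier by (simp add: F_def)
  have "n \<le> card (F \<tau>)" if \<tau>: "\<tau> \<in> ?Z" for \<tau>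
  proof -
    obtain g where g: "g \<in> carrier H" "g \<circ> \<sigma> = \<tau> \<circ> g" using full_cycle_conj_in_H[OF \<sigma>] \<tau> by blast
    have x: "1 \<in> {1..n}" using n_pos by simp
    have inj: "inj_on (\<lambda>m. g \<circ> (\<sigma> ^^ m)) {..<n}"
    proof (rule inj_onI)
      fix i j assume ij: "i \<in> {..<n}" "j \<in> {..<n}" "g \<circ> (\<sigma> ^^ i) = g \<circ> (\<sigma> ^^ j)"
      then have "g ((\<sigma> ^^ i) 1) = g ((\<sigma> ^^ j) 1)" by (metis o_apply)
      then have "(\<sigma> ^^ i) 1 = (\<sigma> ^^ j) 1" using g(1) permutes_inj by (auto simp: H_carrier dest: injD)
      then show "i = j" using full_cycle_eq_iff[OF \<sigma>(2) finite_atLeastAtMost x] ij by simp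
    qed
    have "(\<lambda>m. g \<circ> (\<sigma> ^^ m)) ` {..<n} \<subseteq> F \<tau>"
    proof (rule image_subsetI)
      fix m
      have "\<sigma> ^^ m \<in> carrier H" using H.nat_pow_closed[OF \<sigma>(1), of m] by (simp add: H_pow)
      then have "g \<circ> (\<sigma> ^^ m) \<in> carrier H" using H.m_closed[OF g(1)] by simp
      moreover have "g \<circ> (\<sigma> ^^ m) \<circ> \<sigma> = \<tau> \<circ> (g \<circ> (\<sigma> ^^ m))"
      proof -
        have "(\<sigma> ^^ m) \<circ> \<sigma> = \<sigma> \<circ> (\<sigma> ^^ m)" by (metis funpow.simps(2) funpow_Suc_right)
        then show ?thesis using g(2) by (metis comp_assoc)
      qed
      ultimately show "g \<circ> (\<sigma> ^^ m) \<in> F \<tau>" by (simp add: F_def)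
    qed
    then show ?thesis using card_inj_on_le[OF inj _ finF] by simp
  qed
  then have "(\<Sum>\<tau>\<in>?Z. n) \<le> (\<Sum>\<tau>\<in>?Z. card (F \<tau>))" by (rule sum_mono)
  also have "\<dots> = card (\<Union>\<tau>\<in>?Z. F \<tau>)"
  proof (rule card_UN_disjoint[symmetric])
    show "finite ?Z" using H.fin_carrier by simp
    show "\<forall>\<tau>\<in>?Z. finite (F \<tau>)" using finF by blast
    show "\<forall>\<tau>\<in>?Z. \<forall>\<tau>'\<in>?Z. \<tau> \<noteq> \<tau>' \<longrightarrow> F \<tau> \<inter> F \<tau>' = {}"
    proof (intro ballI impI equals0I)
      fix \<tau> \<tau>' g assume ne: "\<tau> \<noteq> \<tau>'" and g: "g \<in> F \<tau> \<inter> F \<tau>'"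
      then have "\<tau> \<circ> g = \<tau>' \<circ> g" "surj g"
        using permutes_surj by (auto simp: F_def H_carrier)
      then have "\<tau> y = \<tau>' y" for y by (metis o_apply surjD)
      then have "\<tau> = \<tau>'" by (rule ext)
      then show False using ne by simp
    qed
  qed
  also have "\<dots> \<le> card (carrier H)"
    by (rule card_mono[OF H.fin_carrier]) (auto simp: F_def)
  finally show ?thesis by (simp add: mult.commute)
next
  case True
  then show ?thesis by (simp only: card.empty mult_0_right le0)
qed

text \<open>List the points so that consecutive ones lie in consecutive blocks, cyclically. Moving
  every point to its successor is a full cycle that maps blocks to blocks.\<close>

lemma full_cycle_exists:
  obtains \<sigma> where "\<sigma> \<in> carrier H" "full_cycle {1..n} \<sigma>"
proof -
  let ?p = "card P"
  have p0: "?p > 0" using P_ne finite_P by (simp add: card_gt_0_iff)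
  obtain b where b: "bij_betw b {..<?p} P"
    using ex_bij_betw_nat_finite[OF finite_P] by (auto simp: lessThan_atLeast0)
  have bP: "b (m mod ?p) \<in> P" for m using b p0 by (auto simp: bij_betw_def)
  define \<theta> where "\<theta> m = e (b (m mod ?p)) (m div ?p)" for m
  have lt: "m div ?p < a" if "m < n" for m
    using that p0 by (simp add: n_eq less_mult_imp_div_less)
  have \<theta>_in: "\<theta> m \<in> {1..n}" "\<theta> m \<in> b (m mod ?p)" if "m < n" for m
    using e_range[OF bP lt[OF that]] e_in[OF bP lt[OF that]] by (simp_all add: \<theta>_def)
  have inj: "inj_on \<theta> {..<n}"
  proof (rule inj_onI)
    fix i j assume ij: "i \<in> {..<n}" "j \<in> {..<n}" "\<theta> i = \<theta> j"
    then have "b (i mod ?p) = b (j mod ?p)" and d: "i div ?p = j div ?p"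
      using e_eq_iff[OF bP bP lt lt, of i j] by (auto simp: \<theta>_def)
    then have "i mod ?p = j mod ?p" using b p0 by (auto simp: bij_betw_def dest: inj_onD)
    then show "i = j" using d by (metis div_mult_mod_eq)
  qed
  have im: "\<theta> ` {..<n} = {1..n}"
    using card_image[OF inj] \<theta>_in(1) by (intro card_subset_eq) auto
  define \<kappa> where "\<kappa> = inv_into {..<n} \<theta>"
  have \<kappa>: "\<kappa> (\<theta> m) = m" if "m < n" for m using inj that by (simp add: \<kappa>_def)
  have \<theta>\<kappa>: "\<kappa> y < n" "\<theta> (\<kappa> y) = y" if "y \<in> {1..n}" for y
    using that im inv_into_into[of y \<theta> "{..<n}"] f_inv_into_f[of y \<theta> "{..<n}"] by (auto simp: \<kappa>_def)
  define h where "h y = (if y \<in> {1..n} then \<theta> (Suc (\<kappa> y) mod n) else y)" for y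
  have h: "h (\<theta> m) = \<theta> (Suc m mod n)" if "m < n" for m
    using \<theta>_in(1)[OF that] \<kappa>[OF that] by (simp only: h_def if_True)
  have pow: "(h ^^ k) (\<theta> m) = \<theta> ((m + k) mod n)" if "m < n" for m k
  proof (induction k)
    case (Suc k)
    then show ?case using h[of "(m + k) mod n"] n_pos by (simp add: mod_Suc_eq)
  qed (use that in simp)
  have "h ` {1..n} = {1..n}"
  proof (intro equalityI subsetI)
    fix z assume "z \<in> h ` {1..n}"
    then show "z \<in> {1..n}" using \<theta>_in(1)[of "Suc _ mod n"] n_pos by (auto simp del: atLeastAtMost_iff simp add: h_def)
  next
    fix z assume z: "z \<in> {1..n}"
    have "h (\<theta> ((\<kappa> z + (n - 1)) mod n)) = \<theta> (Suc ((\<kappa> z + (n - 1)) mod n) mod n)"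
      using n_pos by (intro h) simp
    also have "Suc ((\<kappa> z + (n - 1)) mod n) mod n = \<kappa> z"
      using n_pos \<theta>\<kappa>(1)[OF z] by (simp add: mod_Suc_eq)
    finally have "z = h (\<theta> ((\<kappa> z + (n - 1)) mod n))" using \<theta>\<kappa>(2)[OF z] by simp
    then show "z \<in> h ` {1..n}" using \<theta>_in(1) n_pos by (intro image_eqI[of z h]) auto
  qed
  then have "bij_betw h {1..n} {1..n}" by (simp add: bij_betw_def eq_card_imp_inj_on)
  then have hp: "h permutes {1..n}" by (rule bij_imp_permutes) (simp only: h_def if_False simp_thms)
  have fc: "full_cycle {1..n} h"
    unfolding full_cycle_def
  proof (intro conjI ballI hp)
    fix y z assume yz: "y \<in> {1..n}" "z \<in> {1..n}"
    have "(h ^^ (n - \<kappa> y + \<kappa> z)) (\<theta> (\<kappa> y)) = \<theta> ((\<kappa> y + (n - \<kappa> y + \<kappa> z)) mod n)"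
      by (rule pow[OF \<theta>\<kappa>(1)[OF yz(1)]])
    also have "(\<kappa> y + (n - \<kappa> y + \<kappa> z)) mod n = \<kappa> z" using \<theta>\<kappa>(1)[OF yz(1)] \<theta>\<kappa>(1)[OF yz(2)] by simp
    finally have "(h ^^ (n - \<kappa> y + \<kappa> z)) y = z" using \<theta>\<kappa>(2)[OF yz(1)] \<theta>\<kappa>(2)[OF yz(2)] by simp
    then show "\<exists>m. (h ^^ m) y = z" ..
  qed
  have "\<exists>B'\<in>P. h ` B \<subseteq> B'" if B: "B \<in> P" for B
  proof -
    have "B \<in> b ` {..<?p}" using bij_betw_imp_surj_on[OF b] B by simp
    then obtain i where i: "i < ?p" "b i = B" by blast
    have "h ` B \<subseteq> b (Suc i mod ?p)"
    proof
      fix z assume "z \<in> h ` B"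
      then obtain y where y: "y \<in> B" "z = h y" by blast
      have yX: "y \<in> {1..n}" using block_sub[OF B] y by blast
      have "y \<in> b (\<kappa> y mod ?p)" using \<theta>_in(2)[OF \<theta>\<kappa>(1)[OF yX]] \<theta>\<kappa>(2)[OF yX] by simp
      then have "b (\<kappa> y mod ?p) = b i" using block_eq[OF bP B] y i by blast
      then have ki: "\<kappa> y mod ?p = i" using b i p0 by (auto simp: bij_betw_def dest: inj_onD)
      have "z = \<theta> (Suc (\<kappa> y) mod n)" using y(2) yX by (simp only: h_def if_True)
      then have "z \<in> b ((Suc (\<kappa> y) mod n) mod ?p)" using \<theta>_in(2)[of "Suc (\<kappa> y) mod n"] n_pos by simp
      \<comment> \<open>The wrap-around modulo n does not disturb the block number, because card P
        divides n.\<close>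
      also have "(Suc (\<kappa> y) mod n) mod ?p = Suc (\<kappa> y) mod ?p" by (simp add: n_eq mod_mod_cancel)
      also have "\<dots> = Suc i mod ?p" unfolding ki[symmetric] by (simp add: mod_Suc_eq)
      finally show "z \<in> b (Suc i mod ?p)" .
    qed
    then show ?thesis using bP by blast
  qed
  then have "h \<in> carrier H" by (rule image_blocks_eq[OF hp])
  then show thesis using fc by (rule that)
qed

end

section \<open>Characters of degree coprime to \<open>p\<close>\<close>

context blocks
begin

text \<open>The renumbering i = card P * t + s, which matches the hook of index i.\<close>

definition psi_at :: "nat \<Rightarrow> (nat \<Rightarrow> nat) \<Rightarrow> complex" where
  "psi_at i = psi (i div card P) (i mod card P)"

abbreviation "hk \<equiv> hook {1..n} rX"

lemma card_P_pos: "card P > 0"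
  using P_ne finite_P by (simp add: card_gt_0_iff)

lemma psi_at_Irr: "psi_at ` {..<n} \<subseteq> Irr H"
proof (rule image_subsetI)
  fix i assume "i \<in> {..<n}"
  then have "i div card P < a" using n_eq by (metis lessThan_iff less_mult_imp_div_less)
  then show "psi_at i \<in> Irr H" unfolding psi_at_def using card_P_pos by (intro psi_Irr) simp_all
qed

lemma cip_psi_at: "i < n \<Longrightarrow> j < n \<Longrightarrow> cip H (psi_at i) (psi_at j) = (if i = j then 1 else 0)"
  unfolding psi_at_def using card_P_pos n_eq
  by (subst cip_psi) (auto simp: less_mult_imp_div_less, metis div_mult_mod_eq)

lemma cip_hk_psi_at: "i < n \<Longrightarrow> j < n \<Longrightarrow> cip H (hk i) (psi_at j) = (if i = j then 1 else 0)"
  unfolding psi_at_def using card_P_pos n_eq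
  by (subst cip_hook_psi) (auto simp: less_mult_imp_div_less)

lemma psi_at_inj: "inj_on psi_at {..<n}"
proof (rule inj_onI)
  fix i j assume ij: "i \<in> {..<n}" "j \<in> {..<n}" "psi_at i = psi_at j"
  then have "cip H (psi_at i) (psi_at j) = 1" using cip_psi_at[of i i] by simp
  then show "i = j" using cip_psi_at[of i j] ij by (simp split: if_splits)
qed

lemma H_subset: "h \<in> carrier H \<Longrightarrow> h \<in> carrier (Sym_on {1..n})"
  unfolding H_carrier Sym_on_simps by blast

lemma genuine_restrict:
  assumes "genuine_char (Sym_on {1..n}) f"
  shows "genuine_char H (restrict f (carrier H))"
proof -
  obtain d \<rho> where \<rho>: "representation (Sym_on {1..n}) d \<rho>" "f = character_of (Sym_on {1..n}) \<rho>"
    using assms unfolding genuine_char_def by blast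
  have "representation H d \<rho>"
    using \<rho>(1) H_subset unfolding representation_def hom_def Pi_def H_mult Sym_on_simps(2) by blast
  moreover have "restrict f (carrier H) = character_of H \<rho>"
    unfolding \<rho>(2) character_of_def using H_subset by (auto intro!: restrict_ext)
  ultimately show ?thesis unfolding genuine_char_def by blast
qed

lemma hk_genuine: "i < n \<Longrightarrow> genuine_char (Sym_on {1..n}) (hk i)"
  using fin_group.Irr_genuine[OF fin_group_Sym_on hook_Irr[OF _ inj_rX]] by simp

text \<open>The two alternating sums have inner product \<open>n\<close>, and both have squared norm at most \<open>n\<close>.
  Hence their difference has norm \<open>0\<close>.\<close>

lemma alt_sum_psi_at:
  assumes g: "g \<in> carrier H"
  shows "alt_sum n psi_at g = (if g \<in> {\<tau> \<in> carrier H. full_cycle {1..n} \<tau>} then of_nat n else 0)"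
proof -
  let ?Z = "{\<tau> \<in> carrier H. full_cycle {1..n} \<tau>}" and ?c = "real (card (carrier H))"
  define f where "f = alt_sum n hk"
  define F where "F = alt_sum n psi_at"
  obtain \<sigma> where \<sigma>: "\<sigma> \<in> carrier H" "full_cycle {1..n} \<sigma>" by (rule full_cycle_exists)
  have f: "f h = (if h \<in> ?Z then of_nat n else 0)" if "h \<in> carrier H" for h
  proof -
    have "{1..n} \<noteq> {}" "h permutes {1..n}" using n_pos that by (auto simp: H_carrier)
    from alt_sum_hook[OF finite_atLeastAtMost inj_rX \<sigma>(2) this]
    show ?thesis using that by (simp add: f_def)
  qed
  have finv: "f (inv\<^bsub>H\<^esub> h) = cnj (f h)" if "h \<in> carrier H" for h
  proof -
    have "restrict (hk i) (carrier H) (inv\<^bsub>H\<^esub> h) = cnj (restrict (hk i) (carrier H) h)" if "i < n" for i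
      using H.genuine_char_inv[OF genuine_restrict[OF hk_genuine[OF that]]] \<open>h \<in> carrier H\<close> by blast
    then show ?thesis
      using that H.inv_closed[OF that] unfolding f_def alt_sum_def cnj_sum by (intro sum.cong refl) simp
  qed
  have Finv: "F (inv\<^bsub>H\<^esub> h) = cnj (F h)" if "h \<in> carrier H" for h
    unfolding F_def using psi_at_Irr H.Irr_genuine that by (intro H.alt_sum_inv) blast+
  define D where "D h = f h - F h" for h
  have "cip H D D = cip H f f - cip H f F - cip H F f + cip H F F"
    unfolding D_def[abs_def] by (simp add: cip_def algebra_simps sum.distrib sum_subtractf diff_divide_distrib add_divide_distrib)
  also have "cip H F f = cip H f F" by (rule H.cip_commute)
  also have "cip H f F = of_nat n" unfolding f_def F_def by (rule H.cip_alt_sums[OF cip_hk_psi_at])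
  also have "cip H F F = of_nat n" unfolding F_def by (rule H.cip_alt_sums[OF cip_psi_at])
  finally have DD: "cip H D D = cip H f f - of_nat n" by simp
  have "(\<Sum>h\<in>carrier H. (cmod (f h))\<^sup>2) = (\<Sum>h\<in>carrier H. if h \<in> ?Z then (real n)\<^sup>2 else 0)"
    by (intro sum.cong refl) (simp add: f)
  also have "\<dots> = real (card ?Z) * (real n)\<^sup>2"
    using H.fin_carrier by (subst sum.If_cases) (auto simp: Int_def)
  also have "\<dots> = real (n * card ?Z) * real n" by (simp add: power2_eq_square)
  also have "\<dots> \<le> ?c * real n" using full_cycles_in_H_le by (intro mult_right_mono) (simp_all del: of_nat_mult)
  finally have le: "(\<Sum>h\<in>carrier H. (cmod (f h))\<^sup>2) / ?c \<le> real n"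
    using H.card_carrier_pos by (simp add: field_simps)
  have "cip H D D = of_real ((\<Sum>h\<in>carrier H. (cmod (D h))\<^sup>2) / ?c)"
    by (rule H.cip_self_cmod) (simp add: D_def finv Finv)
  moreover have "cip H f f = of_real ((\<Sum>h\<in>carrier H. (cmod (f h))\<^sup>2) / ?c)"
    by (rule H.cip_self_cmod) (rule finv)
  ultimately have "of_real ((\<Sum>h\<in>carrier H. (cmod (D h))\<^sup>2) / ?c) =
      (of_real ((\<Sum>h\<in>carrier H. (cmod (f h))\<^sup>2) / ?c - real n) :: complex)"
    using DD by (simp only: of_real_diff of_real_of_nat_eq)
  then have "(\<Sum>h\<in>carrier H. (cmod (D h))\<^sup>2) / ?c \<le> 0" using le by (simp only: of_real_eq_iff)
  then have "(\<Sum>h\<in>carrier H. (cmod (D h))\<^sup>2) \<le> 0"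
    using H.card_carrier_pos by (simp add: divide_le_0_iff)
  moreover have "(cmod (D g))\<^sup>2 \<le> (\<Sum>h\<in>carrier H. (cmod (D h))\<^sup>2)"
    using H.fin_carrier g by (intro member_le_sum) auto
  ultimately have "(cmod (D g))\<^sup>2 \<le> 0" by linarith
  then show ?thesis using f[OF g] by (simp add: D_def F_def)
qed

lemma Irr_p'_Sym:
  assumes p: "prime p" and n: "n = p ^ k" and k: "k \<ge> 1"
  shows "Irr_p' p (sym_group n) = hk ` {..<n}"
proof -
  interpret S: fin_group "Sym_on {1..n}" by (rule fin_group_Sym_on) simp
  obtain \<sigma> where \<sigma>: "\<sigma> \<in> carrier H" "full_cycle {1..n} \<sigma>" by (rule full_cycle_exists)
  have x: "1 \<in> {1..n}" using n_pos by simp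
  then have ne: "{1..n} \<noteq> {}" by blast
  show ?thesis
    unfolding sym_group_eq_Sym_on
  proof (rule S.Irr_p'_eq[where Z = "{\<tau>. full_cycle {1..n} \<tau>}", OF _ _ _ _ _ _ p n k])
    show "hk ` {..<n} \<subseteq> Irr (Sym_on {1..n})" using hook_Irr[OF _ inj_rX] by auto
    show "inj_on hk {..<n}" using hook_inj[OF _ inj_rX] by simp
    show "alt_sum n hk g = (if g \<in> {\<tau>. full_cycle {1..n} \<tau>} then of_nat n else 0)"
      if "g \<in> carrier (Sym_on {1..n})" for g
      using alt_sum_hook[OF finite_atLeastAtMost inj_rX \<sigma>(2) ne, of g] that by simp
    show "{\<tau>. full_cycle {1..n} \<tau>} \<subseteq> carrier (Sym_on {1..n})" using full_cycleD by auto
    show "\<sigma> \<in> {\<tau>. full_cycle {1..n} \<tau>}" using \<sigma> by simp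
    show "\<sigma> [^]\<^bsub>Sym_on {1..n}\<^esub> n = \<one>\<^bsub>Sym_on {1..n}\<^esub>"
      using full_cycle_pow_card[OF \<sigma>(2)] by (simp add: Sym_on_pow)
    show "\<sigma> [^]\<^bsub>Sym_on {1..n}\<^esub> u \<in> {\<tau>. full_cycle {1..n} \<tau>}" if "coprime u p" for u :: nat
      using full_cycle_power[OF \<sigma>(2), of u] that n by (simp add: Sym_on_pow)
    show "\<exists>g\<in>carrier (Sym_on {1..n}). \<tau>' = g \<otimes>\<^bsub>Sym_on {1..n}\<^esub> \<tau> \<otimes>\<^bsub>Sym_on {1..n}\<^esub> inv\<^bsub>Sym_on {1..n}\<^esub> g"
      if "\<tau> \<in> {\<tau>. full_cycle {1..n} \<tau>}" "\<tau>' \<in> {\<tau>. full_cycle {1..n} \<tau>}" for \<tau> \<tau>'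
    proof -
      have fc: "full_cycle {1..n} \<tau>" "full_cycle {1..n} \<tau>'" using that by blast+
      obtain g where g: "g permutes {1..n}" "g \<circ> \<tau> = \<tau>' \<circ> g"
        by (rule full_cycle_conjugator[OF fc finite_atLeastAtMost x])
      then have c: "g \<in> carrier (Sym_on {1..n})" "\<tau> \<in> carrier (Sym_on {1..n})" "\<tau>' \<in> carrier (Sym_on {1..n})"
        using that full_cycleD by auto
      then have "\<tau>' = g \<otimes>\<^bsub>Sym_on {1..n}\<^esub> \<tau> \<otimes>\<^bsub>Sym_on {1..n}\<^esub> inv\<^bsub>Sym_on {1..n}\<^esub> g"
        using S.inv_solve_right[of \<tau>' "g \<circ> \<tau>" g] S.m_closed[OF c(1,2)] g(2) by simp
      then show ?thesis using c(1) by blast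
    qed
  qed
qed

lemma Irr_p'_H:
  assumes p: "prime p" and n: "n = p ^ k" and k: "k \<ge> 1"
  shows "Irr_p' p H = psi_at ` {..<n}"
proof -
  let ?Z = "{\<tau> \<in> carrier H. full_cycle {1..n} \<tau>}"
  obtain \<sigma> where \<sigma>: "\<sigma> \<in> carrier H" "full_cycle {1..n} \<sigma>" by (rule full_cycle_exists)
  show ?thesis
  proof (rule H.Irr_p'_eq[where Z = ?Z, OF psi_at_Irr psi_at_inj alt_sum_psi_at _ _ _ p n k])
    show "\<sigma> \<in> ?Z" using \<sigma> by simp
    show "\<sigma> [^]\<^bsub>H\<^esub> n = \<one>\<^bsub>H\<^esub>" using full_cycle_pow_card[OF \<sigma>(2)] by (simp add: H_pow)
    show "\<sigma> [^]\<^bsub>H\<^esub> u \<in> ?Z" if "coprime u p" for u :: nat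
    proof -
      have "coprime u (card {1..n})" using that n by simp
      then show ?thesis
        using full_cycle_power[OF \<sigma>(2) finite_atLeastAtMost, of u] H.nat_pow_closed[OF \<sigma>(1), of u]
        unfolding H_pow by blast
    qed
    show "\<exists>g\<in>carrier H. \<tau>' = g \<otimes>\<^bsub>H\<^esub> \<tau> \<otimes>\<^bsub>H\<^esub> inv\<^bsub>H\<^esub> g" if "\<tau> \<in> ?Z" "\<tau>' \<in> ?Z" for \<tau> \<tau>'
    proof -
      have c: "\<tau> \<in> carrier H" "\<tau>' \<in> carrier H" "full_cycle {1..n} \<tau>" "full_cycle {1..n} \<tau>'"
        using that by blast+
      obtain g where g: "g \<in> carrier H" "g \<circ> \<tau> = \<tau>' \<circ> g"
        by (rule full_cycle_conj_in_H[OF c(1,3) c(2,4)])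
      then have "\<tau>' = g \<otimes>\<^bsub>H\<^esub> \<tau> \<otimes>\<^bsub>H\<^esub> inv\<^bsub>H\<^esub> g"
        using H.inv_solve_right[of \<tau>' "g \<circ> \<tau>" g] H.m_closed[OF g(1) c(1)] c by simp
      then show ?thesis using g(1) by blast
    qed
  qed auto
qed

text \<open>A star is some \<open>psi_at j\<close> and occurs in the restriction, which forces j =
  i. Conversely \<open>psi_at i\<close> occurs once and no other \<open>psi_at j\<close> occurs; as
  the \<open>psi_at\<close> exhaust \<open>Irr_p' p H\<close>, the remaining constituents have
  degree divisible by p.\<close>

lemma is_star_hk_iff:
  assumes p: "prime p" and n: "n = p ^ k" and k: "k \<ge> 1" and i: "i < n"
  shows "is_star p H (hk i) \<psi> \<longleftrightarrow> \<psi> = psi_at i"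
proof
  assume star: "is_star p H (hk i) \<psi>"
  then have "\<psi> \<in> Irr_p' p H" unfolding is_star_def by blast
  then obtain j where j: "j < n" "\<psi> = psi_at j" and cop: "coprime (char_degree H \<psi>) p"
    unfolding Irr_p'_def using Irr_p'_H[OF p n k] unfolding Irr_p'_def by auto
  obtain \<Delta> where \<Delta>: "sum_of_irr_div p H \<Delta>" "restrict (hk i) (carrier H) = (\<lambda>h\<in>carrier H. \<psi> h + \<Delta> h)"
    using star unfolding is_star_def by blast
  obtain M where M: "\<forall>\<theta>\<in>#M. \<theta> \<in> Irr H \<and> p dvd char_degree H \<theta>" "\<Delta> = (\<lambda>g\<in>carrier H. \<Sum>\<theta>\<in>#M. \<theta> g)"
    using \<Delta>(1) unfolding sum_of_irr_div_def by blast
  have eq: "hk i h = (\<Sum>\<theta>\<in>#add_mset \<psi> M. \<theta> h)" if "h \<in> carrier H" for h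
    using fun_cong[OF \<Delta>(2), of h] that M(2) by simp
  have \<psi>: "\<psi> \<in> Irr H" using psi_at_Irr j by blast
  have "cip H (hk i) \<psi> = of_nat (count (add_mset \<psi> M) \<psi>)"
    by (rule H.cip_genuine[OF _ eq \<psi>]) (use M(1) \<psi> in auto)
  then have "cip H (hk i) \<psi> \<noteq> 0" by (simp only: count_add_mset of_nat_eq_0_iff) simp
  then have "i = j" using cip_hk_psi_at[OF i j(1)] j(2) by (simp split: if_splits)
  then show "\<psi> = psi_at i" using j(2) by simp
next
  assume \<psi>: "\<psi> = psi_at i"
  obtain M where M: "set_mset M \<subseteq> Irr H" "\<forall>g\<in>carrier H. restrict (hk i) (carrier H) g = (\<Sum>\<theta>\<in>#M. \<theta> g)"
    using H.genuine_char_decompose[OF genuine_restrict[OF hk_genuine[OF i]]] by blast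
  then have eq: "hk i g = (\<Sum>\<theta>\<in>#M. \<theta> g)" if "g \<in> carrier H" for g using that by simp
  have cnt: "of_nat (count M (psi_at j)) = (if i = j then 1 else 0 :: complex)" if "j < n" for j
    using H.cip_genuine[OF M(1) eq, of "psi_at j"] psi_at_Irr that cip_hk_psi_at[OF i that] by auto
  have one: "count M \<psi> = 1" using cnt[OF i] \<psi> by simp
  then have "\<psi> \<in># M" by (simp flip: count_greater_zero_iff)
  then obtain M' where M': "M = add_mset \<psi> M'" by (rule multi_member_split[elim_format]) blast
  have "p dvd char_degree H \<theta>" if \<theta>: "\<theta> \<in># M'" for \<theta>
  proof (rule ccontr)
    assume "\<not> p dvd char_degree H \<theta>"
    then have "coprime (char_degree H \<theta>) p" using p by (simp add: coprime_commute prime_imp_coprime)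
    moreover have "\<theta> \<in> Irr H" using \<theta> M(1) M' by auto
    ultimately have "\<theta> \<in> Irr_p' p H" by (simp add: Irr_p'_def)
    \<comment> \<open>A further constituent of degree prime to p would be some
      \<open>psi_at j\<close>; the multiplicities force j = i, but its only copy has been removed
      from \<open>M\<close>.\<close>
    then obtain j where j: "j < n" "\<theta> = psi_at j" using Irr_p'_H[OF p n k] by auto
    have "count M (psi_at j) \<noteq> 0" using \<theta> M' j(2) by (simp add: count_eq_zero_iff)
    then have "i = j" using cnt[OF j(1)] by (metis of_nat_eq_0_iff)
    then have "\<theta> = \<psi>" using j(2) \<psi> by simp
    moreover have "count M' \<psi> = 0" using one M' by simp
    ultimately show False using \<theta> by (simp add: count_eq_zero_iff)
  qed
  then have "sum_of_irr_div p H (\<lambda>g\<in>carrier H. \<Sum>\<theta>\<in>#M'. \<theta> g)"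
    unfolding sum_of_irr_div_def using M(1) M' by auto
  moreover have "restrict (hk i) (carrier H) = (\<lambda>h\<in>carrier H. \<psi> h + (\<lambda>g\<in>carrier H. \<Sum>\<theta>\<in>#M'. \<theta> g) h)"
    using eq M' by (intro restrict_ext) simp
  moreover have "\<psi> \<in> Irr_p' p H" using Irr_p'_H[OF p n k] i \<psi> by blast
  ultimately show "is_star p H (hk i) \<psi>" unfolding is_star_def by blast
qed

text \<open>Both sets of characters are numbered by i < n, through \<open>hk\<close> and
  \<open>psi_at\<close>, and the star map preserves the number.\<close>

lemma star_bijection:
  assumes p: "prime p" and n: "n = p ^ k" and k: "k \<ge> 1"
  shows "\<forall>\<chi>\<in>Irr_p' p (sym_group n). \<exists>!\<psi>. is_star p H \<chi> \<psi>"
    and "bij_betw (\<lambda>\<chi>. THE \<psi>. is_star p H \<chi> \<psi>) (Irr_p' p (sym_group n)) (Irr_p' p H)"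
proof -
  show "\<forall>\<chi>\<in>Irr_p' p (sym_group n). \<exists>!\<psi>. is_star p H \<chi> \<psi>"
    unfolding Irr_p'_Sym[OF p n k] using is_star_hk_iff[OF p n k] by auto
  have "bij_betw psi_at {..<n} (Irr_p' p H)"
    unfolding Irr_p'_H[OF p n k] using psi_at_inj by (rule inj_on_imp_bij_betw)
  moreover have "(\<lambda>\<chi>. THE \<psi>. is_star p H \<chi> \<psi>) (hk i) = psi_at i" if "i < n" for i
    using is_star_hk_iff[OF p n k that] by simp
  ultimately have "bij_betw ((\<lambda>\<chi>. THE \<psi>. is_star p H \<chi> \<psi>) \<circ> hk) {..<n} (Irr_p' p H)"
    by (subst bij_betw_cong[where g = psi_at]) auto
  moreover have "bij_betw hk {..<n} (Irr_p' p (sym_group n))"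
    unfolding Irr_p'_Sym[OF p n k] using hook_inj[OF _ inj_rX] by (intro inj_on_imp_bij_betw) simp
  ultimately show "bij_betw (\<lambda>\<chi>. THE \<psi>. is_star p H \<chi> \<psi>) (Irr_p' p (sym_group n)) (Irr_p' p H)"
    using bij_betw_comp_iff by blast
qed

end

theorem theoremB:
  fixes p k :: nat and P :: "nat set set" and H :: "(nat \<Rightarrow> nat) monoid"
  assumes "prime p" and "odd p" and "k \<ge> 1"
    and "partition_on {1..p ^ k} P" and "card P = p" and "\<forall>B\<in>P. card B = p ^ (k - 1)"
    and "H = partition_stabilizer (p ^ k) P"
  shows "(\<forall>\<chi>\<in>Irr_p' p (sym_group (p ^ k)). \<exists>!\<psi>. is_star p H \<chi> \<psi>) \<and>
    bij_betw (\<lambda>\<chi>. THE \<psi>. is_star p H \<chi> \<psi>) (Irr_p' p (sym_group (p ^ k))) (Irr_p' p H)"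
proof -
  have p0: "p > 0" using assms(1) by (rule prime_gt_0_nat)
  have fin: "finite P" using finite_elements[OF finite_atLeastAtMost assms(4)] .
  \<comment> \<open>Numberings of the blocks and an order on them are chosen freely; the conclusion
    does not mention them.\<close>
  have "\<exists>b. bij_betw b {..<p ^ (k - 1)} B" if "B \<in> P" for B
    using assms(6) that p0 ex_bij_betw_nat_finite[of B] card_ge_0_finite[of B]
    by (simp add: lessThan_atLeast0)
  then obtain e where e: "\<And>B. B \<in> P \<Longrightarrow> bij_betw (e B) {..<p ^ (k - 1)} B" by metis
  obtain rk :: "nat set \<Rightarrow> nat" where rk: "inj_on rk P"
    using finite_imp_inj_to_nat_seg[OF fin] by blast
  interpret blocks "p ^ k" "p ^ (k - 1)" P e rk
    by unfold_locales (use assms p0 e rk in auto)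
  show ?thesis unfolding assms(7) using star_bijection[OF assms(1) refl assms(3)] by (intro conjI)
qed

end
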